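(* Let $p\in P^{Log}$ and $r\in\mathbb{N}$. There is a constant $C>0$ depending only on $p$ and $r$ such that for every $\sigma>0$ and every $f\in W_r^{p(\cdot)}$, $$A_\sigma(f)_{p(\cdot)}\le \frac{C}{\sigma^r}\,A_\sigma\big(f^{(r)}\big)_{p(\cdot)}.$$
   Context: $P$ is the class of measurable functions $p:\mathbb{R}\to[1,\infty)$ with $1\le \operatorname{ess\,inf}_{x\in\mathbb{R}}p(x)$ and $\operatorname{ess\,sup}_{x\in\mathbb{R}}p(x)<\infty$. $P^{Log}$ is the class of $p\in P$ for which there exist constants $c_1,c_2>0$ and $c_3\in\mathbb{R}$ with $|p(x)-p(y)|\ln(e+1/|x-y|)\le c_1$ for all $x,y\in\mathbb{R}$ and $|p(x)-c_3|\ln(e+|x|)\le c_2$ for all $x\in\mathbb{R}$. For $p\in P$, $L^{p(\cdot)}=L^{p(\cdot)}(\mathbb{R})$ is the Banach space of measurable $f:\mathbb{R}\to\mathbb{C}$ with $I_{p(\cdot)}(f/\lambda):=\int_{\mathbb{R}}|f(y)/\lambda|^{p(y)}dy<\infty$ for some $\lambda>0$, with norm $\|f\|_{p(\cdot)}=\inf\{\eta>0: I_{p(\cdot)}(f/\eta)<1\}$. For $r\in\mathbb{N}=\{1,2,\dots\}$, $W_r^{p(\cdot)}$ is the class of $f\in L^{p(\cdot)}$ such that $f^{(r-1)}$ is absolutely continuous and $f^{(r)}\in L^{p(\cdot)}$. For $\sigma>0$, $\mathcal{G}_{\sigma,p(\cdot)}$ is the class of entire functions of exponential type $\le\sigma$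 (whose restrictions to $\mathbb{R}$ are) belonging to $L^{p(\cdot)}$, and $A_\sigma(f)_{p(\cdot)}:=\inf\{\|f-g\|_{p(\cdot)}: g\in\mathcal{G}_{\sigma,p(\cdot)}\}$. *)

theory Defs
  imports "HOL-Complex_Analysis.Complex_Analysis" "HOL-Probability.Essential_Supremum"
begin

definition essinf :: "real measure \<Rightarrow> (real \<Rightarrow> ereal) \<Rightarrow> ereal" where
  "essinf M f = - esssup M (\<lambda>x. - f x)"

definition exponents :: "(real \<Rightarrow> real) set" where
  "exponents = {p. p \<in> borel_measurable lebesgue \<and> (\<forall>x. 1 \<le> p x) \<and>
     1 \<le> essinf lebesgue (\<lambda>x. ereal (p x)) \<and>
     esssup lebesgue (\<lambda>x. ereal (p x)) < \<infinity>}"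

(* For x = y the first condition reads 0 * ln (e + 1/0) \<le> c1, which holds trivially
   as 1/0 = 0; the condition is thus a condition on the pairs x \<noteq> y, as intended. *)
definition log_exponents :: "(real \<Rightarrow> real) set" where
  "log_exponents = {p \<in> exponents. \<exists>c1 c2 c3 :: real. c1 > 0 \<and> c2 > 0 \<and>
     (\<forall>x y. \<bar>p x - p y\<bar> * ln (exp 1 + 1 / \<bar>x - y\<bar>) \<le> c1) \<and>
     (\<forall>x. \<bar>p x - c3\<bar> * ln (exp 1 + \<bar>x\<bar>) \<le> c2)}"

definition modular :: "(real \<Rightarrow> real) \<Rightarrow> (real \<Rightarrow> complex) \<Rightarrow> ennreal" where
  "modular p f = (\<integral>\<^sup>+ y. ennreal (norm (f y) powr p y) \<partial>lebesgue)"

definition Lp :: "(real \<Rightarrow> real) \<Rightarrow> (real \<Rightarrow> complex) set" where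
  "Lp p = {f \<in> borel_measurable lebesgue.
     \<exists>t>0. modular p (\<lambda>y. f y / complex_of_real t) < \<infinity>}"

definition Lp_norm :: "(real \<Rightarrow> real) \<Rightarrow> (real \<Rightarrow> complex) \<Rightarrow> real" where
  "Lp_norm p f = Inf {\<eta>. \<eta> > 0 \<and> modular p (\<lambda>y. f y / complex_of_real \<eta>) < 1}"

definition abs_cont_on :: "real \<Rightarrow> real \<Rightarrow> (real \<Rightarrow> complex) \<Rightarrow> bool" where
  "abs_cont_on a b f \<longleftrightarrow> (\<forall>\<epsilon>>0. \<exists>\<delta>>0. \<forall>(n::nat) u v.
     (\<forall>i<n. a \<le> u i \<and> u i \<le> v i \<and> v i \<le> b) \<longrightarrow>
     disjoint_family_on (\<lambda>i. {u i<..<v i}) {..<n} \<longrightarrow>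
     (\<Sum>i<n. v i - u i) < \<delta> \<longrightarrow>
     (\<Sum>i<n. norm (f (v i) - f (u i))) < \<epsilon>)"

(* Absolute continuity of a function on the real line is understood on every compact interval. *)
definition abs_cont :: "(real \<Rightarrow> complex) \<Rightarrow> bool" where
  "abs_cont f \<longleftrightarrow> (\<forall>a b. a \<le> b \<longrightarrow> abs_cont_on a b f)"

(* The n-th pointwise derivative. Where a derivative does not exist, vector_derivative is
   an unspecified constant; for f in W below, the r-th derivative exists almost everywhere
   because f^(r-1) is absolutely continuous, so this affects only a null set. *)
definition nth_deriv :: "nat \<Rightarrow> (real \<Rightarrow> complex) \<Rightarrow> real \<Rightarrow> complex" where
  "nth_deriv n f = ((\<lambda>g x. vector_derivative g (at x)) ^^ n) f"

(* Meant for r \<ge> 1. The clause on k < r - 1 says that f^(r-1) exists on the whole line. *)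
definition W :: "nat \<Rightarrow> (real \<Rightarrow> real) \<Rightarrow> (real \<Rightarrow> complex) set" where
  "W r p = {f \<in> Lp p.
     (\<forall>k<r - 1. \<forall>x. nth_deriv k f differentiable at x) \<and>
     abs_cont (nth_deriv (r - 1) f) \<and> nth_deriv r f \<in> Lp p}"

definition exp_type_le :: "real \<Rightarrow> (complex \<Rightarrow> complex) \<Rightarrow> bool" where
  "exp_type_le \<sigma> g \<longleftrightarrow> (\<forall>\<epsilon>>0. \<exists>A. \<forall>z. norm (g z) \<le> A * exp ((\<sigma> + \<epsilon>) * norm z))"

definition G :: "real \<Rightarrow> (real \<Rightarrow> real) \<Rightarrow> (complex \<Rightarrow> complex) set" where
  "G \<sigma> p = {g. g holomorphic_on UNIV \<and> exp_type_le \<sigma> g \<and>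
     (\<lambda>x. g (complex_of_real x)) \<in> Lp p}"

definition best_approx :: "real \<Rightarrow> (real \<Rightarrow> real) \<Rightarrow> (real \<Rightarrow> complex) \<Rightarrow> real" where
  "best_approx \<sigma> p f = (INF g\<in>G \<sigma> p. Lp_norm p (\<lambda>x. f x - g (complex_of_real x)))"

end

theory Submission
  imports Defs
begin

text \<open>
  It suffices to approximate \<open>f\<close>, up to a constant times \<open>1 / \<sigma> ^ r\<close>, as well as an arbitrary
  entire function \<open>g\<close> of type \<open>\<sigma>\<close> in the space approximates the \<open>r\<close>-th derivative of \<open>f\<close>. The
  approximant of \<open>f\<close> must have the same type \<open>\<sigma>\<close> as \<open>g\<close>, so subtracting a smoothed copy of \<open>f\<close> that
  reproduces only functions of smaller type is not enough. Instead one starts by integrating \<open>g\<close>: a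
  primitive of an entire function of type \<open>\<sigma>\<close> is again entire of type \<open>\<sigma>\<close>. It need not belong to
  the space, but that is not required until the end.

  One step goes as follows. Let \<open>F\<close> be a derivative of \<open>f\<close> and let \<open>Q\<close> be entire of type \<open>\<sigma>\<close> such that
  \<open>h = F' - Q\<close> lies in the space. With a primitive \<open>P\<close> of \<open>Q\<close>, the function \<open>u = F - P\<close> has
  derivative \<open>h\<close>. Convolving \<open>u\<close>, which grows at most linearly, with a rapidly decaying kernel of
  exponential type \<open>\<sigma>\<close> and integral 1 yields an entire function of type \<open>\<sigma>\<close>, and the error is at most a
  constant times \<open>1/\<sigma>\<close> times the convolution of \<open>\<bar>h\<bar>\<close> with a kernel of width \<open>1/\<sigma>\<close>
  (\<open>approximation_of_primitive\<close>). Hence \<open>F\<close> is approximated by the sum of \<open>P\<close> and the convolution, both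
  of type \<open>\<sigma>\<close>, with an error at most a constant times \<open>1/\<sigma>\<close> times the norm of \<open>h\<close>. Starting with
  \<open>Q = g\<close> and iterating \<open>r\<close> times reaches \<open>f\<close>. The last approximant differs from \<open>f\<close> by an element of
  the space, so it lies in the space as well.

  Two analytic facts carry this argument. The first is that convolution with rapidly decaying kernels
  is bounded on the variable exponent space uniformly in the width (\<open>kernel_domination_norm_bound\<close>),
  also when \<open>p\<close> attains the value 1, where the maximal operator is not available. Writing \<open>a\<close> for half
  of the convolution at \<open>x\<close>, only values of the function above \<open>a\<close> matter, and for these the
  exponent \<open>p x\<close> can be exchanged for \<open>p y\<close>. If \<open>a \<ge> 1\<close>, then \<open>a \<le> \<sigma>\<close> and the local logarithmic
  condition bounds the cost by a power of \<open>1 + \<sigma> \<bar>x - y\<bar>\<close>; if \<open>a < 1\<close>, the decay condition allows the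
  detour through the limit of \<open>p\<close> at infinity.

  The second is that an absolutely continuous function is differentiable almost everywhere and is the
  integral of its derivative (\<open>AC_on_complex_differentiable_ae\<close> and
  \<open>fundamental_theorem_of_calculus_AC\<close>). It is needed once, for the derivative of order \<open>r - 1\<close>, and
  is proved from the Vitali covering theorem and a gauge argument.
\<close>

section \<open>Absolutely continuous functions\<close>

text \<open>A pair \<open>(u, v)\<close> stands for the interval from \<open>u\<close> to \<open>v\<close>; intervals may share end points
  and may be degenerate.\<close>
definition nonoverlapping :: "real \<Rightarrow> real \<Rightarrow> (real \<times> real) set \<Rightarrow> bool" where
  "nonoverlapping a b S \<longleftrightarrow> finite S \<and> (\<forall>s\<in>S. a \<le> fst s \<and> fst s \<le> snd s \<and> snd s \<le> b) \<and>
     pairwise (\<lambda>s t. disjnt {fst s<..<snd s} {fst t<..<snd t}) S"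

text \<open>Absolute continuity tested on finite sets of intervals rather than on indexed families, so that
  sums over tagged divisions and Vitali covers can be inserted directly.\<close>
definition AC_on :: "real \<Rightarrow> real \<Rightarrow> (real \<Rightarrow> 'a::real_normed_vector) \<Rightarrow> bool" where
  "AC_on a b F \<longleftrightarrow> (\<forall>e>0. \<exists>d>0. \<forall>S. nonoverlapping a b S \<longrightarrow>
     (\<Sum>s\<in>S. snd s - fst s) < d \<longrightarrow> (\<Sum>s\<in>S. norm (F (snd s) - F (fst s))) < e)"

lemma AC_onD:
  assumes "AC_on a b F" "e > 0"
  obtains d where "d > 0" "\<And>S. nonoverlapping a b S \<Longrightarrow>
     (\<Sum>s\<in>S. snd s - fst s) < d \<Longrightarrow> (\<Sum>s\<in>S. norm (F (snd s) - F (fst s))) < e"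
  using assms unfolding AC_on_def by meson

lemma abs_cont_on_imp_AC_on:
  assumes "abs_cont_on a b F"
  shows "AC_on a b F"
  unfolding AC_on_def
proof (intro allI impI)
  fix e :: real assume "e > 0"
  then obtain d where d: "d > 0" and D: "\<And>(n::nat) u v.
     (\<forall>i<n. a \<le> u i \<and> u i \<le> v i \<and> v i \<le> b) \<Longrightarrow>
     disjoint_family_on (\<lambda>i. {u i<..<v i}) {..<n} \<Longrightarrow>
     (\<Sum>i<n. v i - u i) < d \<Longrightarrow> (\<Sum>i<n. norm (F (v i) - F (u i))) < e"
    using assms unfolding abs_cont_on_def by (elim allE[of _ e] impE) blast+
  show "\<exists>d>0. \<forall>S. nonoverlapping a b S \<longrightarrow>
     (\<Sum>s\<in>S. snd s - fst s) < d \<longrightarrow> (\<Sum>s\<in>S. norm (F (snd s) - F (fst s))) < e"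
  proof (intro exI[of _ d] conjI d allI impI)
    fix S :: "(real \<times> real) set"
    assume no: "nonoverlapping a b S" and lt: "(\<Sum>s\<in>S. snd s - fst s) < d"
    have S: "finite S" "\<forall>s\<in>S. a \<le> fst s \<and> fst s \<le> snd s \<and> snd s \<le> b"
      "pairwise (\<lambda>s t. disjnt {fst s<..<snd s} {fst t<..<snd t}) S"
      using no by (auto simp: nonoverlapping_def)
    obtain h where h: "bij_betw h {..<card S} S"
      using ex_bij_betw_nat_finite[OF S(1)] by (auto simp: atLeast0LessThan)
    have hS: "h i \<in> S" if "i < card S" for i using h that by (auto simp: bij_betw_def)
    have "(\<Sum>i<card S. norm (F (snd (h i)) - F (fst (h i)))) < e"
    proof (rule D)
      show "disjoint_family_on (\<lambda>i. {fst (h i)<..<snd (h i)}) {..<card S}"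
        unfolding disjoint_family_on_def
      proof (intro ballI impI)
        fix m n assume "m \<in> {..<card S}" "n \<in> {..<card S}" "m \<noteq> n"
        then have "h m \<noteq> h n" "h m \<in> S" "h n \<in> S"
          using h hS by (auto simp: bij_betw_def inj_on_def)
        then show "{fst (h m)<..<snd (h m)} \<inter> {fst (h n)<..<snd (h n)} = {}"
          using S(3) unfolding pairwise_def disjnt_def by blast
      qed
      show "(\<Sum>i<card S. snd (h i) - fst (h i)) < d"
        using lt sum.reindex_bij_betw[OF h, of "\<lambda>s. snd s - fst s"] by simp
    qed (use hS S(2) in auto)
    then show "(\<Sum>s\<in>S. norm (F (snd s) - F (fst s))) < e"
      using sum.reindex_bij_betw[OF h, of "\<lambda>s. norm (F (snd s) - F (fst s))"] by simp
  qed
qed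

text \<open>Covers the real and imaginary parts, negation, and the subtraction of a Lipschitz function.\<close>
lemma AC_on_of_increment_le:
  assumes F: "AC_on a b F"
    and le: "\<And>x y. a \<le> x \<Longrightarrow> x \<le> y \<Longrightarrow> y \<le> b \<Longrightarrow> norm (H y - H x) \<le> norm (F y - F x) + B * (y - x)"
    and B: "B \<ge> 0"
  shows "AC_on a b H"
  unfolding AC_on_def
proof (intro allI impI)
  fix e :: real assume "e > 0"
  then obtain d where d: "d > 0" and D: "\<And>S. nonoverlapping a b S \<Longrightarrow>
     (\<Sum>s\<in>S. snd s - fst s) < d \<Longrightarrow> (\<Sum>s\<in>S. norm (F (snd s) - F (fst s))) < e/2"
    using AC_onD[OF F half_gt_zero[OF \<open>e > 0\<close>]] by blast
  define d' where "d' = min d (e / (2 * (B + 1)))"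
  have d': "d' > 0" using d \<open>e>0\<close> B by (auto simp: d'_def)
  show "\<exists>d>0. \<forall>S. nonoverlapping a b S \<longrightarrow>
     (\<Sum>s\<in>S. snd s - fst s) < d \<longrightarrow> (\<Sum>s\<in>S. norm (H (snd s) - H (fst s))) < e"
  proof (intro exI[of _ d'] conjI d' allI impI)
    fix S :: "(real \<times> real) set"
    assume no: "nonoverlapping a b S" and lt: "(\<Sum>s\<in>S. snd s - fst s) < d'"
    have S: "\<forall>s\<in>S. a \<le> fst s \<and> fst s \<le> snd s \<and> snd s \<le> b"
      using no by (auto simp: nonoverlapping_def)
    have 1: "(\<Sum>s\<in>S. norm (F (snd s) - F (fst s))) < e/2"
      by (rule D) (use no lt in \<open>auto simp: d'_def\<close>)
    have "(\<Sum>s\<in>S. snd s - fst s) \<le> e / (2 * (B + 1))" using lt by (auto simp: d'_def)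
    then have "B * (\<Sum>s\<in>S. snd s - fst s) \<le> B * (e / (2 * (B + 1)))" using B by (intro mult_left_mono)
    also have "\<dots> \<le> e/2" using B \<open>e>0\<close> by (simp add: field_simps)
    finally have 2: "B * (\<Sum>s\<in>S. snd s - fst s) \<le> e/2" .
    have "(\<Sum>s\<in>S. norm (H (snd s) - H (fst s))) \<le> (\<Sum>s\<in>S. norm (F (snd s) - F (fst s)) + B * (snd s - fst s))"
      by (intro sum_mono le) (use S in auto)
    also have "\<dots> < e" using 1 2 by (simp add: sum.distrib sum_distrib_left)
    finally show "(\<Sum>s\<in>S. norm (H (snd s) - H (fst s))) < e" .
  qed
qed

lemma AC_on_imp_continuous:
  assumes F: "AC_on a b F"
  shows "continuous_on {a..b} F"
proof (rule continuous_onI)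
  fix x e :: real assume x: "x \<in> {a..b}" and "e > 0"
  obtain d where d: "d > 0" and D: "\<And>S. nonoverlapping a b S \<Longrightarrow>
     (\<Sum>s\<in>S. snd s - fst s) < d \<Longrightarrow> (\<Sum>s\<in>S. norm (F (snd s) - F (fst s))) < e"
    using AC_onD[OF F \<open>e>0\<close>] by blast
  show "\<exists>d>0. \<forall>x'\<in>{a..b}. dist x' x < d \<longrightarrow> dist (F x') (F x) \<le> e"
  proof (intro exI[of _ d] conjI d ballI impI)
    fix y assume y: "y \<in> {a..b}" "dist y x < d"
    show "dist (F y) (F x) \<le> e"
    proof (cases "x \<le> y")
      case True
      then show ?thesis using D[of "{(x,y)}"] x y by (auto simp: nonoverlapping_def dist_norm)
    next
      case False
      then show ?thesis using D[of "{(y,x)}"] x y by (auto simp: nonoverlapping_def dist_norm norm_minus_commute)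
    qed
  qed
qed

text \<open>The gaps left by finitely many intervals inside \<open>[c, d]\<close>. The increments of every function \<open>F\<close>
  over the gaps telescope against those over the intervals; with \<open>F\<close> the identity this gives the
  total length of the gaps. The intervals are removed one at a time, from the right.\<close>
lemma complementary_intervals:
  fixes P :: "(real \<times> real) set"
  assumes "finite P" "c \<le> d" "\<And>s. s \<in> P \<Longrightarrow> c \<le> fst s \<and> fst s < snd s \<and> snd s \<le> d"
    and "pairwise (\<lambda>s t. disjnt {fst s<..<snd s} {fst t<..<snd t}) P"
  shows "\<exists>R. nonoverlapping c d R \<and>
     (\<forall>F::real\<Rightarrow>real. (\<Sum>s\<in>R. F (snd s) - F (fst s)) = F d - F c - (\<Sum>s\<in>P. F (snd s) - F (fst s)))"
  using assms
proof (induction arbitrary: d rule: finite_ranking_induct[where f = snd])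
  case empty
  show ?case by (rule exI[of _ "{(c,d)}"]) (use empty in \<open>auto simp: nonoverlapping_def\<close>)
next
  case (insert x P)
  show ?case
  proof (cases "x \<in> P")
    case True
    then show ?thesis using insert by (simp add: insert_absorb)
  next
    case False
    obtain u v where x: "x = (u,v)" by (cases x)
    have uv: "c \<le> u" "u < v" "v \<le> d" using insert.prems(2)[of x] x by auto
    have P: "snd s \<le> u" if "s \<in> P" for s
    proof (rule ccontr)
      assume "\<not> snd s \<le> u"
      then have "max u (fst s) < snd s" using insert.prems(2)[of s] that by auto
      then obtain z where z: "max u (fst s) < z" "z < snd s" using dense by blast
      have "disjnt {fst s<..<snd s} {u<..<v}"
        using insert.prems(3) that False x unfolding pairwise_def by force
      moreover have "z \<in> {fst s<..<snd s}" "z \<in> {u<..<v}"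
        using z insert.hyps(2)[OF that] x by auto
      ultimately show False by (auto simp: disjnt_iff)
    qed
    have "\<exists>R. nonoverlapping c u R \<and>
       (\<forall>F::real\<Rightarrow>real. (\<Sum>s\<in>R. F (snd s) - F (fst s)) = F u - F c - (\<Sum>s\<in>P. F (snd s) - F (fst s)))"
    proof (rule insert.IH)
      show "\<And>s. s \<in> P \<Longrightarrow> c \<le> fst s \<and> fst s < snd s \<and> snd s \<le> u"
        using insert.prems(2) P by auto
      show "pairwise (\<lambda>s t. disjnt {fst s<..<snd s} {fst t<..<snd t}) P"
        using insert.prems(3) by (rule pairwise_subset) auto
    qed (use uv in auto)
    then obtain R where R: "finite R" "\<forall>s\<in>R. c \<le> fst s \<and> fst s \<le> snd s \<and> snd s \<le> u"
      "pairwise (\<lambda>s t. disjnt {fst s<..<snd s} {fst t<..<snd t}) R"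
      "\<And>F::real\<Rightarrow>real. (\<Sum>s\<in>R. F (snd s) - F (fst s)) = F u - F c - (\<Sum>s\<in>P. F (snd s) - F (fst s))"
      unfolding nonoverlapping_def by blast
    have new: "(v,d) \<notin> R" using R(2) uv by fastforce
    show ?thesis
      unfolding nonoverlapping_def
    proof (intro exI[of _ "insert (v,d) R"] conjI ballI allI)
      show "pairwise (\<lambda>s t. disjnt {fst s<..<snd s} {fst t<..<snd t}) (insert (v,d) R)"
        using R(2,3) uv by (fastforce simp: pairwise_insert disjnt_iff)
      show "(\<Sum>s\<in>insert (v,d) R. F (snd s) - F (fst s)) = F d - F c - (\<Sum>s\<in>insert x P. F (snd s) - F (fst s))" for F :: "real\<Rightarrow>real"
        using R(1,4) new False insert.hyps(1) x by simp
    qed (use R uv in auto)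
  qed
qed

text \<open>The Vitali covering theorem for fine interval covers, truncated to a finite subfamily by
  continuity of measure and kept inside a prescribed open set.\<close>
lemma Vitali_finite_intervals:
  fixes K :: "(real \<times> real) set"
  assumes E: "E \<in> lmeasurable" and U: "open U" "E \<subseteq> U" and "e > 0"
    and K: "\<And>x d. x \<in> E \<Longrightarrow> d > 0 \<Longrightarrow> \<exists>s\<in>K. fst s < x \<and> x < snd s \<and> snd s - fst s < d"
  obtains C where "finite C" "C \<subseteq> K" "\<And>s. s \<in> C \<Longrightarrow> fst s < snd s \<and> {fst s..snd s} \<subseteq> U"
    "pairwise (\<lambda>s t. disjnt {fst s..snd s} {fst t..snd t}) C"
    "measure lebesgue (E - (\<Union>s\<in>C. {fst s..snd s})) < e"
proof -
  define K' where "K' = {s\<in>K. fst s < snd s \<and> {fst s..snd s} \<subseteq> U}"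
  define m r where "m s = (fst s + snd s) / 2" and "r s = (snd s - fst s) / 2" for s :: "real \<times> real"
  have cb: "cball (m s) (r s) = {fst s..snd s}" for s
    by (auto simp: cball_eq_atLeastAtMost m_def r_def field_simps)
  obtain C where C: "countable C" "C \<subseteq> K'"
     "pairwise (\<lambda>i j. disjnt (cball (m i) (r i)) (cball (m j) (r j))) C"
     "negligible(E - (\<Union>i \<in> C. cball (m i) (r i)))"
  proof (rule Vitali_covering_theorem_cballs[of K' r E m])
    show "0 < r i" if "i \<in> K'" for i using that by (auto simp: K'_def r_def)
    show "\<exists>i. i \<in> K' \<and> x \<in> cball (m i) (r i) \<and> r i < d" if xE: "x \<in> E" and d0: "d > 0" for x d
    proof -
      obtain d1 where d1: "d1 > 0" "ball x d1 \<subseteq> U" using U xE by (metis openE subsetD)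
      obtain s where s: "s \<in> K" "fst s < x" "x < snd s" "snd s - fst s < min d d1"
        using K[OF xE, of "min d d1"] d0 d1 by auto
      have "{fst s..snd s} \<subseteq> ball x d1" using s by (auto simp: dist_real_def)
      then have "s \<in> K'" using s d1 by (auto simp: K'_def)
      then show ?thesis using s d0 unfolding cb by (intro exI[of _ s]) (auto simp: r_def)
    qed
  qed
  define g where "g n = (if C = {} then {} else {fst (from_nat_into C n)..snd (from_nat_into C n)})" for n
  define A where "A n = E - (\<Union>i\<le>n. g i)" for n
  have gl: "g n \<in> lmeasurable" for n by (auto simp: g_def)
  have Am: "A n \<in> lmeasurable" for n unfolding A_def
    by (intro fmeasurable.Diff E fmeasurable.finite_UN) (auto simp: gl)
  have Ug0: "(\<Union>n. g n) = (\<Union>i\<in>from_nat_into C ` UNIV. {fst i..snd i})" if "C \<noteq> {}"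
    using that by (simp add: g_def)
  have Ug: "(\<Union>n. g n) = (\<Union>i \<in> C. cball (m i) (r i))"
    unfolding cb using Ug0 range_from_nat_into[OF _ C(1)] by (cases "C = {}") (auto simp: g_def)
  have "(\<lambda>n. measure lebesgue (A n)) \<longlonglongrightarrow> measure lebesgue (\<Inter>n. A n)"
  proof (rule Lim_measure_decseq)
    show "range A \<subseteq> sets lebesgue" using Am by auto
    show "decseq A" unfolding decseq_def A_def by force
    show "emeasure lebesgue (A i) \<noteq> \<infinity>" for i using fmeasurableD2[OF Am] by simp
  qed
  moreover have "(\<Inter>n. A n) = E - (\<Union>i \<in> C. cball (m i) (r i))"
    unfolding Ug[symmetric] A_def by auto
  moreover have "measure lebesgue (E - (\<Union>i \<in> C. cball (m i) (r i))) = 0"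
    using C(4) negligible_imp_measure0 by blast
  ultimately have "(\<lambda>n. measure lebesgue (A n)) \<longlonglongrightarrow> 0" by simp
  then have "\<forall>\<^sub>F n in sequentially. measure lebesgue (A n) < e"
    using \<open>e>0\<close> by (rule order_tendstoD)
  then obtain n where n: "measure lebesgue (A n) < e" by (auto simp: eventually_sequentially)
  define C' where "C' = (if C = {} then {} else from_nat_into C ` {..n})"
  have C'C: "C' \<subseteq> C" unfolding C'_def using from_nat_into[of C] by (cases "C = {}") auto
  show ?thesis
  proof
    show "finite C'" by (simp add: C'_def)
    show "C' \<subseteq> K" using C'C C(2) by (auto simp: K'_def)
    show "\<And>s. s \<in> C' \<Longrightarrow> fst s < snd s \<and> {fst s..snd s} \<subseteq> U"
      using C'C C(2) by (auto simp: K'_def)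
    show "pairwise (\<lambda>s t. disjnt {fst s..snd s} {fst t..snd t}) C'"
      using C(3) C'C unfolding cb by (rule pairwise_subset)
    have "A n = E - (\<Union>s\<in>C'. {fst s..snd s})"
      unfolding A_def C'_def g_def by (cases "C = {}") auto
    then show "measure lebesgue (E - (\<Union>s\<in>C'. {fst s..snd s})) < e" using n by simp
  qed
qed

section \<open>Almost everywhere differentiability\<close>

text \<open>A condition that forces the upper derivate of \<open>F\<close> at \<open>x\<close>, taken over intervals around \<open>x\<close>, to be at
  least \<open>k\<close> and that holds whenever it exceeds \<open>k\<close>. The strict
  inequalities make the condition open, which is what makes the set of steep points a
  \<open>G\<^sub>\<delta>\<close> set, hence measurable.\<close>
definition steep :: "(real \<Rightarrow> real) \<Rightarrow> real \<Rightarrow> real \<Rightarrow> bool" where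
  "steep F k x \<longleftrightarrow> (\<forall>d>0. \<exists>u v. u < x \<and> x < v \<and> v - u < d \<and> F v - F u > k * (v - u))"

lemma steep_set_borel [measurable]: "{x. steep F k x} \<in> sets borel"
proof -
  have "{x. steep F k x} =
      (\<Inter>n::nat. \<Union>s\<in>{s. snd s - fst s < 1 / (n+1) \<and> F (snd s) - F (fst s) > k * (snd s - fst s)}. {fst s<..<snd s})"
    (is "?A = ?B")
  proof
    show "?A \<subseteq> ?B"
    proof
      fix x assume x: "x \<in> ?A"
      show "x \<in> ?B"
      proof
        fix n :: nat
        have "1 / (real n + 1) > 0" by simp
        then obtain u v where "u < x \<and> x < v \<and> v - u < 1 / (real n + 1) \<and> F v - F u > k * (v - u)"
          using x unfolding steep_def by blast
        then show "x \<in> (\<Union>s\<in>{s. snd s - fst s < 1 / (real n + 1) \<and> F (snd s) - F (fst s) > k * (snd s - fst s)}. {fst s<..<snd s})"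
          by (intro UN_I[of "(u,v)"]) auto
      qed
    qed
    show "?B \<subseteq> ?A"
    proof
      fix x assume x: "x \<in> ?B"
      show "x \<in> ?A" unfolding steep_def mem_Collect_eq
      proof (intro allI impI)
        fix d :: real assume "d > 0"
        then obtain n :: nat where n: "1 / (n+1) < d"
          using nat_approx_posE by (metis Suc_eq_plus1 of_nat_Suc add.commute)
        have "x \<in> (\<Union>s\<in>{s. snd s - fst s < 1 / (real n + 1) \<and> F (snd s) - F (fst s) > k * (snd s - fst s)}. {fst s<..<snd s})"
          using x by (rule INT_D) simp
        then obtain s where "snd s - fst s < 1 / (1 + real n)" "F (snd s) - F (fst s) > k * (snd s - fst s)" "x \<in> {fst s<..<snd s}"
          by (auto simp: add.commute)
        then show "\<exists>u v. u < x \<and> x < v \<and> v - u < d \<and> F v - F u > k * (v - u)"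
          using n by (intro exI[of _ "fst s"] exI[of _ "snd s"]) auto
      qed
    qed
  qed
  also have "\<dots> \<in> sets borel"
    by (intro sets.countable_INT) (auto intro!: borel_open open_UN)
  finally show ?thesis .
qed

lemma measure_Union_disjoint_intervals:
  fixes C :: "(real \<times> real) set"
  assumes "finite C" "\<And>s. s \<in> C \<Longrightarrow> fst s < snd s"
    "pairwise (\<lambda>s t. disjnt {fst s..snd s} {fst t..snd t}) C"
  shows "measure lebesgue (\<Union>s\<in>C. {fst s..snd s}) = (\<Sum>s\<in>C. snd s - fst s)"
proof -
  have "measure lebesgue (\<Union>s\<in>C. {fst s..snd s}) = (\<Sum>s\<in>C. measure lebesgue {fst s..snd s})"
    by (rule measure_UNION') (use assms in auto)
  also have "\<dots> = (\<Sum>s\<in>C. snd s - fst s)"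
    by (intro sum.cong) (use assms(2) in \<open>auto simp: less_imp_le\<close>)
  finally show ?thesis .
qed

text \<open>Suppose the set \<open>E\<close> had measure \<open>\<mu> > 0\<close>. Cover it up to a small error by disjoint intervals along
  which \<open>F\<close> falls with slope below \<open>-k\<close>, and cover it again, inside these intervals, by disjoint
  intervals along which \<open>F\<close> rises with slope above \<open>k\<close>. Both families have total length close to
  \<open>\<mu>\<close>, so the gaps between them have small total length; yet over the gaps \<open>F\<close> must fall by about
  \<open>2 k \<mu>\<close>. This contradicts absolute continuity.\<close>
lemma negligible_two_sided_steep:
  assumes F: "AC_on a b F" and k: "k > 0"
  shows "negligible ({a<..<b} \<inter> {x. steep F k x} \<inter> {x. steep (\<lambda>y. - F y) k x})" (is "negligible ?E")
proof (rule ccontr)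
  assume neg: "\<not> negligible ?E"
  have Em: "?E \<in> lmeasurable"
  proof (rule bounded_set_imp_lmeasurable)
    show "bounded ?E" by (rule bounded_subset[of "{a<..<b}"]) auto
    show "?E \<in> sets lebesgue" using steep_set_borel by (auto intro!: sets.Int)
  qed
  define \<mu> where "\<mu> = measure lebesgue ?E"
  have \<mu>: "\<mu> > 0"
    using neg Em unfolding \<mu>_def
    by (metis measure_nonneg negligible_iff_measure order_le_less)
  obtain d where d: "d > 0" and D: "\<And>S. nonoverlapping a b S \<Longrightarrow>
     (\<Sum>s\<in>S. snd s - fst s) < d \<Longrightarrow> (\<Sum>s\<in>S. norm (F (snd s) - F (fst s))) < k * \<mu>"
    using AC_onD[OF F mult_pos_pos[OF k \<mu>]] by blast
  \<comment> \<open>Three errors of size \<open>\<eta>\<close> make up the length of the gaps; it must stay below \<open>d\<close>, while the second cover must keep at least half of \<open>\<mu>\<close>.\<close>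
  define \<eta> where "\<eta> = min (d/4) (\<mu>/4)"
  have \<eta>: "\<eta> > 0" "3 * \<eta> < d" "4 * \<eta> \<le> \<mu>" using d \<mu> by (auto simp: \<eta>_def)
  obtain T where T: "open T" "?E \<subseteq> T" "(T - ?E) \<in> lmeasurable" "emeasure lebesgue (T - ?E) < ennreal \<eta>"
    using sets_lebesgue_outer_open[of ?E \<eta>] Em \<eta> by blast
  define U where "U = T \<inter> {a<..<b}"
  have U: "open U" "?E \<subseteq> U" "U \<subseteq> {a<..<b}" using T by (auto simp: U_def)
  have Um: "U \<in> lmeasurable"
    by (rule bounded_set_imp_lmeasurable) (use U in \<open>auto intro: bounded_subset[of "{a<..<b}"]\<close>)
  have "measure lebesgue U \<le> measure lebesgue (?E \<union> (T - ?E))"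
    by (rule measure_mono_fmeasurable) (use fmeasurable.Un[OF Em T(3)] Um in \<open>auto simp: U_def\<close>)
  also have "\<dots> \<le> \<mu> + measure lebesgue (T - ?E)"
    unfolding \<mu>_def by (rule measure_Un_le) (use Em T in auto)
  also have "measure lebesgue (T - ?E) < \<eta>"
    using T(4) \<eta> by (simp add: emeasure_eq_measure2[OF T(3)] ennreal_less_iff)
  finally have mU: "measure lebesgue U < \<mu> + \<eta>" by simp
  define K1 where "K1 = {s::real\<times>real. F (snd s) - F (fst s) < - (k * (snd s - fst s))}"
  obtain C1 where C1: "finite C1" "C1 \<subseteq> K1" "\<And>s. s \<in> C1 \<Longrightarrow> fst s < snd s \<and> {fst s..snd s} \<subseteq> U"
    "pairwise (\<lambda>s t. disjnt {fst s..snd s} {fst t..snd t}) C1"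
    "measure lebesgue (?E - (\<Union>s\<in>C1. {fst s..snd s})) < \<eta>"
  proof (rule Vitali_finite_intervals[OF Em U(1,2) \<eta>(1), of K1])
    fix x d :: real assume x: "x \<in> ?E" "d > 0"
    then obtain u v where "u < x \<and> x < v \<and> v - u < d \<and> - F v - - F u > k * (v - u)"
      unfolding steep_def by blast
    then show "\<exists>s\<in>K1. fst s < x \<and> x < snd s \<and> snd s - fst s < d"
      by (intro bexI[of _ "(u,v)"]) (auto simp: K1_def)
  qed blast
  define V where "V = (\<Union>s\<in>C1. {fst s<..<snd s})"
  define E2 where "E2 = ?E \<inter> V"
  have Vo: "open V" unfolding V_def by auto
  have E2m: "E2 \<in> lmeasurable" unfolding E2_def
    by (rule fmeasurable.Int) (use Em Vo in \<open>auto simp: V_def intro!: fmeasurable.finite_UN C1(1)\<close>)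
  define K2 where "K2 = {s::real\<times>real. F (snd s) - F (fst s) > k * (snd s - fst s) \<and> (\<exists>t\<in>C1. fst t < fst s \<and> snd s < snd t)}"
  have E2V: "E2 \<subseteq> V" by (auto simp: E2_def)
  obtain C2 where C2: "finite C2" "C2 \<subseteq> K2" "\<And>s. s \<in> C2 \<Longrightarrow> fst s < snd s \<and> {fst s..snd s} \<subseteq> V"
    "pairwise (\<lambda>s t. disjnt {fst s..snd s} {fst t..snd t}) C2"
    "measure lebesgue (E2 - (\<Union>s\<in>C2. {fst s..snd s})) < \<eta>"
  proof (rule Vitali_finite_intervals[OF E2m Vo E2V \<eta>(1), of K2])
    fix x d :: real assume x: "x \<in> E2" "d > 0"
    then obtain t where t: "t \<in> C1" "fst t < x" "x < snd t" by (auto simp: E2_def V_def)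
    define d' where "d' = min d (min (x - fst t) (snd t - x))"
    have "d' > 0" using x t by (auto simp: d'_def)
    then obtain u v where uv: "u < x \<and> x < v \<and> v - u < d' \<and> F v - F u > k * (v - u)"
      using x unfolding E2_def steep_def by blast
    then have "(u,v) \<in> K2" unfolding K2_def using t by (auto simp: d'_def intro!: bexI[of _ t])
    then show "\<exists>s\<in>K2. fst s < x \<and> x < snd s \<and> snd s - fst s < d"
      using uv by (intro bexI[of _ "(u,v)"]) (auto simp: d'_def)
  qed blast
  define P where "P t = {s\<in>C2. fst t < fst s \<and> snd s < snd t}" for t
  have PC2: "(\<Union>t\<in>C1. P t) = C2" using C2(2) unfolding P_def K2_def by blast
  have finP: "finite (P t)" for t using C2(1) by (simp add: P_def)
  have mid: "s \<in> P t \<Longrightarrow> fst s \<in> {fst t..snd t}" for s t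
    using C2(3)[of s] unfolding P_def by auto
  have Pdis: "P t \<inter> P t' = {}" if "t \<in> C1" "t' \<in> C1" "t \<noteq> t'" for t t'
    using C1(4) that mid[of _ t] mid[of _ t'] unfolding pairwise_def disjnt_def by blast
  have "\<exists>R. t \<in> C1 \<longrightarrow> nonoverlapping (fst t) (snd t) R \<and>
     (\<forall>F::real\<Rightarrow>real. (\<Sum>s\<in>R. F (snd s) - F (fst s)) = F (snd t) - F (fst t) - (\<Sum>s\<in>P t. F (snd s) - F (fst s)))"
    for t
  proof (cases "t \<in> C1")
    case t: True
    have "\<exists>R. nonoverlapping (fst t) (snd t) R \<and>
      (\<forall>F::real\<Rightarrow>real. (\<Sum>s\<in>R. F (snd s) - F (fst s)) = F (snd t) - F (fst t) - (\<Sum>s\<in>P t. F (snd s) - F (fst s)))"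
    proof (rule complementary_intervals[OF finP])
    show "fst t \<le> snd t" using C1(3)[OF t] by simp
    show "\<And>s. s \<in> P t \<Longrightarrow> fst t \<le> fst s \<and> fst s < snd s \<and> snd s \<le> snd t"
      using C2(3) by (auto simp: P_def)
    have "disjnt {fst s<..<snd s} {fst t<..<snd t}" if "disjnt {fst s..snd s} {fst t..snd t}" for s t :: "real\<times>real"
      using that by (rule disjnt_subset1[OF disjnt_subset2]) auto
    then show "pairwise (\<lambda>s t. disjnt {fst s<..<snd s} {fst t<..<snd t}) (P t)"
      by (intro pairwise_mono[OF C2(4)]) (auto simp: P_def)
    qed
    then show ?thesis by blast
  qed simp
  then obtain R where "\<forall>t. t \<in> C1 \<longrightarrow> nonoverlapping (fst t) (snd t) (R t) \<and>
      (\<forall>F::real\<Rightarrow>real. (\<Sum>s\<in>R t. F (snd s) - F (fst s)) = F (snd t) - F (fst t) - (\<Sum>s\<in>P t. F (snd s) - F (fst s)))"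
    using choice[of "\<lambda>t R. t \<in> C1 \<longrightarrow> nonoverlapping (fst t) (snd t) R \<and>
      (\<forall>F::real\<Rightarrow>real. (\<Sum>s\<in>R. F (snd s) - F (fst s)) = F (snd t) - F (fst t) - (\<Sum>s\<in>P t. F (snd s) - F (fst s)))"]
    by blast
  then have R: "\<And>t. t \<in> C1 \<Longrightarrow> nonoverlapping (fst t) (snd t) (R t)"
     "\<And>t F. t \<in> C1 \<Longrightarrow> (\<Sum>s\<in>R t. F (snd s) - F (fst s)) = F (snd t) - (F (fst t) :: real) - (\<Sum>s\<in>P t. F (snd s) - F (fst s))"
    by blast+
  have Rin: "{fst s..snd s} \<subseteq> {fst t..snd t}" "fst s \<le> snd s" if "s \<in> R t" "t \<in> C1" for s t
    using R(1)[OF that(2)] that(1) unfolding nonoverlapping_def by auto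
  have finR: "finite (R t)" if "t \<in> C1" for t using R(1)[OF that] by (simp add: nonoverlapping_def)
  have Rd: "disjnt {fst s..snd s} {fst s'..snd s'}" if "s \<in> R t" "s' \<in> R t'" "t \<in> C1" "t' \<in> C1" "t \<noteq> t'" for s s' t t'
  proof -
    have "disjnt {fst t..snd t} {fst t'..snd t'}" using C1(4) that(3-5) unfolding pairwise_def by blast
    then show ?thesis by (rule disjnt_subset1[OF disjnt_subset2[OF _ Rin(1)[OF that(2,4)]] Rin(1)[OF that(1,3)]])
  qed
  have Rdis: "R t \<inter> R t' = {}" if "t \<in> C1" "t' \<in> C1" "t \<noteq> t'" for t t'
  proof (rule ccontr)
    assume "R t \<inter> R t' \<noteq> {}"
    then obtain s where s: "s \<in> R t" "s \<in> R t'" by blast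
    from Rd[OF s that] have "{fst s..snd s} = {}" by (simp add: disjnt_def)
    then show False using Rin(2)[OF s(1) that(1)] by simp
  qed
  let ?R = "\<Union>t\<in>C1. R t"
  have no: "nonoverlapping a b ?R"
    unfolding nonoverlapping_def
  proof (intro conjI ballI)
    show "finite ?R" using C1(1) finR by auto
    show "a \<le> fst s" "fst s \<le> snd s" "snd s \<le> b" if s: "s \<in> ?R" for s
    proof -
      obtain t where t: "t \<in> C1" "s \<in> R t" using s by blast
      have "{fst s..snd s} \<subseteq> {a<..<b}" using Rin(1)[OF t(2,1)] C1(3)[OF t(1)] U(3) by blast
      then show "a \<le> fst s" "fst s \<le> snd s" "snd s \<le> b" using Rin(2)[OF t(2,1)] by auto
    qed
    show "pairwise (\<lambda>s t. disjnt {fst s<..<snd s} {fst t<..<snd t}) ?R"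
    proof (rule pairwiseI)
      fix s s' assume s: "s \<in> ?R" "s' \<in> ?R" "s \<noteq> s'"
      obtain t t' where t: "t \<in> C1" "s \<in> R t" "t' \<in> C1" "s' \<in> R t'" using s by blast
      show "disjnt {fst s<..<snd s} {fst s'<..<snd s'}"
      proof (cases "t = t'")
        case True
        then show ?thesis using R(1)[OF t(1)] t s(3) unfolding nonoverlapping_def pairwise_def by blast
      next
        case False
        then have "disjnt {fst s..snd s} {fst s'..snd s'}" using Rd t by blast
        then show ?thesis by (rule disjnt_subset1[OF disjnt_subset2]) auto
      qed
    qed
  qed
  have sumR: "(\<Sum>s\<in>?R. H (snd s) - H (fst s)) = (\<Sum>t\<in>C1. H (snd t) - H (fst t)) - (\<Sum>s\<in>C2. H (snd s) - H (fst s))"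
    for H :: "real \<Rightarrow> real"
  proof -
    have "(\<Sum>s\<in>?R. H (snd s) - H (fst s)) = (\<Sum>t\<in>C1. \<Sum>s\<in>R t. H (snd s) - H (fst s))"
      by (rule sum.UNION_disjoint) (use C1(1) finR Rdis in auto)
    also have "\<dots> = (\<Sum>t\<in>C1. H (snd t) - H (fst t) - (\<Sum>s\<in>P t. H (snd s) - H (fst s)))"
      by (intro sum.cong R(2)) auto
    also have "\<dots> = (\<Sum>t\<in>C1. H (snd t) - H (fst t)) - (\<Sum>t\<in>C1. \<Sum>s\<in>P t. H (snd s) - H (fst s))"
      by (simp add: sum_subtractf)
    also have "(\<Sum>t\<in>C1. \<Sum>s\<in>P t. H (snd s) - H (fst s)) = (\<Sum>s\<in>(\<Union>t\<in>C1. P t). H (snd s) - H (fst s))"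
      by (rule sum.UNION_disjoint[symmetric]) (use C1(1) finP Pdis in auto)
    finally show ?thesis unfolding PC2 .
  qed
  define L1 L2 where "L1 = (\<Sum>s\<in>C1. snd s - fst s)" and "L2 = (\<Sum>s\<in>C2. snd s - fst s)"
  have mC1: "measure lebesgue (\<Union>s\<in>C1. {fst s..snd s}) = L1"
    unfolding L1_def using C1 by (intro measure_Union_disjoint_intervals) auto
  have mC2: "measure lebesgue (\<Union>s\<in>C2. {fst s..snd s}) = L2"
    unfolding L2_def using C2 by (intro measure_Union_disjoint_intervals) auto
  have L1: "L1 < \<mu> + \<eta>"
  proof -
    have "L1 \<le> measure lebesgue U" unfolding mC1[symmetric]
      by (rule measure_mono_fmeasurable) (use C1 Um in auto)
    then show ?thesis using mU by simp
  qed
  have L2: "L2 > \<mu> - 2 * \<eta>"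
  proof -
    let ?N = "fst ` C1 \<union> snd ` C1"
    have N0: "negligible ?N" by (intro negligible_finite) (use C1(1) in auto)
    then have Nm: "?N \<in> lmeasurable" by (simp add: negligible_iff_measure)
    have C1m: "(\<Union>s\<in>C1. {fst s..snd s}) \<in> lmeasurable" and C2m: "(\<Union>s\<in>C2. {fst s..snd s}) \<in> lmeasurable"
      by (intro fmeasurable.finite_UN; use C1(1) C2(1) in auto)+
    note fm = fmeasurable.Diff[OF Em C1m] fmeasurable.Diff[OF E2m C2m] C1m C2m Nm
    have "?E \<subseteq> (?E - (\<Union>s\<in>C1. {fst s..snd s})) \<union> ((\<Union>s\<in>C2. {fst s..snd s}) \<union> (E2 - (\<Union>s\<in>C2. {fst s..snd s})) \<union> ?N)"
    proof
      fix x assume x: "x \<in> ?E"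
      show "x \<in> (?E - (\<Union>s\<in>C1. {fst s..snd s})) \<union> ((\<Union>s\<in>C2. {fst s..snd s}) \<union> (E2 - (\<Union>s\<in>C2. {fst s..snd s})) \<union> ?N)"
      proof (cases "x \<in> (\<Union>s\<in>C1. {fst s..snd s})")
        case True
        then obtain s where s: "s \<in> C1" "fst s \<le> x" "x \<le> snd s" by auto
        then consider "x = fst s" | "x = snd s" | "x \<in> V" unfolding V_def by (force simp: less_le)
        then show ?thesis using x s(1) by cases (auto simp: E2_def)
      qed (use x in blast)
    qed
    then have "\<mu> \<le> measure lebesgue ((?E - (\<Union>s\<in>C1. {fst s..snd s})) \<union> ((\<Union>s\<in>C2. {fst s..snd s}) \<union> (E2 - (\<Union>s\<in>C2. {fst s..snd s})) \<union> ?N))"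
      unfolding \<mu>_def
      by (intro measure_mono_fmeasurable)
        (use Em in \<open>simp_all only: fmeasurableD fmeasurable.Un fm\<close>)
    also have "\<dots> \<le> measure lebesgue (?E - (\<Union>s\<in>C1. {fst s..snd s})) + (measure lebesgue (\<Union>s\<in>C2. {fst s..snd s})
        + measure lebesgue (E2 - (\<Union>s\<in>C2. {fst s..snd s})) + measure lebesgue ?N)"
      by (rule order_trans[OF measure_Un_le] add_mono order_refl; (simp only: fmeasurableD fmeasurable.Un fm)?)+
    also have "measure lebesgue ?N = 0"
      by (rule negligible_imp_measure0[OF N0])
    finally show ?thesis using C1(5) C2(5) mC2 by simp
  qed
  have "(\<Sum>s\<in>?R. snd s - fst s) = L1 - L2"
    using sumR[of "\<lambda>x. x"] by (simp add: L1_def L2_def)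
  then have "(\<Sum>s\<in>?R. snd s - fst s) < d" using L1 L2 \<eta> by simp
  \<comment> \<open>The gaps are short, so \<open>F\<close> changes little over them; but it has to make up for both covers.\<close>
  from D[OF no this] have less: "(\<Sum>s\<in>?R. norm (F (snd s) - F (fst s))) < k * \<mu>" .
  have "(\<Sum>t\<in>C1. F (snd t) - F (fst t)) \<le> (\<Sum>t\<in>C1. - k * (snd t - fst t))"
    by (intro sum_mono) (use C1(2) in \<open>force simp: K1_def\<close>)
  also have "\<dots> = - k * L1" unfolding L1_def sum_distrib_left ..
  finally have 1: "(\<Sum>t\<in>C1. F (snd t) - F (fst t)) \<le> - k * L1" .
  have "k * L2 = (\<Sum>t\<in>C2. k * (snd t - fst t))" unfolding L2_def sum_distrib_left ..
  also have "\<dots> \<le> (\<Sum>t\<in>C2. F (snd t) - F (fst t))"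
    by (intro sum_mono) (use C2(2) in \<open>force simp: K2_def\<close>)
  finally have "(\<Sum>s\<in>?R. F (snd s) - F (fst s)) \<le> - k * L1 - k * L2"
    using 1 unfolding sumR by simp
  moreover have "\<bar>\<Sum>s\<in>?R. F (snd s) - F (fst s)\<bar> \<le> (\<Sum>s\<in>?R. norm (F (snd s) - F (fst s)))"
    using sum_abs[of "\<lambda>s. F (snd s) - F (fst s)" ?R] by simp
  ultimately have "k * (L1 + L2) < k * \<mu>" using less unfolding distrib_left by linarith
  then have "L1 + L2 < \<mu>" using k by simp
  moreover have "L2 \<le> L1"
  proof -
    have "0 \<le> (\<Sum>s\<in>?R. snd s - fst s)" using no by (intro sum_nonneg) (auto simp: nonoverlapping_def)
    then show ?thesis using \<open>(\<Sum>s\<in>?R. snd s - fst s) = L1 - L2\<close> by simp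
  qed
  ultimately show False using L2 \<eta> by simp
qed

text \<open>If the points of infinite upper derivate had positive measure near \<open>x\<close>, disjoint intervals of
  total length below the \<open>\<delta>\<close> that belongs to \<open>\<epsilon> = 1\<close> would carry increments of \<open>F\<close> summing to more
  than 1.\<close>
lemma negligible_infinitely_steep:
  assumes F: "AC_on a b F"
  shows "negligible ({a<..<b} \<inter> {x. \<forall>n::nat. steep F (real n) x})" (is "negligible ?E")
  unfolding locally_negligible_alt[of ?E]
proof
  fix x assume x: "x \<in> ?E"
  obtain d where d: "d > 0" and D: "\<And>S. nonoverlapping a b S \<Longrightarrow>
     (\<Sum>s\<in>S. snd s - fst s) < d \<Longrightarrow> (\<Sum>s\<in>S. norm (F (snd s) - F (fst s))) < 1"
    using AC_onD[OF F zero_less_one] by blast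
  let ?U = "ball x (d/4) \<inter> {a<..<b}" and ?E' = "?E \<inter> ball x (d/4)"
  have "negligible ?E'"
  proof (rule ccontr)
    assume neg: "\<not> negligible ?E'"
    have Em: "?E' \<in> lmeasurable"
    proof (rule bounded_set_imp_lmeasurable)
      show "bounded ?E'" by (rule bounded_subset[of "{a<..<b}"]) auto
      have "{x. \<forall>n::nat. steep F (real n) x} = (\<Inter>n::nat. {x. steep F (real n) x})" by auto
      also have "\<dots> \<in> sets borel" by auto
      finally show "?E' \<in> sets lebesgue" by (auto intro!: sets.Int)
    qed
    define \<mu> where "\<mu> = measure lebesgue ?E'"
    have \<mu>: "\<mu> > 0"
      using neg Em unfolding \<mu>_def by (metis measure_nonneg negligible_iff_measure order_le_less)
    obtain n :: nat where n: "real n * (\<mu>/2) > 1"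
      using reals_Archimedean3[of "\<mu>/2"] \<mu> by (metis half_gt_zero)
    define K where "K = {s::real\<times>real. F (snd s) - F (fst s) > n * (snd s - fst s)}"
    have U: "open ?U" "?E' \<subseteq> ?U" by auto
    have "0 < \<mu>/2" using \<mu> by simp
    obtain C where C: "finite C" "C \<subseteq> K" "\<And>s. s \<in> C \<Longrightarrow> fst s < snd s \<and> {fst s..snd s} \<subseteq> ?U"
      "pairwise (\<lambda>s t. disjnt {fst s..snd s} {fst t..snd t}) C"
      "measure lebesgue (?E' - (\<Union>s\<in>C. {fst s..snd s})) < \<mu>/2"
    proof (rule Vitali_finite_intervals[OF Em U \<open>0 < \<mu>/2\<close>, of K])
      fix x d :: real assume x: "x \<in> ?E'" "d > 0"
      then have "steep F (real n) x" by blast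
      then obtain u v :: real where "u < x \<and> x < v \<and> v - u < d \<and> F v - F u > real n * (v - u)"
        using x(2) unfolding steep_def by blast
      then show "\<exists>s\<in>K. fst s < x \<and> x < snd s \<and> snd s - fst s < d"
        by (intro bexI[of _ "(u,v)"]) (auto simp: K_def)
    qed blast
    define L where "L = (\<Sum>s\<in>C. snd s - fst s)"
    have mC: "measure lebesgue (\<Union>s\<in>C. {fst s..snd s}) = L"
      unfolding L_def using C by (intro measure_Union_disjoint_intervals) auto
    have "\<mu> \<le> measure lebesgue ((\<Union>s\<in>C. {fst s..snd s}) \<union> (?E' - (\<Union>s\<in>C. {fst s..snd s})))"
      unfolding \<mu>_def by (intro measure_mono_fmeasurable)
        (use Em C(1) in \<open>auto intro!: fmeasurable.Un fmeasurable.Diff fmeasurable.finite_UN\<close>)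
    also have "\<dots> \<le> L + measure lebesgue (?E' - (\<Union>s\<in>C. {fst s..snd s}))"
      unfolding mC[symmetric] by (intro measure_Un_le) 
        (use Em C(1) in \<open>auto intro!: fmeasurableD sets.Diff sets.Un sets.finite_UN\<close>)
    finally have L: "L > \<mu>/2" using C(5) by simp
    have "L \<le> measure lebesgue (ball x (d/4))"
      unfolding mC[symmetric] by (rule measure_mono_fmeasurable) (use C in auto)
    also have "\<dots> = d/2" using d by (simp add: ball_eq_greaterThanLessThan)
    finally have "L < d" using d by simp
    have no: "nonoverlapping a b C"
      unfolding nonoverlapping_def
    proof (intro conjI ballI C(1))
      show "pairwise (\<lambda>s t. disjnt {fst s<..<snd s} {fst t<..<snd t}) C"
      proof (rule pairwise_mono[OF C(4)])
        show "disjnt {fst s<..<snd s} {fst t<..<snd t}" if "disjnt {fst s..snd s} {fst t..snd t}" for s t :: "real\<times>real"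
          using that by (rule disjnt_subset1[OF disjnt_subset2]) auto
      qed auto
      show "a \<le> fst s" "fst s \<le> snd s" "snd s \<le> b" if "s \<in> C" for s
      proof -
        have "fst s \<in> ?U" "snd s \<in> ?U" using C(3)[OF that] by (auto simp: subset_iff)
        then show "a \<le> fst s" "fst s \<le> snd s" "snd s \<le> b" using C(3)[OF that] by auto
      qed
    qed
    have "real n * L = (\<Sum>t\<in>C. n * (snd t - fst t))" unfolding L_def sum_distrib_left ..
    also have "\<dots> \<le> (\<Sum>s\<in>C. norm (F (snd s) - F (fst s)))"
      by (intro sum_mono) (use C(2) in \<open>force simp: K_def\<close>)
    also have "\<dots> < 1" using D[OF no] \<open>L < d\<close> by (simp add: L_def)
    finally have "real n * L < 1" .
    moreover have "real n * (\<mu>/2) \<le> real n * L" using L by (intro mult_left_mono) auto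
    ultimately show False using n by simp
  qed
  then show "\<exists>U. openin (top_of_set ?E) U \<and> x \<in> U \<and> negligible U"
    using x d by (intro exI[of _ ?E']) auto
qed

lemma not_steep_imp_quotient_le:
  assumes "\<not> steep F k x" "a < x" "x < b" and cont: "continuous_on {a..b} F"
  shows "\<forall>\<^sub>F y in at x. (F y - F x) / (y - x) \<le> k"
proof -
  obtain d where d: "d > 0" and D: "\<And>u v. u < x \<Longrightarrow> x < v \<Longrightarrow> v - u < d \<Longrightarrow> F v - F u \<le> k * (v - u)"
    using assms(1) unfolding steep_def by (meson not_le)
  have "isCont F x" using cont assms(2,3)
    by (metis at_within_Icc_at continuous_on_eq_continuous_within atLeastAtMost_iff less_imp_le)
  then have Fl: "(F \<longlongrightarrow> F x) (at_left x)" "(F \<longlongrightarrow> F x) (at_right x)"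
    by (simp_all add: isCont_def filterlim_at_split)
  have right: "F y - F x \<le> k * (y - x)" if y: "x < y" "y < x + d" for y
  proof (rule tendsto_le[OF trivial_limit_at_left_real])
    show "((\<lambda>u. k * (y - u)) \<longlongrightarrow> k * (y - x)) (at_left x)" by (intro tendsto_intros)
    show "((\<lambda>u. F y - F u) \<longlongrightarrow> F y - F x) (at_left x)" by (intro tendsto_intros Fl)
    have "\<forall>\<^sub>F u in at_left x. u \<in> {y - d <..<x}" using y by (intro eventually_at_left_real) auto
    then show "\<forall>\<^sub>F u in at_left x. F y - F u \<le> k * (y - u)"
      by eventually_elim (use y D in auto)
  qed
  have left: "F x - F y \<le> k * (x - y)" if y: "x - d < y" "y < x" for y
  proof (rule tendsto_le[OF trivial_limit_at_right_real])
    show "((\<lambda>u. k * (u - y)) \<longlongrightarrow> k * (x - y)) (at_right x)" by (intro tendsto_intros)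
    show "((\<lambda>u. F u - F y) \<longlongrightarrow> F x - F y) (at_right x)" by (intro tendsto_intros Fl)
    have "\<forall>\<^sub>F u in at_right x. u \<in> {x<..<y + d}" using y by (intro eventually_at_right_real) auto
    then show "\<forall>\<^sub>F u in at_right x. F u - F y \<le> k * (u - y)"
      by eventually_elim (use y D in auto)
  qed
  have "\<forall>\<^sub>F y in at x. y \<noteq> x \<and> dist y x < d"
    using d by (auto simp: eventually_at)
  then show ?thesis
  proof eventually_elim
    case (elim y)
    then consider "x < y" "y < x + d" | "x - d < y" "y < x" by (auto simp: dist_real_def abs_if split: if_splits)
    then show ?case
    proof cases
      case 1 then show ?thesis using right[of y] by (simp add: divide_le_eq)
    next
      case 2 then show ?thesis using left[of y] by (simp add: divide_le_eq algebra_simps)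
    qed
  qed
qed

text \<open>The limit of the difference quotients is the infimum \<open>L\<close> of their eventual upper bounds. A rational
  interval \<open>[m - k, m + k]\<close> just below \<open>L\<close> cannot bound the quotients from above, so by the
  dichotomy for \<open>F - m id\<close> its lower end bounds them from below.\<close>
lemma differentiable_of_not_steep:
  fixes F :: "real \<Rightarrow> real"
  assumes cont: "continuous_on {a..b} F" and x: "a < x" "x < b"
    and up: "\<not> steep F k1 x" and dn: "\<not> steep (\<lambda>y. - F y) k2 x"
    and two: "\<And>m k. m \<in> \<rat> \<Longrightarrow> k \<in> \<rat> \<Longrightarrow> k > 0 \<Longrightarrow>
      \<not> steep (\<lambda>y. F y - m * y) k x \<or> \<not> steep (\<lambda>y. - (F y - m * y)) k x"
  shows "F differentiable (at x)"
proof -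
  define q where "q y = (F y - F x) / (y - x)" for y
  have ne: "\<forall>\<^sub>F y in at x. y \<noteq> x" by (auto simp: eventually_at_filter)
  have A: "\<forall>\<^sub>F y in at x. q y \<le> m + k" if "\<not> steep (\<lambda>y. F y - m * y) k x" for m k
  proof (rule eventually_elim2[OF not_steep_imp_quotient_le[OF that x] ne])
    show "continuous_on {a..b} (\<lambda>y. F y - m * y)" by (intro continuous_intros cont)
    fix y assume y: "y \<noteq> x" and "((F y - m * y) - (F x - m * x)) / (y - x) \<le> k"
    moreover have "((F y - m * y) - (F x - m * x)) / (y - x) = q y - m"
      using y by (simp add: q_def field_simps)
    ultimately show "q y \<le> m + k" by simp
  qed
  have B: "\<forall>\<^sub>F y in at x. q y \<ge> m - k" if "\<not> steep (\<lambda>y. - (F y - m * y)) k x" for m k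
  proof (rule eventually_elim2[OF not_steep_imp_quotient_le[OF that x] ne])
    show "continuous_on {a..b} (\<lambda>y. - (F y - m * y))" by (intro continuous_intros cont)
    fix y assume y: "y \<noteq> x" and "(- (F y - m * y) - - (F x - m * x)) / (y - x) \<le> k"
    moreover have "(- (F y - m * y) - - (F x - m * x)) / (y - x) = m - q y"
      using y by (simp add: q_def field_simps)
    ultimately show "q y \<ge> m - k" by simp
  qed
  define S where "S = {c. \<forall>\<^sub>F y in at x. q y \<le> c}"
  have S1: "k1 \<in> S" using A[of 0 k1] up by (simp add: S_def)
  have low: "\<forall>\<^sub>F y in at x. q y \<ge> - k2" using B[of 0 k2] dn by simp
  have S2: "- k2 \<le> c" if "c \<in> S" for c
  proof -
    have "\<forall>\<^sub>F y in at x. q y \<le> c" using that by (simp add: S_def)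
    with low have "\<forall>\<^sub>F y in at x. - k2 \<le> c" by eventually_elim simp
    then show ?thesis by (simp add: eventually_const)
  qed
  have bdd: "bdd_below S" by (rule bdd_belowI) (rule S2)
  define L where "L = Inf S"
  have "(q \<longlongrightarrow> L) (at x)"
  proof (rule order_tendstoI)
    fix c assume "L < c"
    then obtain c' where c': "c' \<in> S" "c' < c" unfolding L_def using cInf_lessD[of S c] S1 by auto
    then have "\<forall>\<^sub>F y in at x. q y \<le> c'" by (simp add: S_def)
    then show "\<forall>\<^sub>F y in at x. q y < c" by eventually_elim (use c' in simp)
  next
    fix c assume "c < L"
    obtain r1 where r1: "r1 \<in> \<rat>" "c < r1" "r1 < L" using Rats_dense_in_real[OF \<open>c < L\<close>] by blast
    \<comment> \<open>Two rationals between \<open>c\<close> and \<open>L\<close> are the ends of the interval of centre \<open>m\<close> and half-width \<open>k\<close>.\<close>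
    obtain r2 where r2: "r2 \<in> \<rat>" "r1 < r2" "r2 < L" using Rats_dense_in_real[OF r1(3)] by blast
    define m k where "m = (r1 + r2)/2" and "k = (r2 - r1)/2"
    have mk: "m \<in> \<rat>" "k \<in> \<rat>" "k > 0" "m + k = r2" "m - k = r1"
      using r1 r2 by (auto simp: m_def k_def field_simps)
    have "r2 \<notin> S" using r2(3) cInf_lower[OF _ bdd, of r2] by (auto simp: L_def)
    then have "steep (\<lambda>y. F y - m * y) k x" using A[of m k] mk by (auto simp: S_def)
    then have "\<forall>\<^sub>F y in at x. q y \<ge> r1" using two[OF mk(1-3)] B[of m k] mk by auto
    then show "\<forall>\<^sub>F y in at x. c < q y" by eventually_elim (use r1 in simp)
  qed
  then have "(F has_field_derivative L) (at x)"
    by (simp add: has_field_derivative_iff q_def[abs_def])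
  then show ?thesis by (metis DERIV_deriv_iff_real_differentiable DERIV_imp_deriv)
qed

text \<open>Outside the countably many null sets obtained from all slopes \<open>m\<close> and half-widths \<open>k\<close> in the
  rationals, no two derivates can differ and none is infinite.\<close>
lemma AC_on_real_differentiable_ae:
  fixes F :: "real \<Rightarrow> real"
  assumes F: "AC_on a b F"
  shows "negligible {x\<in>{a<..<b}. \<not> F differentiable (at x)}"
proof -
  have Fm: "AC_on a b (\<lambda>y. F y - m * y)" for m
  proof (rule AC_on_of_increment_le[OF F, of _ "\<bar>m\<bar>"])
    fix x y :: real assume "x \<le> y"
    have "F y - m * y - (F x - m * x) = (F y - F x) - m * (y - x)" by (simp add: algebra_simps)
    then have "norm (F y - m * y - (F x - m * x)) \<le> norm (F y - F x) + norm (m * (y - x))"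
      using norm_triangle_ineq4 by metis
    then show "norm (F y - m * y - (F x - m * x)) \<le> norm (F y - F x) + \<bar>m\<bar> * (y - x)"
      using \<open>x \<le> y\<close> by (simp add: abs_mult)
  qed auto
  have Fn: "AC_on a b (\<lambda>y. - F y)"
    by (rule AC_on_of_increment_le[OF F, of _ 0]) (auto simp: abs_minus_commute)
  define A where "A m k = {a<..<b} \<inter> {x. steep (\<lambda>y. F y - m * y) k x} \<inter> {x. steep (\<lambda>y. - (F y - m * y)) k x}" for m k
  define Z where "Z = ({a<..<b} \<inter> {x. \<forall>n::nat. steep F (real n) x}) \<union> ({a<..<b} \<inter> {x. \<forall>n::nat. steep (\<lambda>y. - F y) (real n) x})
    \<union> \<Union>((\<lambda>(m,k). A m k) ` (\<rat> \<times> (\<rat> \<inter> {0<..})))"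
  have "negligible (\<Union>((\<lambda>(m,k). A m k) ` (\<rat> \<times> (\<rat> \<inter> {0<..}))))"
  proof (rule negligible_countable_Union)
    show "countable ((\<lambda>(m,k). A m k) ` (\<rat> \<times> (\<rat> \<inter> {0<..})))"
      by (intro countable_image countable_SIGMA countable_Int1 countable_rat)
    show "negligible X" if X: "X \<in> (\<lambda>(m,k). A m k) ` (\<rat> \<times> (\<rat> \<inter> {0<..}))" for X
    proof -
      obtain m k where "X = A m k" "k > 0" using X by auto
      then show ?thesis using negligible_two_sided_steep[OF Fm[of m], of k] by (simp add: A_def)
    qed
  qed
  then have "negligible Z" unfolding Z_def
    by (intro negligible_Un negligible_infinitely_steep F Fn)
  then show ?thesis
  proof (rule negligible_subset)
    show "{x\<in>{a<..<b}. \<not> F differentiable (at x)} \<subseteq> Z"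
    proof (clarify, rule ccontr)
      fix x assume x: "x \<in> {a<..<b}" "\<not> F differentiable (at x)" "x \<notin> Z"
      obtain n1 n2 :: nat where "\<not> steep F n1 x" "\<not> steep (\<lambda>y. - F y) n2 x"
        using x unfolding Z_def by blast
      moreover have "\<not> steep (\<lambda>y. F y - m * y) k x \<or> \<not> steep (\<lambda>y. - (F y - m * y)) k x"
        if "m \<in> \<rat>" "k \<in> \<rat>" "k > 0" for m k
      proof -
        have "x \<notin> A m k" using x(3) that unfolding Z_def by auto
        then show ?thesis using x(1) unfolding A_def by auto
      qed
      ultimately have "F differentiable (at x)"
        using differentiable_of_not_steep[OF AC_on_imp_continuous[OF F]] x(1) by auto
      then show False using x by simp
    qed
  qed
qed

lemma AC_on_complex_differentiable_ae:
  fixes F :: "real \<Rightarrow> complex"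
  assumes F: "AC_on a b F"
  shows "negligible {x\<in>{a<..<b}. \<not> F differentiable (at x)}"
proof -
  have R: "AC_on a b (\<lambda>x. Re (F x))"
    by (rule AC_on_of_increment_le[OF F, of _ 0]) (auto, metis abs_Re_le_cmod minus_complex.simps(1))
  have I: "AC_on a b (\<lambda>x. Im (F x))"
    by (rule AC_on_of_increment_le[OF F, of _ 0]) (auto, metis abs_Im_le_cmod minus_complex.simps(2))
  show ?thesis
  proof (rule negligible_subset[OF negligible_Un[OF AC_on_real_differentiable_ae[OF R] AC_on_real_differentiable_ae[OF I]]])
    have "F differentiable (at x)" if "(\<lambda>x. Re (F x)) differentiable (at x)" "(\<lambda>x. Im (F x)) differentiable (at x)" for x
    proof -
      have "(\<lambda>x. complex_of_real (Re (F x)) + \<i> * complex_of_real (Im (F x))) differentiable (at x)"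
        using that unfolding differentiable_def
        by (fast intro: has_derivative_add has_derivative_mult_right has_derivative_of_real)
      moreover have "(\<lambda>x. complex_of_real (Re (F x)) + \<i> * complex_of_real (Im (F x))) = F"
        by (simp add: fun_eq_iff complex_eq_iff)
      ultimately show ?thesis by simp
    qed
    then show "{x\<in>{a<..<b}. \<not> F differentiable (at x)} \<subseteq>
      {x\<in>{a<..<b}. \<not> (\<lambda>x. Re (F x)) differentiable (at x)} \<union> {x\<in>{a<..<b}. \<not> (\<lambda>x. Im (F x)) differentiable (at x)}"
      by auto
  qed
qed

section \<open>The fundamental theorem of calculus for absolutely continuous functions\<close>

text \<open>A gauge argument: a tagged interval with tag outside \<open>N\<close> is short enough for the derivative at the
  tag to predict the increment of \<open>F\<close>, while one with tag in \<open>N\<close> lies in an open set of small measure,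
  so that absolute continuity bounds the sum of these increments.\<close>
lemma fundamental_theorem_of_calculus_AC:
  fixes F :: "real \<Rightarrow> 'a::banach"
  assumes F: "AC_on a b F" and "a \<le> b" and N: "negligible N"
    and D: "\<And>x. x \<in> {a..b} - N \<Longrightarrow> (F has_vector_derivative f x) (at x within {a..b})"
  shows "(f has_integral (F b - F a)) {a..b}"
proof -
  define g where "g x = (if x \<in> N then 0 else f x)" for x
  have "(g has_integral (F b - F a)) {a..b}"
    unfolding has_integral_real
  proof (intro allI impI)
    fix e :: real assume e: "e > 0"
    define e1 where "e1 = e / (2 * (b - a + 1))"
    have e1: "e1 > 0" "e1 * (b - a) < e/2" using e \<open>a \<le> b\<close> by (auto simp: e1_def field_simps)
    have "\<forall>x. \<exists>d>0. x \<in> {a..b} - N \<longrightarrow>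
         (\<forall>y\<in>{a..b}. norm (y-x) < d \<longrightarrow> norm (F y - F x - (y-x) *\<^sub>R f x) \<le> e1 * norm (y-x))"
      using D[unfolded has_vector_derivative_def has_derivative_within_alt] e1(1) 
      by (metis zero_less_one)
    then obtain d where d: "\<And>x. 0 < d x"
      "\<And>x y. \<lbrakk>x \<in> {a..b} - N; y \<in> {a..b}; norm (y-x) < d x\<rbrakk> \<Longrightarrow> norm (F y - F x - (y-x) *\<^sub>R f x) \<le> e1 * norm (y-x)"
      by metis
    obtain \<delta> where \<delta>: "\<delta> > 0" and \<Delta>: "\<And>S. nonoverlapping a b S \<Longrightarrow>
      (\<Sum>s\<in>S. snd s - fst s) < \<delta> \<Longrightarrow> (\<Sum>s\<in>S. norm (F (snd s) - F (fst s))) < e/2"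
      using AC_onD[OF F half_gt_zero[OF e]] by blast
    obtain T where T: "open T" "N \<subseteq> T" "(T - N) \<in> lmeasurable" "emeasure lebesgue (T - N) < ennreal \<delta>"
      using sets_lebesgue_outer_open[of N \<delta>] N \<delta> negligible_imp_sets by blast
    have Tm: "T \<in> lmeasurable" "measure lebesgue T < \<delta>"
    proof -
      have Nm: "N \<in> lmeasurable" using N by (simp add: negligible_iff_measure)
      have TN: "T = (T - N) \<union> N" using T(2) by auto
      then show Tl: "T \<in> lmeasurable" using T(3) Nm fmeasurable.Un by metis
      have "measure lebesgue T \<le> measure lebesgue (T - N) + measure lebesgue N"
        using TN measure_Un_le[of "T - N" lebesgue N] T(3) Nm by auto
      also have "measure lebesgue N = 0" using N by (rule negligible_imp_measure0)
      also have "measure lebesgue (T - N) < \<delta>"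
        using T(4) \<delta> by (simp add: emeasure_eq_measure2[OF T(3)] ennreal_less_iff)
      finally show "measure lebesgue T < \<delta>" by simp
    qed
    define \<gamma> where "\<gamma> x = (if x \<in> N then T else ball x (d x))" for x
    have "gauge \<gamma>" unfolding gauge_def \<gamma>_def using T(1,2) d(1) by auto
    moreover have "norm ((\<Sum>(x,K)\<in>p. measure lborel K *\<^sub>R g x) - (F b - F a)) < e"
      if p: "p tagged_division_of {a..b}" and fine: "\<gamma> fine p" for p
    proof -
      note pD = tagged_division_ofD[OF p]
      have K: "K = {Inf K..Sup K}" "Inf K \<le> x" "x \<le> Sup K" "measure lborel K = Sup K - Inf K" "a \<le> Inf K" "Sup K \<le> b"
        if xK: "(x,K) \<in> p" for x K
      proof -
        obtain u v where uv: "K = {u..v}" using pD(4)[OF xK] by auto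
        then have "u \<le> v" "x \<in> K" "K \<subseteq> {a..b}" using pD(2,3)[OF xK] by auto
        then show "K = {Inf K..Sup K}" "Inf K \<le> x" "x \<le> Sup K" "measure lborel K = Sup K - Inf K" "a \<le> Inf K" "Sup K \<le> b"
          unfolding uv by auto
      qed
      define p1 p2 where "p1 = {s\<in>p. fst s \<notin> N}" and "p2 = {s\<in>p. fst s \<in> N}"
      have p12: "p = p1 \<union> p2" "p1 \<inter> p2 = {}" "finite p1" "finite p2"
        using pD(1) by (auto simp: p1_def p2_def)
      define T1 where "T1 s = measure lborel (snd s) *\<^sub>R g (fst s) - (F (Sup (snd s)) - F (Inf (snd s)))" for s
      have "(\<Sum>(x,K)\<in>p. measure lborel K *\<^sub>R g x) - (F b - F a) = (\<Sum>s\<in>p. T1 s)"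
        using additive_tagged_division_1[OF \<open>a \<le> b\<close> p, of F]
        by (simp add: T1_def split_def sum_subtractf)
      also have "\<dots> = (\<Sum>s\<in>p1. T1 s) + (\<Sum>s\<in>p2. T1 s)"
        unfolding p12(1) by (rule sum.union_disjoint) (use p12 in auto)
      finally have eq: "(\<Sum>(x,K)\<in>p. measure lborel K *\<^sub>R g x) - (F b - F a) = (\<Sum>s\<in>p1. T1 s) + (\<Sum>s\<in>p2. T1 s)" .
      have "norm (\<Sum>s\<in>p1. T1 s) \<le> (\<Sum>s\<in>p1. e1 * measure lborel (snd s))"
      proof (rule sum_norm_le)
        fix s assume s: "s \<in> p1"
        obtain x L where xL: "s = (x, L)" by (cases s)
        have xLp: "(x,L) \<in> p" "x \<notin> N" using s xL by (auto simp: p1_def)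
        note KK = K[OF xLp(1)]
        have sub: "L \<subseteq> ball x (d x)" using fineD[OF fine xLp(1)] xLp(2) by (simp add: \<gamma>_def)
        have mem: "Sup L \<in> L" "Inf L \<in> L" using KK(1-3)
          by (metis atLeastAtMost_iff order_refl order_trans)+
        have x: "x \<in> {a..b} - N" using KK xLp by auto
        have 1: "norm (F (Sup L) - F x - (Sup L - x) *\<^sub>R f x) \<le> e1 * norm (Sup L - x)"
          by (rule d(2)[OF x]) (use mem(1) sub KK in \<open>auto simp: dist_real_def abs_minus_commute subset_iff\<close>)
        have 2: "norm (F (Inf L) - F x - (Inf L - x) *\<^sub>R f x) \<le> e1 * norm (Inf L - x)"
          by (rule d(2)[OF x]) (use mem(2) sub KK in \<open>auto simp: dist_real_def abs_minus_commute subset_iff\<close>)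
        have T1eq: "T1 s = (F (Inf L) - F x - (Inf L - x) *\<^sub>R f x) - (F (Sup L) - F x - (Sup L - x) *\<^sub>R f x)"
          unfolding T1_def xL fst_conv snd_conv KK(4) using xLp(2) by (simp add: g_def algebra_simps)
        have "norm (T1 s) \<le> e1 * norm (Inf L - x) + e1 * norm (Sup L - x)"
          unfolding T1eq using 1 2 norm_triangle_ineq4[of "F (Inf L) - F x - (Inf L - x) *\<^sub>R f x" "F (Sup L) - F x - (Sup L - x) *\<^sub>R f x"]
          by linarith
        also have "\<dots> = e1 * measure lborel L" unfolding KK(4) using KK(2,3) by (simp add: algebra_simps)
        finally show "norm (T1 s) \<le> e1 * measure lborel (snd s)" by (simp add: xL)
      qed
      also have "\<dots> \<le> (\<Sum>s\<in>p. e1 * measure lborel (snd s))"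
        by (rule sum_mono2) (use pD(1) e1 in \<open>auto simp: p1_def\<close>)
      also have "\<dots> = e1 * (b - a)"
        using additive_content_tagged_division[of p a b] p \<open>a \<le> b\<close>
        by (simp add: split_def sum_distrib_left[symmetric])
      finally have one: "norm (\<Sum>s\<in>p1. T1 s) < e/2" using e1 by simp
      \<comment> \<open>Several tags may carry degenerate intervals with the same end points; these are dropped so that \<open>h\<close> becomes injective.\<close>
      define p3 where "p3 = {s\<in>p2. Inf (snd s) < Sup (snd s)}"
      define h where "h s = (Inf (snd s), Sup (snd s))" for s :: "real \<times> real set"
      have p3p: "(fst s, snd s) \<in> p" "fst s \<in> N" "Inf (snd s) < Sup (snd s)" if "s \<in> p3" for s
        using that by (auto simp: p3_def p2_def)
      have dis: "disjnt {Inf (snd s)<..<Sup (snd s)} {Inf (snd t)<..<Sup (snd t)}" if "s \<in> p3" "t \<in> p3" "s \<noteq> t" for s t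
      proof -
        have "interior (snd s) \<inter> interior (snd t) = {}"
          using pD(5)[OF p3p(1)[OF that(1)] p3p(1)[OF that(2)]] that(3) by (auto simp: prod_eq_iff)
        moreover have "interior (snd s) = {Inf (snd s)<..<Sup (snd s)}" "interior (snd t) = {Inf (snd t)<..<Sup (snd t)}"
          using K(1)[OF p3p(1)[OF that(1)]] K(1)[OF p3p(1)[OF that(2)]] interior_atLeastAtMost_real by metis+
        ultimately show ?thesis by (simp add: disjnt_def)
      qed
      have inj: "inj_on h p3"
      proof (rule inj_onI, rule ccontr)
        fix s t assume st: "s \<in> p3" "t \<in> p3" "h s = h t" "s \<noteq> t"
        then have "{Inf (snd s)<..<Sup (snd s)} = {}" using dis[OF st(1,2,4)] by (auto simp: h_def disjnt_def)
        then show False using p3p(3)[OF st(1)] by simp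
      qed
      have fin3: "finite p3" using p12 by (simp add: p3_def)
      have no: "nonoverlapping a b (h ` p3)"
        unfolding nonoverlapping_def
      proof (intro conjI ballI)
        show "pairwise (\<lambda>s t. disjnt {fst s<..<snd s} {fst t<..<snd t}) (h ` p3)"
          unfolding pairwise_def by (auto simp: h_def intro!: dis)
      qed (use fin3 K(5,6)[OF p3p(1)] p3p(3) in \<open>auto simp: h_def less_imp_le\<close>)
      have "(\<Sum>s\<in>h ` p3. snd s - fst s) = (\<Sum>s\<in>p3. measure lebesgue {Inf (snd s)<..<Sup (snd s)})"
        unfolding sum.reindex[OF inj] by (intro sum.cong) (auto simp: h_def dest: p3p(3))
      also have "\<dots> = measure lebesgue (\<Union>s\<in>p3. {Inf (snd s)<..<Sup (snd s)})"
        by (rule measure_UNION'[symmetric]) (use fin3 dis in \<open>auto simp: pairwise_def\<close>)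
      also have "\<dots> \<le> measure lebesgue T"
      proof (rule measure_mono_fmeasurable)
        have "{Inf (snd s)<..<Sup (snd s)} \<subseteq> T" if "s \<in> p3" for s
        proof -
          have "snd s \<subseteq> T" using fineD[OF fine p3p(1)[OF that]] p3p(2)[OF that] by (simp add: \<gamma>_def)
          then show ?thesis using K(1)[OF p3p(1)[OF that]] by (metis greaterThanLessThan_subseteq_atLeastAtMost_iff order_refl order_trans)
        qed
        then show "(\<Union>s\<in>p3. {Inf (snd s)<..<Sup (snd s)}) \<subseteq> T" by auto
      qed (use Tm fin3 in auto)
      finally have "(\<Sum>s\<in>h ` p3. snd s - fst s) < \<delta>" using Tm by simp
      from \<Delta>[OF no this] have "(\<Sum>s\<in>p3. norm (F (Sup (snd s)) - F (Inf (snd s)))) < e/2"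
        unfolding sum.reindex[OF inj] by (simp add: h_def)
      moreover have "(\<Sum>s\<in>p2. T1 s) = (\<Sum>s\<in>p3. T1 s)"
      proof (rule sum.mono_neutral_right)
        show "\<forall>s\<in>p2 - p3. T1 s = 0"
        proof
          fix s assume s: "s \<in> p2 - p3"
          then have "(fst s, snd s) \<in> p" by (auto simp: p2_def)
          from K(2,3)[OF this] have "Inf (snd s) = Sup (snd s)" using s by (auto simp: p3_def)
          then show "T1 s = 0" using s by (simp add: T1_def g_def p2_def)
        qed
      qed (use p12 in \<open>auto simp: p3_def\<close>)
      moreover have "norm (\<Sum>s\<in>p3. T1 s) \<le> (\<Sum>s\<in>p3. norm (F (Sup (snd s)) - F (Inf (snd s))))"
        by (rule sum_norm_le) (use p3p in \<open>auto simp: T1_def g_def norm_minus_commute\<close>)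
      ultimately have two: "norm (\<Sum>s\<in>p2. T1 s) < e/2" by simp
      show ?thesis unfolding eq using one two norm_triangle_ineq[of "\<Sum>s\<in>p1. T1 s" "\<Sum>s\<in>p2. T1 s"] by simp
    qed
    ultimately show "\<exists>\<gamma>. gauge \<gamma> \<and> (\<forall>\<D>. \<D> tagged_division_of {a..b} \<and> \<gamma> fine \<D> \<longrightarrow>
        norm ((\<Sum>(x,k)\<in>\<D>. measure lborel k *\<^sub>R g x) - (F b - F a)) < e)" by (intro exI[of _ \<gamma>]) simp
  qed
  show ?thesis
    by (intro has_integral_spike[OF N _ \<open>(g has_integral (F b - F a)) {a..b}\<close>]) (auto simp: g_def)
qed

section \<open>Convolution under log-Hoelder continuity of the exponent\<close>

lemma nn_integral_inverse_square: "(\<integral>\<^sup>+x. ennreal (1 / (1 + \<bar>x\<bar>)^2) \<partial>lborel) = 2"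
proof -
  let ?f = "\<lambda>x::real. ennreal (1 / (1 + \<bar>x\<bar>)^2)"
  have pos: "(\<integral>\<^sup>+x. ?f x * indicator {0..} x \<partial>lborel) = 1"
  proof -
    have lim: "((\<lambda>x::real. - 1 / (1 + x)) \<longlongrightarrow> 0) at_top"
      by (intro tendsto_divide_0[OF tendsto_const] filterlim_at_top_imp_at_infinity
          filterlim_tendsto_add_at_top[OF tendsto_const] filterlim_ident)
    have "(\<integral>\<^sup>+x. ennreal (1 / (1 + x)^2) * indicator {0..} x \<partial>lborel) = ennreal (0 - (- 1 / (1 + 0::real)))"
    proof (rule nn_integral_FTC_atLeast[where F = "\<lambda>x. - 1 / (1 + x)"])
      show "((\<lambda>x. - 1 / (1 + x)) has_real_derivative 1 / (1 + x)^2) (at x)" if "0 \<le> x" for x :: real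
        using that by (auto intro!: derivative_eq_intros simp: power2_eq_square)
    qed (use lim in auto)
    also have "(\<integral>\<^sup>+x. ennreal (1 / (1 + x)^2) * indicator {0..} x \<partial>lborel) = (\<integral>\<^sup>+x. ?f x * indicator {0..} x \<partial>lborel)"
      by (intro nn_integral_cong) (auto simp: indicator_def)
    finally show ?thesis by simp
  qed
  have neg: "(\<integral>\<^sup>+x. ?f x * indicator {..0} x \<partial>lborel) = 1"
  proof -
    have "(\<integral>\<^sup>+x. ?f x * indicator {0..} x \<partial>lborel) = ennreal \<bar>-1\<bar> * (\<integral>\<^sup>+x. ?f (0 + (-1) * x) * indicator {0..} (0 + (-1) * x) \<partial>lborel)"
      by (rule nn_integral_real_affine) auto
    also have "\<dots> = (\<integral>\<^sup>+x. ?f x * indicator {..0} x \<partial>lborel)"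
      by (simp, intro nn_integral_cong) (auto simp: indicator_def)
    finally show ?thesis using pos by simp
  qed
  have "(\<integral>\<^sup>+x. ?f x \<partial>lborel) = (\<integral>\<^sup>+x. ?f x * indicator {0..} x + ?f x * indicator {..0} x \<partial>lborel)"
  proof (rule nn_integral_cong_AE)
    have "AE x in lborel. x \<noteq> (0::real)" by (rule AE_lborel_singleton)
    then show "AE x in lborel. ?f x = ?f x * indicator {0..} x + ?f x * indicator {..0} x"
      by eventually_elim (auto simp: indicator_def)
  qed
  also have "\<dots> = 1 + 1"
    by (subst nn_integral_add) (auto simp: pos neg)
  finally show ?thesis by simp
qed

lemma nn_integral_scaled_inverse_square:
  assumes "\<sigma> > 0"
  shows "(\<integral>\<^sup>+y. ennreal (\<sigma> / (1 + \<sigma> * \<bar>x - y\<bar>)^2) \<partial>lborel) = 2"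
proof -
  have "2 = (\<integral>\<^sup>+u. ennreal (1 / (1 + \<bar>u\<bar>)^2) \<partial>lborel)" by (simp add: nn_integral_inverse_square)
  also have "\<dots> = ennreal \<bar>-\<sigma>\<bar> * (\<integral>\<^sup>+y. ennreal (1 / (1 + \<bar>\<sigma> * x + (-\<sigma>) * y\<bar>)^2) \<partial>lborel)"
    by (rule nn_integral_real_affine) (use assms in auto)
  also have "\<dots> = (\<integral>\<^sup>+y. ennreal \<bar>-\<sigma>\<bar> * ennreal (1 / (1 + \<bar>\<sigma> * x + (-\<sigma>) * y\<bar>)^2) \<partial>lborel)"
    by (rule nn_integral_cmult[symmetric]) auto
  also have "\<dots> = (\<integral>\<^sup>+y. ennreal (\<sigma> / (1 + \<sigma> * \<bar>x - y\<bar>)^2) \<partial>lborel)"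
  proof (rule nn_integral_cong)
    fix y
    have "\<bar>\<sigma> * x + (-\<sigma>) * y\<bar> = \<sigma> * \<bar>x - y\<bar>"
      using assms by (metis abs_mult abs_of_pos mult_minus_left right_diff_distrib uminus_add_conv_diff add.commute)
    then show "ennreal \<bar>-\<sigma>\<bar> * ennreal (1 / (1 + \<bar>\<sigma> * x + (-\<sigma>) * y\<bar>)^2) = ennreal (\<sigma> / (1 + \<sigma> * \<bar>x - y\<bar>)^2)"
      using assms by (simp add: ennreal_mult'[symmetric])
  qed
  finally show ?thesis by simp
qed

text \<open>The number \<open>q\<close> is the limit of \<open>p\<close> at infinity.\<close>
locale log_hoelder =
  fixes p :: "real \<Rightarrow> real" and c1 c2 q :: real
  assumes p_meas [measurable]: "p \<in> borel_measurable borel"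
    and p_ge1: "\<And>x. 1 \<le> p x"
    and c1_pos: "c1 > 0" and c2_pos: "c2 > 0"
    and local_log: "\<And>x y. \<bar>p x - p y\<bar> * ln (exp 1 + 1 / \<bar>x - y\<bar>) \<le> c1"
    and decay_log: "\<And>x. \<bar>p x - q\<bar> * ln (exp 1 + \<bar>x\<bar>) \<le> c2"
begin

text \<open>The integrable error that is committed when the exponent \<open>p x\<close> is exchanged for its limit \<open>q\<close>.\<close>
definition decay :: "real \<Rightarrow> real" where "decay x = 1 / (exp 1 + \<bar>x\<bar>)^2"

lemma decay_measurable [measurable]: "decay \<in> borel_measurable borel" by (simp add: decay_def[abs_def])

lemma decay_pos: "decay x > 0" and decay_nonneg: "decay x \<ge> 0"
proof -
  have "exp 1 + \<bar>x\<bar> > 0" by (intro add_pos_nonneg) auto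
  then show "decay x > 0" "decay x \<ge> 0" by (auto simp: decay_def)
qed

lemma nn_integral_decay: "(\<integral>\<^sup>+x. ennreal (decay x) \<partial>lborel) \<le> 2"
proof -
  have "(\<integral>\<^sup>+x. ennreal (decay x) \<partial>lborel) \<le> (\<integral>\<^sup>+x. ennreal (1 / (1 + \<bar>x\<bar>)^2) \<partial>lborel)"
  proof (intro nn_integral_mono ennreal_leI)
    fix x :: real
    have "1 + \<bar>x\<bar> \<le> exp 1 + \<bar>x\<bar>" using one_le_exp_iff[of "1::real"] by simp
    then have "(1 + \<bar>x\<bar>)^2 \<le> (exp 1 + \<bar>x\<bar>)^2" by (intro power_mono) auto
    then show "decay x \<le> 1 / (1 + \<bar>x\<bar>)^2"
      unfolding decay_def by (intro divide_left_mono mult_pos_pos zero_less_power) (auto intro: add_pos_nonneg)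
  qed
  then show ?thesis by (simp add: nn_integral_inverse_square)
qed

text \<open>Otherwise \<open>q\<close> would stay a fixed distance below \<open>p\<close>, against the decay condition at large \<open>x\<close>.\<close>
lemma q_ge1: "1 \<le> q"
proof (rule ccontr)
  assume "\<not> 1 \<le> q"
  then have q: "1 - q > 0" by simp
  define x where "x = exp ((c2 + 1) / (1 - q))"
  have "ln x = (c2 + 1) / (1 - q)" by (simp add: x_def)
  moreover have "ln x \<le> ln (exp 1 + \<bar>x\<bar>)" by (intro ln_mono) (auto simp: x_def)
  ultimately have "(c2 + 1) \<le> (1 - q) * ln (exp 1 + \<bar>x\<bar>)" using q by (simp add: pos_divide_le_eq mult.commute)
  also have "\<dots> \<le> \<bar>p x - q\<bar> * ln (exp 1 + \<bar>x\<bar>)"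
  proof (rule mult_right_mono)
    show "1 - q \<le> \<bar>p x - q\<bar>" using p_ge1[of x] by simp
    show "0 \<le> ln (exp 1 + \<bar>x\<bar>)" by (intro ln_ge_zero add_increasing2) auto
  qed
  finally show False using decay_log[of x] by simp
qed

text \<open>Let \<open>d\<close> be the distance of \<open>x\<close> and \<open>y\<close>. Up to distance \<open>\<sigma> powr (-1/2)\<close> the logarithm in the local condition is at
  least half of \<open>ln \<sigma>\<close>, so the left side is bounded; beyond it \<open>\<sigma> \<le> (\<sigma> d)\<^sup>2\<close>, so a power
  of \<open>1 + \<sigma> d\<close> takes over. Thus a change of exponent costs only a polynomial factor, which the fast decay of a convolution kernel absorbs.\<close>
lemma powr_local_log_bound:
  assumes "\<sigma> \<ge> 1" and N: "real N \<ge> 2 * c1 + 2"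
  shows "\<sigma> powr \<bar>p x - p y\<bar> \<le> exp (2 * c1) * (1 + \<sigma> * \<bar>x - y\<bar>) ^ (N - 2)"
proof -
  define d where "d = \<bar>x - y\<bar>"
  define D where "D = \<bar>p x - p y\<bar>"
  have sd: "0 \<le> \<sigma> * d" using assms by (simp add: d_def)
  have e1: "exp 1 \<ge> (1::real)" by simp
  have one: "1 \<le> (1 + \<sigma> * d) ^ (N - 2)" using sd by (intro one_le_power) simp
  have P: "\<sigma> powr D = exp (D * ln \<sigma>)" using assms(1) by (simp add: powr_def)
  have D0: "D \<ge> 0" by (simp add: D_def)
  have ls: "ln \<sigma> \<ge> 0" using assms(1) by simp
  have main: "\<sigma> powr D \<le> exp (2 * c1) * (1 + \<sigma> * d) ^ (N - 2)"
  proof (cases "d = 0")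
    case True
    then have "D = 0" by (simp add: d_def D_def)
    then show ?thesis using True assms(1) c1_pos by simp
  next
    case False
    then have d: "d > 0" by (simp add: d_def)
    have DL: "D * ln (exp 1 + 1 / d) \<le> c1" using local_log[of x y] by (simp add: d_def D_def)
    show ?thesis
    proof (cases "\<sigma> * d^2 \<le> 1")
      case True
      then have "\<sigma> \<le> (1/d)^2" using d by (simp add: field_simps)
      then have "ln \<sigma> \<le> ln ((1/d)^2)" using assms(1) d by (intro ln_mono) auto
      also have "\<dots> = 2 * ln (1/d)" using d by (simp add: ln_realpow)
      also have "\<dots> \<le> 2 * ln (exp 1 + 1/d)" using d by (intro mult_left_mono ln_mono) (auto intro: add_pos_pos)
      finally have "D * ln \<sigma> \<le> D * (2 * ln (exp 1 + 1/d))" using D0 by (rule mult_left_mono)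
      then have "D * ln \<sigma> \<le> 2 * c1" using DL by simp
      then have "\<sigma> powr D \<le> exp (2 * c1) * 1" unfolding P by simp
      also have "\<dots> \<le> exp (2 * c1) * (1 + \<sigma> * d) ^ (N - 2)" using one by (intro mult_left_mono) auto
      finally show ?thesis .
    next
      case False
      then have "\<sigma> * 1 \<le> \<sigma> * (\<sigma> * d^2)" using assms(1) by (intro mult_left_mono) auto
      then have "\<sigma> \<le> (\<sigma> * d)^2" by (simp add: power2_eq_square algebra_simps)
      also have "\<dots> \<le> (1 + \<sigma> * d)^2" using sd by (intro power_mono) auto
      finally have "ln \<sigma> \<le> ln ((1 + \<sigma> * d)^2)" using assms(1) by (intro ln_mono) auto
      also have "\<dots> = 2 * ln (1 + \<sigma> * d)" using sd by (simp add: ln_realpow)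
      finally have l: "ln \<sigma> \<le> 2 * ln (1 + \<sigma> * d)" .
      have "1 \<le> ln (exp 1 + 1 / d)" using d by (subst ln_ge_iff) (auto intro: add_pos_pos)
      then have "D * 1 \<le> D * ln (exp 1 + 1/d)" using D0 by (rule mult_left_mono)
      then have "D \<le> c1" using DL by simp
      then have "D * ln \<sigma> \<le> c1 * (2 * ln (1 + \<sigma> * d))" using l D0 ls c1_pos by (intro mult_mono) auto
      also have "\<dots> = (2 * c1) * ln (1 + \<sigma> * d)" by simp
      also have "\<dots> \<le> real (N - 2) * ln (1 + \<sigma> * d)" using N c1_pos sd by (intro mult_right_mono) (auto simp: of_nat_diff)
      also have "\<dots> = ln ((1 + \<sigma> * d) ^ (N - 2))" using sd by (simp add: ln_realpow)
      finally have "\<sigma> powr D \<le> exp (ln ((1 + \<sigma> * d) ^ (N - 2)))" unfolding P by simp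
      also have "\<dots> = 1 * (1 + \<sigma> * d) ^ (N - 2)" using one by (subst exp_ln) auto
      also have "\<dots> \<le> exp (2 * c1) * (1 + \<sigma> * d) ^ (N - 2)" using one c1_pos by (intro mult_right_mono) auto
      finally show ?thesis .
    qed
  qed
  then show ?thesis by (simp add: d_def D_def)
qed

text \<open>Either \<open>a\<close> is below \<open>decay x\<close>, and then so is \<open>a powr s\<close>, or \<open>- ln a\<close> is at most twice the
  logarithm in the decay condition.\<close>
lemma powr_change_exponent:
  assumes a: "0 \<le> a" "a \<le> 1" and s: "s \<ge> 1" and st: "\<bar>s - t\<bar> * ln (exp 1 + \<bar>x\<bar>) \<le> c2"
  shows "a powr s \<le> exp (2 * c2) * a powr t + decay x"
proof (cases "a < decay x")
  case True
  have "a powr s \<le> a powr 1" using a s by (intro powr_mono')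
  also have "\<dots> \<le> decay x" using a True by simp
  finally show ?thesis using decay_nonneg[of x] by (simp add: add_increasing)
next
  case False
  then have a0: "a > 0" using decay_pos[of x] by simp
  have ex: "exp 1 + \<bar>x\<bar> > 0" by (intro add_pos_nonneg) auto
  have "ln (decay x) \<le> ln a" using False decay_pos[of x] by (intro ln_mono) auto
  then have la: "- ln a \<le> 2 * ln (exp 1 + \<bar>x\<bar>)" using ex by (simp add: decay_def ln_div ln_realpow)
  have "(s - t) * ln a \<le> \<bar>(s - t) * ln a\<bar>" by simp
  also have "\<dots> = \<bar>s - t\<bar> * (- ln a)" using a a0 by (simp add: abs_mult)
  also have "\<dots> \<le> \<bar>s - t\<bar> * (2 * ln (exp 1 + \<bar>x\<bar>))" using la by (intro mult_left_mono) auto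
  also have "\<dots> \<le> 2 * c2" using st by simp
  finally have "a powr (s - t) \<le> exp (2 * c2)" using a0 by (simp add: powr_def)
  then have "a powr (s - t) * a powr t \<le> exp (2 * c2) * a powr t" by (intro mult_right_mono) auto
  then have "a powr s \<le> exp (2 * c2) * a powr t" by (simp flip: powr_add)
  then show ?thesis using decay_nonneg[of x] by simp
qed

definition conv_const :: real where "conv_const = exp (2 * c1) + exp (2 * c2) * exp (2 * c2)"

lemma conv_const_pos: "conv_const > 0" unfolding conv_const_def by (intro add_pos_pos mult_pos_pos) auto

text \<open>Here \<open>H\<close> is a nonnegative function of modular at most 1, convolved with a kernel of width \<open>1/\<sigma>\<close>
  that decays like the \<open>N\<close>-th power. The modular of the convolution is to be bounded independently of \<open>\<sigma>\<close>.\<close>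
context
  fixes \<sigma> :: real and N :: nat and H :: "real \<Rightarrow> real"
  assumes \<sigma>: "\<sigma> > 0" and N: "real N \<ge> 2 * c1 + 2"
    and H_meas [measurable]: "H \<in> borel_measurable borel" and H_nonneg: "\<And>y. H y \<ge> 0"
    and H_mod: "(\<integral>\<^sup>+y. ennreal (H y powr p y) \<partial>lborel) \<le> 1"
begin

definition weight :: "nat \<Rightarrow> real \<Rightarrow> real \<Rightarrow> real" where "weight n x y = \<sigma> / 2 / (1 + \<sigma> * \<bar>x - y\<bar>) ^ n"

definition conv :: "real \<Rightarrow> ennreal" where "conv x = (\<integral>\<^sup>+y. ennreal (weight N x y) * ennreal (H y) \<partial>lborel)"

definition half_conv :: "real \<Rightarrow> real" where "half_conv x = enn2real (conv x) / 2"

lemma base_ge1: "1 + \<sigma> * \<bar>x - y\<bar> \<ge> 1" using \<sigma> by simp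

lemma weight_nonneg: "weight n x y \<ge> 0"
  unfolding weight_def using \<sigma> base_ge1[of x y] by (intro divide_nonneg_nonneg zero_le_power) auto

lemma weight_measurable [measurable]: "(\<lambda>(x,y). weight n x y) \<in> borel_measurable (borel \<Otimes>\<^sub>M borel)"
  unfolding weight_def by measurable

lemma weight_measurable' [measurable]: "weight n x \<in> borel_measurable borel"
  unfolding weight_def[abs_def] by measurable

lemma weight_le_weight2: "weight N x y \<le> weight 2 x y"
  unfolding weight_def using \<sigma> base_ge1[of x y] N c1_pos
  by (intro divide_left_mono mult_pos_pos zero_less_power power_increasing) linarith+

lemma weight_split: "weight N x y * (1 + \<sigma> * \<bar>x - y\<bar>) ^ (N - 2) = weight 2 x y"
proof -
  have "N = 2 + (N - 2)" using N c1_pos by simp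
  then have "(1 + \<sigma> * \<bar>x - y\<bar>) ^ N = (1 + \<sigma> * \<bar>x - y\<bar>) ^ 2 * (1 + \<sigma> * \<bar>x - y\<bar>) ^ (N - 2)"
    by (metis power_add)
  moreover have "(1 + \<sigma> * \<bar>x - y\<bar>) ^ (N - 2) > 0" using base_ge1[of x y] by (intro zero_less_power) simp
  ultimately show ?thesis by (simp add: weight_def)
qed

lemma weight_le: "weight N x y \<le> \<sigma> / 2"
proof -
  have "\<sigma> / 2 / (1 + \<sigma> * \<bar>x - y\<bar>) ^ N \<le> \<sigma> / 2 / 1"
    using \<sigma> base_ge1[of x y] by (intro divide_left_mono one_le_power mult_pos_pos zero_less_power) linarith+
  then show ?thesis by (simp add: weight_def)
qed

lemma weight_commute: "weight n x y = weight n y x" by (simp add: weight_def abs_minus_commute)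

lemma nn_integral_weight2: "(\<integral>\<^sup>+y. ennreal (weight 2 x y) \<partial>lborel) = 1"
proof -
  have "(\<integral>\<^sup>+y. ennreal (\<sigma> / (1 + \<sigma> * \<bar>x - y\<bar>)^2) \<partial>lborel) = (\<integral>\<^sup>+y. 2 * ennreal (weight 2 x y) \<partial>lborel)"
    using weight_nonneg by (intro nn_integral_cong) (simp add: weight_def ennreal_mult'[symmetric] flip: ennreal_numeral)
  also have "\<dots> = 2 * (\<integral>\<^sup>+y. ennreal (weight 2 x y) \<partial>lborel)" by (rule nn_integral_cmult) simp
  finally have "2 * (\<integral>\<^sup>+y. ennreal (weight 2 x y) \<partial>lborel) = 2 * 1"
    using nn_integral_scaled_inverse_square[OF \<sigma>, of x] by simp
  then show ?thesis by (subst (asm) ennreal_mult_cancel_left) auto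
qed

lemma nn_integral_weight: "(\<integral>\<^sup>+y. ennreal (weight N x y) \<partial>lborel) \<le> 1"
  unfolding nn_integral_weight2[of x, symmetric] by (intro nn_integral_mono ennreal_leI weight_le_weight2)

text \<open>Split at \<open>H y = 1\<close>: small values are integrated against the kernel, large ones are dominated by
  \<open>H y powr p y\<close>.\<close>
lemma conv_le: "conv x \<le> ennreal (1 + \<sigma> / 2)"
proof -
  have "conv x \<le> (\<integral>\<^sup>+y. ennreal (weight N x y) + ennreal (\<sigma>/2) * ennreal (H y powr p y) \<partial>lborel)"
    unfolding conv_def
  proof (rule nn_integral_mono)
    fix y
    have "weight N x y * H y \<le> weight N x y + \<sigma>/2 * (H y powr p y)"
    proof (cases "H y \<le> 1")
      case True
      then have "weight N x y * H y \<le> weight N x y * 1" by (intro mult_left_mono weight_nonneg)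
      then show ?thesis using \<sigma> by (simp add: add_increasing2)
    next
      case False
      then have "H y powr 1 \<le> H y powr p y" by (intro powr_mono p_ge1) auto
      then have "weight N x y * H y \<le> \<sigma>/2 * (H y powr p y)" using False weight_le weight_nonneg \<sigma> by (intro mult_mono) auto
      then show ?thesis using weight_nonneg[of N x y] by simp
    qed
    then show "ennreal (weight N x y) * ennreal (H y) \<le> ennreal (weight N x y) + ennreal (\<sigma>/2) * ennreal (H y powr p y)"
      using weight_nonneg[of N x y] H_nonneg[of y] \<sigma> 
      by (simp add: ennreal_mult'[symmetric] ennreal_plus[symmetric] del: ennreal_plus)
  qed
  also have "\<dots> = (\<integral>\<^sup>+y. ennreal (weight N x y) \<partial>lborel) + ennreal (\<sigma>/2) * (\<integral>\<^sup>+y. ennreal (H y powr p y) \<partial>lborel)"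
    by (subst nn_integral_add) (auto simp: nn_integral_cmult)
  also have "\<dots> \<le> 1 + ennreal (\<sigma>/2) * 1" by (intro add_mono nn_integral_weight mult_left_mono H_mod) auto
  also have "\<dots> = ennreal (1 + \<sigma>/2)" using \<sigma> by simp
  finally show ?thesis .
qed

lemma conv_eq: "conv x = ennreal (2 * half_conv x)" and half_conv_nonneg: "half_conv x \<ge> 0" and half_conv_le: "half_conv x \<le> 1/2 + \<sigma>/4"
proof -
  have fin: "conv x < top" using conv_le[of x] by (rule le_less_trans) simp
  then show "conv x = ennreal (2 * half_conv x)" by (simp add: half_conv_def ennreal_enn2real)
  show a0: "half_conv x \<ge> 0" by (simp add: half_conv_def)
  have "enn2real (conv x) \<le> 1 + \<sigma>/2" using conv_le[of x] \<sigma> by (intro enn2real_leI) auto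
  then show "half_conv x \<le> 1/2 + \<sigma>/4" by (simp add: half_conv_def)
qed

lemma conv_measurable [measurable]: "conv \<in> borel_measurable borel"
  unfolding conv_def[abs_def] by measurable

lemma half_conv_measurable [measurable]: "half_conv \<in> borel_measurable borel"
  unfolding half_conv_def[abs_def] by measurable

text \<open>The values of \<open>H\<close> below half of the convolution contribute at most that half. Restricting to the
  large values replaces the use of Jensen inequality on cubes: there \<open>H\<close> can be compared with its
  own powers.\<close>
lemma half_conv_le_large_part:
  "ennreal (half_conv x) \<le> (\<integral>\<^sup>+y. ennreal (weight N x y) * ennreal (H y) * indicator {y. H y > half_conv x} y \<partial>lborel)" (is "_ \<le> ?X")
proof -
  have "conv x \<le> (\<integral>\<^sup>+y. ennreal (weight N x y) * ennreal (half_conv x) + ennreal (weight N x y) * ennreal (H y) * indicator {y. H y > half_conv x} y \<partial>lborel)"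
    unfolding conv_def
    by (rule nn_integral_mono) (auto simp: indicator_def intro!: mult_left_mono ennreal_leI)
  also have "\<dots> = (\<integral>\<^sup>+y. ennreal (weight N x y) \<partial>lborel) * ennreal (half_conv x) + ?X"
    by (subst nn_integral_add) (auto simp: nn_integral_multc)
  also have "\<dots> \<le> 1 * ennreal (half_conv x) + ?X" by (intro add_mono mult_right_mono nn_integral_weight) auto
  finally have "ennreal (half_conv x) + ennreal (half_conv x) \<le> ennreal (half_conv x) + ?X"
    using half_conv_nonneg[of x] by (simp add: conv_eq flip: ennreal_plus)
  then show ?thesis by (simp add: ennreal_add_left_cancel_le)
qed

text \<open>Convolution of an integrable function with the integrable kernel \<open>weight 2\<close>; its integral does not
  depend on \<open>\<sigma>\<close>.\<close>
definition majorant :: "real \<Rightarrow> ennreal" where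
  "majorant x = (\<integral>\<^sup>+y. ennreal (weight 2 x y) * (ennreal (H y powr p y) + ennreal (decay y)) \<partial>lborel)"

text \<open>Where the convolution is large, the exponent at \<open>x\<close> is exchanged for the one at \<open>y\<close>; the local
  condition limits the cost to a power of \<open>1 + \<sigma> \<bar>x - y\<bar>\<close>, as \<open>half_conv x \<le> \<sigma>\<close> there.\<close>
lemma half_conv_powr_le_if_ge1:
  assumes "half_conv x \<ge> 1"
  shows "ennreal (half_conv x powr p x) \<le> ennreal (exp (2 * c1)) * majorant x"
proof -
  have s1: "\<sigma> \<ge> 1" "half_conv x \<le> \<sigma>" using half_conv_le[of x] assms by auto
  have "ennreal (half_conv x powr p x) = ennreal (half_conv x powr (p x - 1)) * ennreal (half_conv x)"
    using assms by (simp add: ennreal_mult'[symmetric] powr_diff)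
  also have "\<dots> \<le> ennreal (half_conv x powr (p x - 1)) * (\<integral>\<^sup>+y. ennreal (weight N x y) * ennreal (H y) * indicator {y. H y > half_conv x} y \<partial>lborel)"
    by (intro mult_left_mono half_conv_le_large_part) auto
  also have "\<dots> = (\<integral>\<^sup>+y. ennreal (half_conv x powr (p x - 1)) * (ennreal (weight N x y) * ennreal (H y) * indicator {y. H y > half_conv x} y) \<partial>lborel)"
    by (rule nn_integral_cmult[symmetric]) measurable
  also have "\<dots> \<le> (\<integral>\<^sup>+y. ennreal (exp (2 * c1)) * (ennreal (weight 2 x y) * (ennreal (H y powr p y) + ennreal (decay y))) \<partial>lborel)"
  proof (rule nn_integral_mono)
    fix y
    show "ennreal (half_conv x powr (p x - 1)) * (ennreal (weight N x y) * ennreal (H y) * indicator {y. H y > half_conv x} y)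
      \<le> ennreal (exp (2 * c1)) * (ennreal (weight 2 x y) * (ennreal (H y powr p y) + ennreal (decay y)))"
    proof (cases "H y > half_conv x")
      case True
      have a0: "half_conv x > 0" using assms by simp
      have H0: "H y > 0" using True a0 by simp
      have "half_conv x powr (p x - 1) * H y = half_conv x powr (p x - p y) * (half_conv x powr (p y - 1) * H y)"
        using a0 by (simp flip: powr_add mult.assoc)
      also have "\<dots> \<le> half_conv x powr (p x - p y) * (H y powr (p y - 1) * H y)"
        using True a0 H0 p_ge1[of y] by (intro mult_left_mono mult_right_mono powr_mono2) auto
      also have "H y powr (p y - 1) * H y = H y powr p y" using H0 by (simp add: powr_diff)
      also have "half_conv x powr (p x - p y) \<le> half_conv x powr \<bar>p x - p y\<bar>" using assms by (intro powr_mono) auto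
      also have "\<dots> \<le> \<sigma> powr \<bar>p x - p y\<bar>" using s1 a0 by (intro powr_mono2) auto
      also have "\<dots> \<le> exp (2 * c1) * (1 + \<sigma> * \<bar>x - y\<bar>) ^ (N - 2)" by (rule powr_local_log_bound[OF s1(1) N])
      finally have "half_conv x powr (p x - 1) * H y \<le> exp (2 * c1) * (1 + \<sigma> * \<bar>x - y\<bar>) ^ (N - 2) * H y powr p y"
        by (simp add: mult_right_mono)
      then have "weight N x y * (half_conv x powr (p x - 1) * H y) \<le> weight N x y * (exp (2 * c1) * (1 + \<sigma> * \<bar>x - y\<bar>) ^ (N - 2) * H y powr p y)"
        by (intro mult_left_mono weight_nonneg)
      also have "\<dots> = exp (2 * c1) * (weight 2 x y * H y powr p y)" unfolding weight_split[symmetric] by simp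
      also have "\<dots> \<le> exp (2 * c1) * (weight 2 x y * (H y powr p y + decay y))"
        using weight_nonneg decay_nonneg by (intro mult_left_mono) auto
      finally have "ennreal (weight N x y * (half_conv x powr (p x - 1) * H y)) \<le> ennreal (exp (2 * c1) * (weight 2 x y * (H y powr p y + decay y)))"
        by (rule ennreal_leI)
      then show ?thesis using True weight_nonneg H_nonneg[of y] decay_nonneg[of y]
        by (simp add: ennreal_mult' ennreal_mult'' mult_ac)
    qed simp
  qed
  also have "\<dots> = ennreal (exp (2 * c1)) * majorant x" unfolding majorant_def by (rule nn_integral_cmult) measurable
  finally show ?thesis .
qed

text \<open>Where the convolution is small, both exponents are exchanged for the limit exponent \<open>q\<close>.\<close>
lemma half_conv_powr_le_if_less1:
  assumes "half_conv x < 1"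
  shows "ennreal (half_conv x powr p x) \<le> ennreal (exp (2 * c2) * exp (2 * c2)) * majorant x + ennreal (decay x)"
proof -
  have e2: "exp (2 * c2) \<ge> 1" using c2_pos by simp
  have "ennreal (half_conv x powr q) = ennreal (half_conv x powr (q - 1)) * ennreal (half_conv x)"
    using half_conv_nonneg[of x] by (cases "half_conv x = 0") (simp_all add: ennreal_mult'[symmetric] powr_diff)
  also have "\<dots> \<le> ennreal (half_conv x powr (q - 1)) * (\<integral>\<^sup>+y. ennreal (weight N x y) * ennreal (H y) * indicator {y. H y > half_conv x} y \<partial>lborel)"
    by (intro mult_left_mono half_conv_le_large_part) auto
  also have "\<dots> = (\<integral>\<^sup>+y. ennreal (half_conv x powr (q - 1)) * (ennreal (weight N x y) * ennreal (H y) * indicator {y. H y > half_conv x} y) \<partial>lborel)"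
    by (rule nn_integral_cmult[symmetric]) measurable
  also have "\<dots> \<le> (\<integral>\<^sup>+y. ennreal (exp (2 * c2)) * (ennreal (weight 2 x y) * (ennreal (H y powr p y) + ennreal (decay y))) \<partial>lborel)"
  proof (rule nn_integral_mono)
    fix y
    show "ennreal (half_conv x powr (q - 1)) * (ennreal (weight N x y) * ennreal (H y) * indicator {y. H y > half_conv x} y)
      \<le> ennreal (exp (2 * c2)) * (ennreal (weight 2 x y) * (ennreal (H y powr p y) + ennreal (decay y)))"
    proof (cases "H y > half_conv x")
      case True
      have H0: "H y > 0" using True half_conv_nonneg[of x] by simp
      have "half_conv x powr (q - 1) * H y \<le> exp (2 * c2) * H y powr p y + decay y"
      proof (cases "H y \<ge> 1")
        case True
        have "half_conv x powr (q - 1) \<le> 1" using half_conv_nonneg[of x] assms q_ge1 by (intro powr_le1) auto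
        then have "half_conv x powr (q - 1) * H y \<le> 1 * H y" using H0 by (intro mult_right_mono) auto
        also have "\<dots> = H y powr 1" using H0 by simp
        also have "\<dots> \<le> H y powr p y" by (intro powr_mono p_ge1 True)
        also have "\<dots> \<le> exp (2 * c2) * H y powr p y" using e2 by (simp add: mult_le_cancel_right1)
        finally show ?thesis using decay_nonneg[of y] by simp
      next
        case False
        have "half_conv x powr (q - 1) * H y \<le> H y powr (q - 1) * H y"
          using True H0 half_conv_nonneg[of x] q_ge1 by (intro mult_right_mono powr_mono2) auto
        also have "\<dots> = H y powr q" using H0 by (simp add: powr_diff)
        also have "\<dots> \<le> exp (2 * c2) * H y powr p y + decay y"
          using decay_log[of y] q_ge1 False H0 by (intro powr_change_exponent) (auto simp: abs_minus_commute)
        finally show ?thesis .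
      qed
      also have "\<dots> \<le> exp (2 * c2) * (H y powr p y + decay y)"
        using e2 decay_nonneg[of y] by (simp add: distrib_left mult_le_cancel_right1)
      finally have "half_conv x powr (q - 1) * H y \<le> exp (2 * c2) * (H y powr p y + decay y)" .
      then have "weight N x y * (half_conv x powr (q - 1) * H y) \<le> weight 2 x y * (exp (2 * c2) * (H y powr p y + decay y))"
        by (rule mult_mono[OF weight_le_weight2 _ weight_nonneg]) (use H0 in auto)
      then have "ennreal (weight N x y * (half_conv x powr (q - 1) * H y)) \<le> ennreal (weight 2 x y * (exp (2 * c2) * (H y powr p y + decay y)))"
        by (rule ennreal_leI)
      then show ?thesis using True weight_nonneg H_nonneg[of y] decay_nonneg[of y]
        by (simp add: ennreal_mult' ennreal_mult'' mult_ac)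
    qed simp
  qed
  also have "\<dots> = ennreal (exp (2 * c2)) * majorant x" unfolding majorant_def by (rule nn_integral_cmult) measurable
  finally have aq: "ennreal (half_conv x powr q) \<le> ennreal (exp (2 * c2)) * majorant x" .
  have "half_conv x powr p x \<le> exp (2 * c2) * half_conv x powr q + decay x"
    using decay_log[of x] p_ge1[of x] half_conv_nonneg[of x] assms by (intro powr_change_exponent) auto
  then have "ennreal (half_conv x powr p x) \<le> ennreal (exp (2 * c2) * half_conv x powr q + decay x)" by (rule ennreal_leI)
  also have "\<dots> = ennreal (exp (2 * c2)) * ennreal (half_conv x powr q) + ennreal (decay x)"
    using decay_nonneg[of x] by (simp add: ennreal_mult')
  also have "\<dots> \<le> ennreal (exp (2 * c2)) * (ennreal (exp (2 * c2)) * majorant x) + ennreal (decay x)"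
    by (intro add_mono mult_left_mono aq) auto
  finally show ?thesis by (simp add: ennreal_mult' mult.assoc)
qed

lemma half_conv_powr_le: "ennreal (half_conv x powr p x) \<le> ennreal conv_const * (majorant x + ennreal (decay x))"
proof (cases "half_conv x \<ge> 1")
  case True
  have "ennreal (exp (2 * c1)) * majorant x \<le> ennreal conv_const * (majorant x + ennreal (decay x))"
    by (intro mult_mono ennreal_leI) (auto simp: conv_const_def)
  then show ?thesis using half_conv_powr_le_if_ge1[OF True] by simp
next
  case False
  have "1 \<le> exp (2 * c2) * exp (2 * c2)" using c2_pos by (simp flip: exp_add)
  then have C1: "ennreal 1 \<le> ennreal conv_const" by (intro ennreal_leI) (simp add: conv_const_def add_increasing)
  have "ennreal (exp (2 * c2) * exp (2 * c2)) * majorant x + 1 * ennreal (decay x) \<le> ennreal conv_const * majorant x + ennreal conv_const * ennreal (decay x)"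
    using C1 by (intro add_mono mult_right_mono ennreal_leI) (auto simp: conv_const_def)
  then show ?thesis using half_conv_powr_le_if_less1[of x] False by (simp add: distrib_left)
qed

lemma nn_integral_majorant: "(\<integral>\<^sup>+x. majorant x \<partial>lborel) \<le> 3"
proof -
  have "(\<integral>\<^sup>+x. majorant x \<partial>lborel) = (\<integral>\<^sup>+y. \<integral>\<^sup>+x. ennreal (weight 2 x y) * (ennreal (H y powr p y) + ennreal (decay y)) \<partial>lborel \<partial>lborel)"
    unfolding majorant_def by (rule lborel_pair.Fubini') measurable
  also have "\<dots> = (\<integral>\<^sup>+y. (\<integral>\<^sup>+x. ennreal (weight 2 y x) \<partial>lborel) * (ennreal (H y powr p y) + ennreal (decay y)) \<partial>lborel)"
    by (intro nn_integral_cong) (subst nn_integral_multc, auto simp: weight_commute)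
  also have "\<dots> = (\<integral>\<^sup>+y. ennreal (H y powr p y) \<partial>lborel) + (\<integral>\<^sup>+y. ennreal (decay y) \<partial>lborel)"
    unfolding nn_integral_weight2 by (simp add: nn_integral_add)
  also have "\<dots> \<le> 1 + 2" by (intro add_mono H_mod nn_integral_decay)
  finally show ?thesis by simp
qed

lemma nn_integral_half_conv_powr: "(\<integral>\<^sup>+x. ennreal (half_conv x powr p x) \<partial>lborel) \<le> ennreal (5 * conv_const)"
proof -
  have [measurable]: "majorant \<in> borel_measurable borel" unfolding majorant_def[abs_def] by measurable
  have conv_const: "conv_const \<ge> 0" by (simp add: conv_const_def)
  have "(\<integral>\<^sup>+x. ennreal (half_conv x powr p x) \<partial>lborel) \<le> (\<integral>\<^sup>+x. ennreal conv_const * (majorant x + ennreal (decay x)) \<partial>lborel)"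
    by (intro nn_integral_mono half_conv_powr_le)
  also have "\<dots> = ennreal conv_const * ((\<integral>\<^sup>+x. majorant x \<partial>lborel) + (\<integral>\<^sup>+x. ennreal (decay x) \<partial>lborel))"
    by (subst nn_integral_cmult, measurable, subst nn_integral_add) auto
  also have "\<dots> \<le> ennreal conv_const * (3 + 2)" by (intro mult_left_mono add_mono nn_integral_majorant nn_integral_decay) auto
  also have "\<dots> = ennreal (5 * conv_const)" using conv_const by (simp add: ennreal_mult'' mult.commute)
  finally show ?thesis .
qed

end

end

section \<open>Modular and norm\<close>

lemma modular_lborel: "modular p f = (\<integral>\<^sup>+ y. ennreal (norm (f y) powr p y) \<partial>lborel)"
  unfolding modular_def by (rule nn_integral_completion)

text \<open>As exponents are at least 1, dividing by \<open>s \<ge> 1\<close> divides the modular by at least \<open>s\<close>.\<close>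
lemma modular_divide_le:
  assumes p1: "\<And>x. 1 \<le> p x" and [measurable]: "p \<in> borel_measurable lebesgue" "f \<in> borel_measurable lebesgue"
    and s: "s \<ge> 1"
  shows "modular p (\<lambda>y. f y / complex_of_real s) \<le> ennreal (1 / s) * modular p f"
proof -
  have "modular p (\<lambda>y. f y / complex_of_real s) \<le> (\<integral>\<^sup>+ y. ennreal (1/s) * ennreal (norm (f y) powr p y) \<partial>lebesgue)"
    unfolding modular_def
  proof (rule nn_integral_mono)
    fix y
    have "s powr 1 \<le> s powr p y" using s p1 by (intro powr_mono) auto
    then have "norm (f y) powr p y / s powr p y \<le> norm (f y) powr p y / s"
      using s by (intro divide_left_mono) auto
    then have "norm (f y / complex_of_real s) powr p y \<le> 1 / s * norm (f y) powr p y"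
      using s by (simp add: norm_divide powr_divide)
    then show "ennreal (norm (f y / complex_of_real s) powr p y) \<le> ennreal (1/s) * ennreal (norm (f y) powr p y)"
      using s by (simp add: ennreal_mult'[symmetric])
  qed
  also have "\<dots> = ennreal (1/s) * modular p f"
    unfolding modular_def by (rule nn_integral_cmult) measurable
  finally show ?thesis .
qed

lemma Lp_normalizable:
  assumes p1: "\<And>x. 1 \<le> p x" and pm: "p \<in> borel_measurable lebesgue" and f: "f \<in> Lp p"
  shows "\<exists>\<eta>>0. modular p (\<lambda>y. f y / complex_of_real \<eta>) < 1"
proof -
  obtain t where t: "t > 0" "modular p (\<lambda>y. f y / complex_of_real t) < \<infinity>" and fm: "f \<in> borel_measurable lebesgue"
    using f by (auto simp: Lp_def)
  obtain m where m: "modular p (\<lambda>y. f y / complex_of_real t) = ennreal m" "m \<ge> 0"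
    using t(2) by (cases "modular p (\<lambda>y. f y / complex_of_real t)") auto
  define s where "s = 2 * m + 1"
  have "modular p (\<lambda>y. f y / complex_of_real t / complex_of_real s) \<le> ennreal (1/s) * ennreal m"
    unfolding m(1)[symmetric] using fm m(2) by (intro modular_divide_le p1 pm) (auto simp: s_def)
  also have "\<dots> = ennreal (m / s)" using m(2) by (simp add: ennreal_mult''[symmetric])
  also have "\<dots> < 1" using m(2) by (simp add: s_def field_simps ennreal_less_one_iff)
  finally show ?thesis using t(1) m(2)
    by (intro exI[of _ "t * s"]) (auto simp: s_def)
qed

lemma Lp_norm_nonneg:
  assumes "\<And>x. 1 \<le> p x" "p \<in> borel_measurable lebesgue" "f \<in> Lp p"
  shows "0 \<le> Lp_norm p f"
  unfolding Lp_norm_def using Lp_normalizable[OF assms] by (intro cInf_greatest) auto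

lemma Lp_diff:
  assumes p1: "\<And>x. 1 \<le> p x" and pm [measurable]: "p \<in> borel_measurable lebesgue" and f: "f \<in> Lp p" and g: "g \<in> Lp p"
  shows "(\<lambda>x. f x - g x) \<in> Lp p"
proof -
  obtain s where s: "s > 0" "modular p (\<lambda>y. f y / complex_of_real s) < \<infinity>" and [measurable]: "f \<in> borel_measurable lebesgue"
    using f by (auto simp: Lp_def)
  obtain t where t: "t > 0" "modular p (\<lambda>y. g y / complex_of_real t) < \<infinity>" and [measurable]: "g \<in> borel_measurable lebesgue"
    using g by (auto simp: Lp_def)
  define T where "T = s + t"
  have T: "T > 0" using s t by (simp add: T_def)
  have "modular p (\<lambda>y. (f y - g y) / complex_of_real T) \<le>
     (\<integral>\<^sup>+y. ennreal (norm (f y / complex_of_real s) powr p y) + ennreal (norm (g y / complex_of_real t) powr p y) \<partial>lebesgue)"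
    unfolding modular_def
  proof (rule nn_integral_mono)
    fix y
    define M where "M = max (norm (f y) / s) (norm (g y) / t)"
    have "norm (f y) \<le> s * M" "norm (g y) \<le> t * M"
      using s t by (simp_all add: M_def max_def field_simps)
    then have "norm (f y - g y) \<le> T * M" using norm_triangle_ineq4[of "f y" "g y"] by (simp add: T_def algebra_simps)
    then have "norm ((f y - g y) / complex_of_real T) \<le> M" using T by (simp add: norm_divide field_simps)
    then have "norm ((f y - g y) / complex_of_real T) powr p y \<le> M powr p y"
      using p1[of y] by (intro powr_mono2) auto
    also have "\<dots> \<le> (norm (f y) / s) powr p y + (norm (g y) / t) powr p y"
      by (simp add: M_def max_def)
    finally have "norm ((f y - g y) / complex_of_real T) powr p y \<le> norm (f y / complex_of_real s) powr p y + norm (g y / complex_of_real t) powr p y"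
      using s t by (simp add: norm_divide)
    then show "ennreal (norm ((f y - g y) / complex_of_real T) powr p y) \<le> ennreal (norm (f y / complex_of_real s) powr p y) + ennreal (norm (g y / complex_of_real t) powr p y)"
      by (simp flip: ennreal_plus)
  qed
  also have "\<dots> = modular p (\<lambda>y. f y / complex_of_real s) + modular p (\<lambda>y. g y / complex_of_real t)"
    unfolding modular_def by (rule nn_integral_add) measurable
  also have "\<dots> < \<infinity>" using s t by simp
  finally show ?thesis using T unfolding Lp_def by auto
qed

lemma Lp_norm_le:
  assumes "\<eta> > 0" "modular p (\<lambda>y. f y / complex_of_real \<eta>) < 1"
  shows "Lp_norm p f \<le> \<eta>"
  unfolding Lp_norm_def by (rule cInf_lower) (use assms in \<open>auto intro!: bdd_belowI[of _ 0]\<close>)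

text \<open>The local logarithmic condition forces continuity, and hence Borel measurability, of the exponent.\<close>
lemma log_exponents_imp_log_hoelder:
  assumes "p \<in> log_exponents"
  obtains c1 c2 q where "log_hoelder p c1 c2 q"
proof -
  obtain c1 c2 q where c: "c1 > 0" "c2 > 0"
     "\<And>x y. \<bar>p x - p y\<bar> * ln (exp 1 + 1 / \<bar>x - y\<bar>) \<le> c1"
     "\<And>x. \<bar>p x - q\<bar> * ln (exp 1 + \<bar>x\<bar>) \<le> c2"
    using assms unfolding log_exponents_def by auto
  have p1: "1 \<le> p x" for x using assms by (simp add: log_exponents_def exponents_def)
  have "continuous_on UNIV p"
  proof (rule continuous_onI)
    fix x e :: real assume e: "e > 0"
    \<comment> \<open>Closer than \<open>d\<close>, the logarithm in the local condition exceeds \<open>c1 / e\<close>.\<close>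
    define d where "d = exp (- (c1 / e))"
    show "\<exists>d>0. \<forall>x'\<in>UNIV. dist x' x < d \<longrightarrow> dist (p x') (p x) \<le> e"
    proof (intro exI[of _ d] conjI ballI impI)
      fix y assume y: "dist y x < d"
      show "dist (p y) (p x) \<le> e"
      proof (cases "y = x")
        case False
        then have pos: "\<bar>y - x\<bar> > 0" by simp
        have "exp (c1 / e) = 1 / d" by (simp add: d_def exp_minus field_simps)
        also have "\<dots> \<le> 1 / \<bar>y - x\<bar>" using y pos by (intro divide_left_mono) (auto simp: dist_real_def d_def)
        also have "\<dots> \<le> exp 1 + 1 / \<bar>y - x\<bar>" by simp
        finally have "c1 / e \<le> ln (exp 1 + 1 / \<bar>y - x\<bar>)"
          using pos by (subst ln_ge_iff) (auto intro: add_pos_pos)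
        then have "\<bar>p y - p x\<bar> * (c1 / e) \<le> c1"
          using c(3)[of y x] mult_left_mono[of "c1/e" _ "\<bar>p y - p x\<bar>"] by fastforce
        then show ?thesis using e c(1) by (simp add: field_simps dist_real_def)
      qed (use e in simp)
    qed (simp add: d_def)
  qed
  then have "p \<in> borel_measurable borel" by (rule borel_measurable_continuous_onI)
  then have "log_hoelder p c1 c2 q" using c p1 by (simp add: log_hoelder_def)
  then show ?thesis using that by blast
qed

context log_hoelder
begin

lemma p_lebesgue [measurable]: "p \<in> borel_measurable lebesgue"
  using p_meas by (intro measurable_completion) simp

text \<open>Functions dominated by a convolution with a rapidly decaying kernel: the bound for the norm is
  uniform in the width of the kernel. The factor 40 collects the normalisation 2 of the kernel, the 2 in
  \<open>half_conv\<close>, and \<open>10 * conv_const\<close>, which brings a modular of at most \<open>5 * conv_const\<close> below 1.\<close>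
lemma kernel_domination_norm_bound:
  assumes \<sigma>: "\<sigma> > 0" and N: "real N \<ge> 2 * c1 + 2" and h: "h \<in> Lp p" and F: "F \<in> borel_measurable lebesgue"
    and B: "B > 0"
    and dom: "\<And>x. ennreal (norm (F x)) \<le> ennreal B * (\<integral>\<^sup>+y. ennreal (\<sigma> / (1 + \<sigma> * \<bar>x - y\<bar>) ^ N) * ennreal (norm (h y)) \<partial>lebesgue)"
  shows "F \<in> Lp p" "Lp_norm p F \<le> 40 * conv_const * B * Lp_norm p h"
proof -
  have hm [measurable]: "h \<in> borel_measurable lebesgue" using h by (simp add: Lp_def)
  have cc1: "conv_const \<ge> 1"
    using c1_pos by (simp add: conv_const_def add_increasing2)
  have key: "modular p (\<lambda>y. F y / complex_of_real (40 * conv_const * B * \<eta>)) < 1"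
    if \<eta>: "\<eta> > 0" and mod: "modular p (\<lambda>y. h y / complex_of_real \<eta>) < 1" for \<eta>
  proof -
    have "(\<lambda>y. norm (h y) / \<eta>) \<in> borel_measurable (completion lborel)" by measurable
    then obtain H' where H': "H' \<in> borel_measurable lborel" "AE y in lborel. norm (h y) / \<eta> = H' y"
      using completion_ex_borel_measurable_real by blast
    define H where "H y = max 0 (H' y)" for y
    have Hm: "H \<in> borel_measurable borel" using H'(1) unfolding H_def by simp
    have H0: "H y \<ge> 0" for y by (simp add: H_def)
    have HAE: "AE y in lborel. norm (h y) / \<eta> = H y"
      using H'(2)
    proof eventually_elim
      case (elim y)
      have "0 \<le> norm (h y) / \<eta>" using \<eta> by simp
      then show ?case using elim by (simp add: H_def)
    qed
    have "(\<integral>\<^sup>+y. ennreal (H y powr p y) \<partial>lborel) = modular p (\<lambda>y. h y / complex_of_real \<eta>)"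
      unfolding modular_lborel
    proof (rule nn_integral_cong_AE)
      show "AE y in lborel. ennreal (H y powr p y) = ennreal (norm (h y / complex_of_real \<eta>) powr p y)"
        using HAE by eventually_elim (use \<eta> in \<open>simp add: norm_divide\<close>)
    qed
    then have Hmod: "(\<integral>\<^sup>+y. ennreal (H y powr p y) \<partial>lborel) \<le> 1" using mod by simp
    note ctx = \<sigma> N Hm H0 Hmod
    have F_le: "norm (F x) \<le> 4 * B * \<eta> * half_conv \<sigma> N H x" for x
    proof -
      have "(\<integral>\<^sup>+y. ennreal (\<sigma> / (1 + \<sigma> * \<bar>x - y\<bar>) ^ N) * ennreal (norm (h y)) \<partial>lebesgue)
          = (\<integral>\<^sup>+y. ennreal (2 * \<eta>) * (ennreal (weight \<sigma> N x y) * ennreal (H y)) \<partial>lborel)"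
        unfolding nn_integral_completion
      proof (rule nn_integral_cong_AE)
        show "AE y in lborel. ennreal (\<sigma> / (1 + \<sigma> * \<bar>x - y\<bar>) ^ N) * ennreal (norm (h y)) =
            ennreal (2 * \<eta>) * (ennreal (weight \<sigma> N x y) * ennreal (H y))"
          using HAE
        proof eventually_elim
          case (elim y)
          have "norm (h y) = \<eta> * H y" using elim \<eta> by (simp add: field_simps)
          moreover have "\<sigma> / (1 + \<sigma> * \<bar>x - y\<bar>) ^ N = 2 * weight \<sigma> N x y" by (simp add: weight_def[OF ctx])
          ultimately show ?case using \<eta> weight_nonneg[OF ctx, of N x y] H0[of y]
            by (simp add: ennreal_mult'[symmetric] mult_ac)
        qed
      qed
      also have "\<dots> = ennreal (2 * \<eta>) * conv \<sigma> N H x"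
        unfolding conv_def[OF ctx] using Hm weight_measurable'[OF ctx] by (intro nn_integral_cmult) simp
      also have "\<dots> = ennreal (4 * \<eta> * half_conv \<sigma> N H x)"
        using \<eta> half_conv_nonneg[OF ctx] by (simp add: conv_eq[OF ctx] ennreal_mult'[symmetric])
      finally have "ennreal (norm (F x)) \<le> ennreal B * ennreal (4 * \<eta> * half_conv \<sigma> N H x)" using dom[of x] by simp
      also have "\<dots> = ennreal (4 * B * \<eta> * half_conv \<sigma> N H x)"
        using B \<eta> half_conv_nonneg[OF ctx] by (simp add: ennreal_mult'[symmetric] mult_ac)
      finally show ?thesis using B \<eta> half_conv_nonneg[OF ctx, of x] by (simp add: ennreal_le_iff)
    qed
    have "modular p (\<lambda>y. F y / complex_of_real (4 * B * \<eta>)) \<le> (\<integral>\<^sup>+x. ennreal (half_conv \<sigma> N H x powr p x) \<partial>lborel)"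
      unfolding modular_lborel
    proof (intro nn_integral_mono ennreal_leI powr_mono2)
      fix x
      have "4 * B * \<eta> > 0" using B \<eta> by simp
      then have "norm (F x / complex_of_real (4 * B * \<eta>)) = norm (F x) / (4 * B * \<eta>)" 
        by (simp only: norm_divide norm_of_real abs_of_pos)
      also have "\<dots> \<le> half_conv \<sigma> N H x" using F_le[of x] B \<eta> by (simp add: divide_le_eq mult_ac)
      finally show "norm (F x / complex_of_real (4 * B * \<eta>)) \<le> half_conv \<sigma> N H x" .
      show "0 \<le> p x" using p_ge1[of x] by simp
    qed auto
    also have "\<dots> \<le> ennreal (5 * conv_const)" by (rule nn_integral_half_conv_powr[OF ctx])
    finally have m5: "modular p (\<lambda>y. F y / complex_of_real (4 * B * \<eta>)) \<le> ennreal (5 * conv_const)" .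
    have "modular p (\<lambda>y. F y / complex_of_real (4 * B * \<eta>) / complex_of_real (10 * conv_const))
        \<le> ennreal (1 / (10 * conv_const)) * modular p (\<lambda>y. F y / complex_of_real (4 * B * \<eta>))"
      using F cc1 by (intro modular_divide_le p_ge1 p_lebesgue) auto
    also have "\<dots> \<le> ennreal (1 / (10 * conv_const)) * ennreal (5 * conv_const)" by (intro mult_left_mono m5) auto
    also have "\<dots> = ennreal (1/2)" using conv_const_pos by (simp add: ennreal_mult'[symmetric])
    also have "\<dots> < ennreal 1" by (subst ennreal_less_iff) auto
    finally show ?thesis by (simp add: mult_ac flip: ennreal_1)
  qed
  have cpos: "40 * conv_const * B > 0" using conv_const_pos B by simp
  obtain \<eta>0 where \<eta>0: "\<eta>0 > 0" "modular p (\<lambda>y. h y / complex_of_real \<eta>0) < 1"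
    using Lp_normalizable[OF p_ge1 p_lebesgue h] by blast
  show "F \<in> Lp p"
    unfolding Lp_def mem_Collect_eq
  proof (intro conjI F exI[of _ "40 * conv_const * B * \<eta>0"])
    show "40 * conv_const * B * \<eta>0 > 0" using cpos \<eta>0 by simp
    show "modular p (\<lambda>y. F y / complex_of_real (40 * conv_const * B * \<eta>0)) < \<infinity>"
      by (rule less_trans[OF key[OF \<eta>0]]) simp
  qed
  have "Lp_norm p F / (40 * conv_const * B) \<le> Lp_norm p h"
    unfolding Lp_norm_def[of p h]
  proof (rule cInf_greatest)
    show "{\<eta>. 0 < \<eta> \<and> modular p (\<lambda>y. h y / complex_of_real \<eta>) < 1} \<noteq> {}" using \<eta>0 by blast
    fix \<eta> assume "\<eta> \<in> {\<eta>. 0 < \<eta> \<and> modular p (\<lambda>y. h y / complex_of_real \<eta>) < 1}"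
    then have "Lp_norm p F \<le> 40 * conv_const * B * \<eta>" using cpos by (intro Lp_norm_le key) auto
    then show "Lp_norm p F / (40 * conv_const * B) \<le> \<eta>" using cpos by (simp add: divide_le_eq mult_ac)
  qed
  then show "Lp_norm p F \<le> 40 * conv_const * B * Lp_norm p h" using cpos by (simp add: divide_le_eq mult_ac)
qed

text \<open>Pointwise \<open>t \<le> 1 + t powr p y\<close>, so a function of finite modular is the sum of a bounded and an
  integrable one.\<close>
lemma Lp_integral_linear_growth:
  assumes h: "h \<in> Lp p"
  obtains M where "M \<ge> 0" "\<And>a b. a \<le> b \<Longrightarrow> (\<integral>\<^sup>+y. ennreal (norm (h y)) * indicator {a..b} y \<partial>lebesgue) \<le> ennreal (M * (1 + (b - a)))"
proof -
  have hm [measurable]: "h \<in> borel_measurable lebesgue" using h by (simp add: Lp_def)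
  obtain \<eta> where \<eta>: "\<eta> > 0" "modular p (\<lambda>y. h y / complex_of_real \<eta>) < 1"
    using Lp_normalizable[OF p_ge1 p_lebesgue h] by blast
  show ?thesis
  proof (rule that[of \<eta>])
    fix a b :: real assume ab: "a \<le> b"
    have "(\<integral>\<^sup>+y. ennreal (norm (h y)) * indicator {a..b} y \<partial>lebesgue) \<le>
       (\<integral>\<^sup>+y. ennreal \<eta> * (indicator {a..b} y + ennreal (norm (h y / complex_of_real \<eta>) powr p y)) \<partial>lebesgue)"
    proof (rule nn_integral_mono)
      fix y
      define t where "t = norm (h y / complex_of_real \<eta>)"
      have t: "norm (h y) = \<eta> * t" "t \<ge> 0" using \<eta> by (simp_all add: t_def norm_divide)
      have "t \<le> 1 + t powr p y"
      proof (cases "t \<le> 1")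
        case False
        then have "t powr 1 \<le> t powr p y" by (intro powr_mono p_ge1) auto
        then show ?thesis using False by simp
      qed (simp add: add_increasing2)
      then have "\<eta> * t \<le> \<eta> * (1 + t powr p y)" using \<eta> by (intro mult_left_mono) auto
      then have "ennreal (norm (h y)) \<le> ennreal (\<eta> * (1 + t powr p y))" unfolding t by (rule ennreal_leI)
      also have "\<dots> = ennreal \<eta> * (1 + ennreal (t powr p y))"
        using \<eta> by (simp add: ennreal_mult' ennreal_plus)
      finally have "ennreal (norm (h y)) \<le> ennreal \<eta> * (1 + ennreal (t powr p y))" .
      then show "ennreal (norm (h y)) * indicator {a..b} y \<le> ennreal \<eta> * (indicator {a..b} y + ennreal (norm (h y / complex_of_real \<eta>) powr p y))"
        unfolding t_def[symmetric] by (auto simp: indicator_def)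
    qed
    also have "\<dots> = ennreal \<eta> * (ennreal (b - a) + modular p (\<lambda>y. h y / complex_of_real \<eta>))"
      unfolding modular_def
    proof -
      have m: "(\<lambda>y. ennreal (norm (h y / complex_of_real \<eta>) powr p y)) \<in> borel_measurable lebesgue"
        by measurable
      have i: "(indicator {a..b} :: real \<Rightarrow> ennreal) \<in> borel_measurable lebesgue"
        by (rule borel_measurable_indicator) simp
      have "(\<integral>\<^sup>+y. indicator {a..b} y \<partial>lebesgue) = ennreal (b - a)"
        using ab by (subst nn_integral_indicator) auto
      then show "(\<integral>\<^sup>+y. ennreal \<eta> * (indicator {a..b} y + ennreal (norm (h y / complex_of_real \<eta>) powr p y)) \<partial>lebesgue) =
        ennreal \<eta> * (ennreal (b - a) + (\<integral>\<^sup>+y. ennreal (norm (h y / complex_of_real \<eta>) powr p y) \<partial>lebesgue))"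
        using i m by (subst nn_integral_cmult) (auto simp: nn_integral_add)
    qed
    also have "\<dots> \<le> ennreal \<eta> * (ennreal (b - a) + 1)"
      by (intro mult_left_mono add_mono less_imp_le[OF \<eta>(2)]) auto
    also have "\<dots> = ennreal (\<eta> * (1 + (b - a)))"
      using \<eta> ab by (simp add: ennreal_mult' ennreal_plus add.commute)
    finally show "(\<integral>\<^sup>+y. ennreal (norm (h y)) * indicator {a..b} y \<partial>lebesgue) \<le> ennreal (\<eta> * (1 + (b - a)))" .
  qed (use \<eta> in simp)
qed

end

section \<open>A band-limited kernel\<close>

definition csinc :: "complex \<Rightarrow> complex" where "csinc z = (if z = 0 then 1 else sin z / z)"

lemma csinc_holomorphic: "csinc holomorphic_on UNIV"
proof (rule no_isolated_singularity')
  have "(sin has_field_derivative cos 0) (at (0::complex))" by (rule DERIV_sin)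
  then have "((\<lambda>z::complex. sin z / z) \<longlongrightarrow> 1) (at 0)"
    by (simp add: has_field_derivative_iff)
  then have "(csinc \<longlongrightarrow> 1) (at 0)"
    by (rule Lim_transform_eventually) (auto simp: eventually_at csinc_def intro: exI[of _ 1])
  then show "(csinc \<longlongrightarrow> csinc z) (at z)" if "z \<in> {0}" for z
    using that by (simp add: csinc_def)
  have "(\<lambda>z::complex. sin z / z) holomorphic_on (UNIV - {0})"
    by (intro holomorphic_intros) auto
  then show "csinc holomorphic_on UNIV - {0}"
    by (rule holomorphic_transform) (auto simp: csinc_def)
qed auto

lemma norm_sin_le: "norm (sin z) \<le> exp \<bar>Im z\<bar>" for z :: complex
proof -
  have "sin z = (exp (\<i> * z) - exp (- (\<i> * z))) / (2 * \<i>)" by (rule sin_exp_eq)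
  then have "norm (sin z) = norm (exp (\<i> * z) - exp (- (\<i> * z))) / 2" by (simp add: norm_divide norm_mult)
  also have "\<dots> \<le> (norm (exp (\<i> * z)) + norm (exp (- (\<i> * z)))) / 2"
    by (intro divide_right_mono norm_triangle_ineq4) auto
  also have "\<dots> = (exp (- Im z) + exp (Im z)) / 2" by (simp add: norm_exp_eq_Re)
  also have "\<dots> \<le> (exp \<bar>Im z\<bar> + exp \<bar>Im z\<bar>) / 2" by (intro divide_right_mono add_mono) auto
  finally show ?thesis by simp
qed

lemma csinc_bound: "\<exists>C>0. \<forall>z. norm (csinc z) \<le> C * exp \<bar>Im z\<bar> / (1 + norm z)"
proof -
  have "compact (csinc ` cball 0 1)"
    by (intro compact_continuous_image holomorphic_on_imp_continuous_on holomorphic_on_subset[OF csinc_holomorphic]) auto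
  then obtain B where B: "B > 0" "\<And>z. z \<in> cball 0 1 \<Longrightarrow> norm (csinc z) \<le> B"
    using compact_imp_bounded bounded_pos by (metis imageI)
  have "norm (csinc z) \<le> (2 * B + 2) * exp \<bar>Im z\<bar> / (1 + norm z)" for z
  proof (cases "norm z \<le> 1")
    case True
    have "norm (csinc z) * (1 + norm z) \<le> B * 2" using B True by (intro mult_mono) auto
    also have "\<dots> \<le> (2 * B + 2) * 1" by simp
    also have "\<dots> \<le> (2 * B + 2) * exp \<bar>Im z\<bar>" using B by (intro mult_left_mono) auto
    finally show ?thesis by (subst pos_le_divide_eq) (auto intro: add_pos_nonneg)
  next
    case False
    then have "norm (csinc z) = norm (sin z) / norm z" by (auto simp: csinc_def norm_divide)
    also have "\<dots> \<le> exp \<bar>Im z\<bar> / norm z" by (intro divide_right_mono norm_sin_le) auto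
    finally have "norm (csinc z) * (1 + norm z) \<le> exp \<bar>Im z\<bar> / norm z * (1 + norm z)" by (intro mult_right_mono) auto
    also have "\<dots> = exp \<bar>Im z\<bar> * ((1 + norm z) / norm z)" by simp
    also have "\<dots> \<le> exp \<bar>Im z\<bar> * (2 * B + 2)" using False B by (intro mult_left_mono) (auto simp: divide_le_eq distrib_right add_increasing)
    finally show ?thesis by (subst pos_le_divide_eq) (auto intro: add_pos_nonneg simp: mult.commute)
  qed
  then show ?thesis using B(1) by (intro exI[of _ "2 * B + 2"]) auto
qed

lemma integrable_inverse_square: "integrable lborel (\<lambda>t::real. 1 / (1 + \<bar>t\<bar>)^2)"
  using nn_integral_inverse_square by (intro integrableI_nonneg) auto

text \<open>A high power of \<open>sin z / z\<close>, rescaled to have exponential type 1. The exponent is even, so the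
  function is nonnegative on the real line and can be normalised.\<close>
lemma exists_band_limited_kernel:
  fixes m :: nat assumes m: "m \<ge> 2"
  shows "\<exists>V K. K > 0 \<and> V holomorphic_on UNIV \<and> (\<forall>z. norm (V z) \<le> K * exp \<bar>Im z\<bar> / (1 + norm z) ^ m) \<and>
    integrable lborel (\<lambda>t::real. V (complex_of_real t)) \<and> (LINT t|lborel. V (complex_of_real t)) = 1"
proof -
  define n where "n = 2 * m"
  have n: "real n \<ge> 1" "n > 0" "n \<ge> m" using m by (auto simp: n_def)
  define S where "S z = csinc (z / of_nat n) ^ n" for z
  obtain C where C: "C > 0" "\<And>z. norm (csinc z) \<le> C * exp \<bar>Im z\<bar> / (1 + norm z)" using csinc_bound by blast
  have S_hol: "S holomorphic_on UNIV"
  proof -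
    have "(csinc \<circ> (\<lambda>z. z / of_nat n)) holomorphic_on UNIV"
      by (rule holomorphic_on_compose_gen[OF _ csinc_holomorphic]) (use n in \<open>auto intro!: holomorphic_intros\<close>)
    then show ?thesis unfolding S_def[abs_def] o_def by (intro holomorphic_intros)
  qed
  define K where "K = (C * real n) ^ n"
  have K: "K > 0" using C n by (simp add: K_def)
  have S_bound: "norm (S z) \<le> K * exp \<bar>Im z\<bar> / (1 + norm z) ^ m" for z
  proof -
    have pos: "1 + norm z > 0" by (simp add: add_pos_nonneg)
    have "norm (csinc (z / of_nat n)) \<le> C * exp (\<bar>Im z\<bar> / n) / (1 + norm z / n)"
      using C(2)[of "z / of_nat n"] by (simp add: norm_divide)
    also have "\<dots> \<le> C * exp (\<bar>Im z\<bar> / n) / ((1 + norm z) / n)"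
      using n C pos by (intro divide_left_mono mult_pos_pos mult_nonneg_nonneg)
        (auto simp: add_divide_distrib add_pos_nonneg)
    finally have "norm (S z) \<le> (C * exp (\<bar>Im z\<bar> / n) / ((1 + norm z) / n)) ^ n"
      unfolding S_def norm_power by (intro power_mono) auto
    also have "\<dots> = K * exp (\<bar>Im z\<bar> / n) ^ n / (1 + norm z) ^ n"
      by (simp add: K_def power_mult_distrib power_divide)
    also have "exp (\<bar>Im z\<bar> / n) ^ n = exp \<bar>Im z\<bar>" using n by (simp flip: exp_of_nat_mult)
    also have "K * exp \<bar>Im z\<bar> / (1 + norm z) ^ n \<le> K * exp \<bar>Im z\<bar> / (1 + norm z) ^ m"
      using K n pos by (intro divide_left_mono mult_pos_pos zero_less_power power_increasing) auto
    finally show ?thesis .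
  qed
  have S_cont: "continuous_on UNIV (\<lambda>t::real. S (complex_of_real t))"
    by (rule continuous_on_compose2[OF holomorphic_on_imp_continuous_on[OF S_hol]]) (auto intro: continuous_intros)
  have S_int: "integrable lborel (\<lambda>t::real. S (complex_of_real t))"
  proof (rule Bochner_Integration.integrable_bound[OF integrable_mult_right[OF integrable_inverse_square, of K]])
    show "AE t in lborel. norm (S (complex_of_real t)) \<le> norm (K * (1 / (1 + \<bar>t\<bar>)^2))"
    proof (rule AE_I2)
      fix t :: real
      have "norm (S (complex_of_real t)) \<le> K / (1 + \<bar>t\<bar>) ^ m" using S_bound[of "complex_of_real t"] by simp
      also have "\<dots> \<le> K / (1 + \<bar>t\<bar>)^2"
        using K m by (intro divide_left_mono mult_pos_pos zero_less_power power_increasing) auto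
      finally show "norm (S (complex_of_real t)) \<le> norm (K * (1 / (1 + \<bar>t\<bar>)^2))" using K by simp
    qed
    show "(\<lambda>t. S (complex_of_real t)) \<in> borel_measurable lborel"
      using borel_measurable_continuous_onI[OF S_cont] by simp
  qed
  have S_real: "S (complex_of_real t) = complex_of_real (Re (S (complex_of_real t)))" "Re (S (complex_of_real t)) \<ge> 0" for t
  proof -
    define v where "v = (if t = 0 then 1 else sin (t / n) / (t / n))"
    have "csinc (complex_of_real t / of_nat n) = complex_of_real v"
      using n by (auto simp: csinc_def v_def sin_of_real[symmetric])
    then have "S (complex_of_real t) = complex_of_real (v ^ n)" by (simp add: S_def)
    moreover have "v ^ n \<ge> 0" by (simp add: n_def)
    ultimately show "S (complex_of_real t) = complex_of_real (Re (S (complex_of_real t)))" "Re (S (complex_of_real t)) \<ge> 0" by simp_all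
  qed
  \<comment> \<open>The normalising constant is nonzero, as it is the integral of a continuous nonnegative function with value 1 at 0.\<close>
  define c where "c = (LINT t|lborel. S (complex_of_real t))"
  have "c \<noteq> 0"
  proof
    assume "c = 0"
    have "complex_of_real (LINT t|lborel. Re (S (complex_of_real t))) = c"
      unfolding c_def integral_complex_of_real[symmetric] S_real(1)[symmetric] ..
    then have "(LINT t|lborel. Re (S (complex_of_real t))) = 0" using \<open>c = 0\<close> by simp
    then have "AE t in lborel. Re (S (complex_of_real t)) = 0"
      by (subst (asm) integral_nonneg_eq_0_iff_AE) (use S_int S_real(2) in auto)
    then have ae: "AE t in lborel. t \<in> {t. Re (S (complex_of_real t)) = 0}" by simp
    have cl: "closed {t. Re (S (complex_of_real t)) = 0}"
      by (intro closed_Collect_eq continuous_intros S_cont)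
    have "0 \<in> {t. Re (S (complex_of_real t)) = 0}"
      by (rule mem_closed_if_AE_lebesgue[OF cl AE_completion[OF ae]])
    then have "Re (S (complex_of_real 0)) = 0" by simp
    then show False by (simp add: S_def csinc_def)
  qed
  show ?thesis
  proof (intro exI[of _ "\<lambda>z. S z / c"] exI[of _ "K / norm c"] conjI allI)
    show "norm (S z / c) \<le> K / norm c * exp \<bar>Im z\<bar> / (1 + norm z) ^ m" for z
      using divide_right_mono[OF S_bound[of z], of "norm c"] by (simp add: norm_divide mult_ac)
  qed (use K \<open>c \<noteq> 0\<close> S_hol S_int in \<open>auto intro!: holomorphic_intros simp: c_def[symmetric]\<close>)
qed

section \<open>Smoothing by entire functions of exponential type\<close>

text \<open>Convolution of a function \<open>u\<close> of at most linear growth with the kernel \<open>V\<close> rescaled to width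
  \<open>1/\<sigma>\<close>. The convolution integral makes sense at complex points and inherits type \<open>\<sigma>\<close> from the
  kernel, although \<open>u\<close> is only defined on the real line.\<close>
locale smoothing =
  fixes V :: "complex \<Rightarrow> complex" and K :: real and m :: nat and \<sigma> :: real
    and u :: "real \<Rightarrow> complex" and M :: real
  assumes K: "K > 0" and V_hol: "V holomorphic_on UNIV"
    and V_bound: "\<And>z. norm (V z) \<le> K * exp \<bar>Im z\<bar> / (1 + norm z) ^ m"
    and V_int: "integrable lborel (\<lambda>t::real. V (complex_of_real t))"
    and V_one: "(LINT t|lborel. V (complex_of_real t)) = 1"
    and m: "m \<ge> 3" and \<sigma>: "\<sigma> > 0"
    and u_cont: "continuous_on UNIV u" and M: "M \<ge> 0" and u_growth: "\<And>t. norm (u t) \<le> M * (1 + \<bar>t\<bar>)"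
begin

definition integrand :: "complex \<Rightarrow> real \<Rightarrow> complex" where "integrand z t = of_real \<sigma> * V (of_real \<sigma> * (z - of_real t)) * u t"

definition smoothed :: "complex \<Rightarrow> complex" where "smoothed z = (LINT t|lborel. integrand z t)"

definition c :: real where "c = max 1 (1 / \<sigma>)"

definition growth :: "real \<Rightarrow> real" where "growth R = \<sigma> * K * M * c ^ 3 * (1 + R) ^ 3 * exp (\<sigma> * R)"

lemma V_cont: "continuous_on UNIV V" using V_hol by (rule holomorphic_on_imp_continuous_on)

lemma integrand_continuous: "continuous_on UNIV (\<lambda>t. integrand z t)"
  unfolding integrand_def by (intro continuous_intros continuous_on_compose2[OF V_cont] u_cont) auto

lemma integrand_measurable: "(\<lambda>t. integrand z t) \<in> borel_measurable borel"
  using integrand_continuous by (rule borel_measurable_continuous_onI)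

text \<open>Three of the powers of decay pay for \<open>\<bar>t\<bar> \<le> \<bar>z\<bar> + \<bar>z - t\<bar>\<close>: one cancels the growth of \<open>u\<close> and two leave
  an integrable majorant that is uniform for \<open>z\<close> in a disc.\<close>
lemma integrand_bound:
  assumes R: "norm z \<le> R"
  shows "norm (integrand z t) \<le> growth R * (1 / (1 + \<bar>t\<bar>) ^ 2)"
proof -
  have R0: "R \<ge> 0" using R norm_ge_zero[of z] by linarith
  define d where "d = norm (z - of_real t)"
  have d0: "d \<ge> 0" by (simp add: d_def)
  have c1: "c \<ge> 1" "c * \<sigma> \<ge> 1" using \<sigma> by (auto simp: c_def max_def field_simps)
  have "\<bar>t\<bar> = norm (complex_of_real t)" by simp
  also have "\<dots> = norm (z - (z - complex_of_real t))" by simp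
  also have "\<dots> \<le> norm z + d" unfolding d_def by (rule norm_triangle_ineq4)
  finally have t: "\<bar>t\<bar> \<le> R + d" using R by simp
  then have "1 + \<bar>t\<bar> \<le> (1 + R) * (1 + d)" using mult_nonneg_nonneg[OF R0 d0] by (simp add: algebra_simps)
  also have "1 + d \<le> c * (1 + \<sigma> * d)"
    using c1 d0 mult_right_mono[OF c1(2) d0] by (simp add: algebra_simps)
  finally have tb: "1 + \<bar>t\<bar> \<le> (1 + R) * (c * (1 + \<sigma> * d))" using R0 by (simp add: mult_left_mono)
  have sd: "1 + \<sigma> * d \<ge> 1" using \<sigma> d0 by simp
  have "norm (V (of_real \<sigma> * (z - of_real t))) \<le> K * exp \<bar>\<sigma> * Im z\<bar> / (1 + \<sigma> * d) ^ m"
    using V_bound[of "of_real \<sigma> * (z - of_real t)"] \<sigma> by (simp add: norm_mult d_def)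
  also have "\<dots> \<le> K * exp \<bar>\<sigma> * Im z\<bar> / (1 + \<sigma> * d) ^ 3"
    using K m sd by (intro divide_left_mono mult_pos_pos zero_less_power power_increasing) auto
  also have "\<dots> \<le> K * exp (\<sigma> * R) / (1 + \<sigma> * d) ^ 3"
    using K sd \<sigma> abs_Im_le_cmod[of z] R
    by (intro divide_right_mono mult_left_mono) (auto simp: abs_mult)
  also have "\<dots> \<le> K * exp (\<sigma> * R) * (c ^ 3 * (1 + R) ^ 3 / (1 + \<bar>t\<bar>) ^ 3)"
  proof -
    have "(1 + \<bar>t\<bar>) ^ 3 \<le> ((1 + R) * (c * (1 + \<sigma> * d))) ^ 3" by (rule power_mono[OF tb]) simp
    then have "(1 + \<bar>t\<bar>) ^ 3 \<le> c ^ 3 * (1 + R) ^ 3 * (1 + \<sigma> * d) ^ 3" by (simp add: power_mult_distrib mult_ac)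
    then have "1 / (1 + \<sigma> * d) ^ 3 \<le> c ^ 3 * (1 + R) ^ 3 / (1 + \<bar>t\<bar>) ^ 3"
      using sd by (simp add: field_simps)
    then have "K * exp (\<sigma> * R) * (1 / (1 + \<sigma> * d) ^ 3) \<le> K * exp (\<sigma> * R) * (c ^ 3 * (1 + R) ^ 3 / (1 + \<bar>t\<bar>) ^ 3)"
      using K by (intro mult_left_mono) auto
    then show ?thesis by simp
  qed
  finally have Vb: "norm (V (of_real \<sigma> * (z - of_real t))) \<le> K * exp (\<sigma> * R) * (c ^ 3 * (1 + R) ^ 3 / (1 + \<bar>t\<bar>) ^ 3)" .
  have "norm (integrand z t) = \<sigma> * norm (V (of_real \<sigma> * (z - of_real t))) * norm (u t)"
    using \<sigma> by (simp add: integrand_def norm_mult)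
  also have "\<dots> \<le> \<sigma> * (K * exp (\<sigma> * R) * (c ^ 3 * (1 + R) ^ 3 / (1 + \<bar>t\<bar>) ^ 3)) * (M * (1 + \<bar>t\<bar>))"
    using \<sigma> K c1 R0 by (intro mult_mono Vb u_growth mult_nonneg_nonneg) auto
  also have "\<dots> = growth R * (1 / (1 + \<bar>t\<bar>) ^ 2)"
    by (simp add: growth_def power2_eq_square power3_eq_cube)
  finally show ?thesis .
qed

lemma integrand_integrable: "integrable lborel (integrand z)"
proof (rule Bochner_Integration.integrable_bound[OF integrable_mult_right[OF integrable_inverse_square, of "growth (norm z)"]])
  show "AE t in lborel. norm (integrand z t) \<le> norm (growth (norm z) * (1 / (1 + \<bar>t\<bar>)^2))"
  proof (rule AE_I2)
    fix t
    have "norm (integrand z t) \<le> growth (norm z) * (1 / (1 + \<bar>t\<bar>)^2)" by (rule integrand_bound) simp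
    also have "\<dots> \<le> norm (growth (norm z) * (1 / (1 + \<bar>t\<bar>)^2))" by (simp only: real_norm_def abs_ge_self)
    finally show "norm (integrand z t) \<le> norm (growth (norm z) * (1 / (1 + \<bar>t\<bar>)^2))" .
  qed
qed (use integrand_measurable in simp)

lemma smoothed_bound: "norm (smoothed z) \<le> growth (norm z) * (LINT t|lborel. 1 / (1 + \<bar>t\<bar>)^2)"
proof -
  have "norm (smoothed z) \<le> (LINT t|lborel. norm (integrand z t))" unfolding smoothed_def by (rule integral_norm_bound)
  also have "\<dots> \<le> (LINT t|lborel. growth (norm z) * (1 / (1 + \<bar>t\<bar>)^2))"
    by (intro integral_mono integrable_norm integrand_integrable integrable_mult_right integrable_inverse_square integrand_bound) auto
  finally show ?thesis by (simp only: integral_mult_right_zero)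
qed

definition truncated :: "nat \<Rightarrow> complex \<Rightarrow> complex" where "truncated n z = integral (cbox (- real n) (real n)) (integrand z)"

lemma truncated_holomorphic: "truncated n holomorphic_on UNIV"
  unfolding truncated_def[abs_def]
proof (rule leibniz_rule_holomorphic)
  have dV: "(V has_field_derivative deriv V z) (at z)" for z
    using V_hol by (meson UNIV_I holomorphic_derivI open_UNIV)
  show "((\<lambda>z. integrand z t) has_field_derivative of_real \<sigma> * (deriv V (of_real \<sigma> * (z - of_real t)) * of_real \<sigma>) * u t) (at z within UNIV)" for z t
    unfolding integrand_def
    by (rule derivative_eq_intros DERIV_chain2[OF dV] refl | simp)+
  show "integrand z integrable_on cbox (- real n) (real n)" for z
    by (intro integrable_continuous continuous_on_subset[OF integrand_continuous]) auto
  have cd: "continuous_on UNIV (deriv V)"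
    using V_hol holomorphic_deriv holomorphic_on_imp_continuous_on open_UNIV by blast
  show "continuous_on (UNIV \<times> cbox (- real n) (real n)) (\<lambda>(z, t). of_real \<sigma> * (deriv V (of_real \<sigma> * (z - of_real t)) * of_real \<sigma>) * u t)"
    unfolding case_prod_beta
    by (intro continuous_intros continuous_on_compose2[OF cd] continuous_on_compose2[OF u_cont]) auto
qed simp

definition tail_integral :: "nat \<Rightarrow> real" where
  "tail_integral n = (LINT t|lborel. indicator (- {- real n..real n}) t *\<^sub>R (1 / (1 + \<bar>t\<bar>)^2))"

lemma tail_integral_tendsto: "tail_integral \<longlonglongrightarrow> 0"
proof -
  have "(\<lambda>n. LINT t|lborel. indicator (- {- real n..real n}) t *\<^sub>R (1 / (1 + \<bar>t\<bar>)^2)) \<longlonglongrightarrow> integral\<^sup>L lborel (\<lambda>t::real. 0::real)"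
  proof (rule integral_dominated_convergence[where w = "\<lambda>t. 1 / (1 + \<bar>t\<bar>)^2"])
    show "AE t in lborel. (\<lambda>n. indicator (- {- real n..real n}) t *\<^sub>R (1 / (1 + \<bar>t\<bar>)^2)) \<longlonglongrightarrow> (0::real)"
    proof (rule AE_I2)
      fix t :: real
      obtain n0 where n0: "\<bar>t\<bar> \<le> real n0" using real_arch_simple by blast
      show "(\<lambda>n. indicator (- {- real n..real n}) t *\<^sub>R (1 / (1 + \<bar>t\<bar>)^2)) \<longlonglongrightarrow> (0::real)"
      proof (rule tendsto_eventually, rule eventually_sequentiallyI)
        fix n assume "n0 \<le> n"
        then have "\<bar>t\<bar> \<le> real n" using n0 by linarith
        then show "indicator (- {- real n..real n}) t *\<^sub>R (1 / (1 + \<bar>t\<bar>)^2) = (0::real)"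
          by (auto simp: indicator_def)
      qed
    qed
    show "AE t in lborel. norm (indicator (- {- real n..real n}) t *\<^sub>R (1 / (1 + \<bar>t\<bar>)^2)) \<le> 1 / (1 + \<bar>t\<bar>)^2" for n
      by (auto simp: indicator_def)
  qed (auto simp: integrable_inverse_square)
  then show ?thesis by (simp add: tail_integral_def[abs_def])
qed

lemma truncated_error:
  assumes R: "norm z \<le> R"
  shows "norm (truncated n z - smoothed z) \<le> growth R * tail_integral n"
proof -
  have si: "set_integrable lborel {- real n..real n} (integrand z)"
    using integrand_integrable[of z] unfolding set_integrable_def by (intro integrable_mult_indicator) auto
  have "truncated n z = (LINT t|lborel. indicator {- real n..real n} t *\<^sub>R integrand z t)"
    using set_borel_integral_eq_integral(2)[OF si] by (simp add: truncated_def set_lebesgue_integral_def)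
  then have "smoothed z - truncated n z = (LINT t|lborel. integrand z t - indicator {- real n..real n} t *\<^sub>R integrand z t)"
    unfolding smoothed_def using si integrand_integrable[of z] by (simp add: set_integrable_def Bochner_Integration.integral_diff)
  also have "\<dots> = (LINT t|lborel. indicator (- {- real n..real n}) t *\<^sub>R integrand z t)"
    by (intro Bochner_Integration.integral_cong) (auto simp: indicator_def)
  finally have eq: "smoothed z - truncated n z = (LINT t|lborel. indicator (- {- real n..real n}) t *\<^sub>R integrand z t)" .
  have "norm (smoothed z - truncated n z) \<le> (LINT t|lborel. norm (indicator (- {- real n..real n}) t *\<^sub>R integrand z t))"
    unfolding eq by (rule integral_norm_bound)
  also have "\<dots> \<le> (LINT t|lborel. growth R * (indicator (- {- real n..real n}) t *\<^sub>R (1 / (1 + \<bar>t\<bar>)^2)))"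
  proof (rule integral_mono)
    show "integrable lborel (\<lambda>t. norm (indicator (- {- real n..real n}) t *\<^sub>R integrand z t))"
      by (intro integrable_norm integrable_mult_indicator integrand_integrable) auto
    show "integrable lborel (\<lambda>t. growth R * (indicator (- {- real n..real n}) t *\<^sub>R (1 / (1 + \<bar>t\<bar>)^2)))"
      by (intro integrable_mult_right integrable_mult_indicator integrable_inverse_square) auto
    show "norm (indicator (- {- real n..real n}) t *\<^sub>R integrand z t) \<le> growth R * (indicator (- {- real n..real n}) t *\<^sub>R (1 / (1 + \<bar>t\<bar>)^2))" for t
      using integrand_bound[OF R, of t] by (auto simp: indicator_def)
  qed
  also have "\<dots> = growth R * tail_integral n" by (simp only: tail_integral_def integral_mult_right_zero)
  finally show ?thesis by (simp add: norm_minus_commute)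
qed

text \<open>The truncated integrals are holomorphic by differentiation under the integral sign and converge
  locally uniformly.\<close>
lemma smoothed_holomorphic: "smoothed holomorphic_on UNIV"
proof (rule holomorphic_uniform_sequence[of UNIV truncated])
  fix z :: complex
  have "uniform_limit (cball z 1) truncated smoothed sequentially"
  proof (rule uniform_limitI)
    fix e :: real assume e: "e > 0"
    define R where "R = norm z + 1"
    have R: "norm y \<le> R" if "y \<in> cball z 1" for y
      using that norm_triangle_ineq4[of z "z - y"] by (simp add: R_def dist_norm)
    have "(\<lambda>n. growth R * tail_integral n) \<longlonglongrightarrow> growth R * 0" by (intro tendsto_intros tail_integral_tendsto)
    then have "\<forall>\<^sub>F n in sequentially. growth R * tail_integral n < e" using e by (intro order_tendstoD) auto
    then show "\<forall>\<^sub>F n in sequentially. \<forall>y\<in>cball z 1. dist (truncated n y) (smoothed y) < e"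
    proof eventually_elim
      case (elim n)
      show ?case
        unfolding dist_norm using le_less_trans[OF truncated_error[OF R] elim] by blast
    qed
  qed
  then show "\<exists>d>0. cball z d \<subseteq> UNIV \<and> uniform_limit (cball z d) truncated smoothed sequentially"
    by (intro exI[of _ 1]) auto
qed (auto simp: truncated_holomorphic)

lemma smoothed_exp_type: "exp_type_le \<sigma> smoothed"
  unfolding exp_type_le_def
proof (intro allI impI)
  fix e :: real assume e: "e > 0"
  define I where "I = (LINT t|lborel. 1 / (1 + \<bar>t::real\<bar>)^2)"
  have I: "I \<ge> 0" unfolding I_def by (intro integral_nonneg_AE) auto
  define B where "B = \<sigma> * K * M * c ^ 3"
  have B: "B \<ge> 0" unfolding B_def using \<sigma> K M by (auto simp: c_def)
  define L where "L = max 1 (3 / e)"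
  have L: "L \<ge> 1" "L * e \<ge> 3" using e by (auto simp: L_def max_def field_simps)
  have "norm (smoothed z) \<le> B * I * L ^ 3 * exp ((\<sigma> + e) * norm z)" for z
  proof -
    have "1 + norm z \<le> L * (1 + e / 3 * norm z)"
      using L mult_right_mono[OF L(2), of "norm z"] by (simp add: algebra_simps)
    also have "\<dots> \<le> L * exp (e / 3 * norm z)" using L exp_ge_add_one_self[of "e/3 * norm z"] by (intro mult_left_mono) auto
    finally have "(1 + norm z) ^ 3 \<le> (L * exp (e / 3 * norm z)) ^ 3" by (intro power_mono) auto
    also have "\<dots> = L ^ 3 * exp (e * norm z)" by (simp add: power_mult_distrib flip: exp_of_nat_mult)
    finally have p3: "(1 + norm z) ^ 3 \<le> L ^ 3 * exp (e * norm z)" .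
    have "norm (smoothed z) \<le> B * (1 + norm z) ^ 3 * exp (\<sigma> * norm z) * I"
      using smoothed_bound[of z] by (simp add: growth_def B_def I_def)
    also have "\<dots> \<le> B * (L ^ 3 * exp (e * norm z)) * exp (\<sigma> * norm z) * I"
      by (intro mult_right_mono mult_left_mono p3 B I) auto
    also have "\<dots> = B * I * L ^ 3 * exp ((\<sigma> + e) * norm z)" by (simp add: distrib_right exp_add)
    finally show ?thesis .
  qed
  then show "\<exists>A. \<forall>z. norm (smoothed z) \<le> A * exp ((\<sigma> + e) * norm z)" by blast
qed

text \<open>The kernel has integral 1, so the error is an average of increments of \<open>u\<close>.\<close>
lemma smoothed_error:
  "ennreal (norm (u x - smoothed (of_real x))) \<le>
    (\<integral>\<^sup>+t. ennreal (\<sigma> * norm (V (of_real (\<sigma> * (x - t)))) * norm (u x - u t)) \<partial>lborel)"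
proof -
  let ?k = "\<lambda>t. of_real \<sigma> * V (of_real (\<sigma> * (x - t)))"
  have aff: "\<sigma> * (x - t) = \<sigma> * x + (- \<sigma>) * t" for t by (simp add: algebra_simps)
  have ik: "integrable lborel (\<lambda>t. V (of_real (\<sigma> * (x - t))))"
    unfolding aff using lborel_integrable_real_affine[OF V_int, of "- \<sigma>" "\<sigma> * x"] \<sigma> by simp
  have one: "(LINT t|lborel. ?k t) = 1"
  proof -
    have "1 = (LINT t|lborel. V (complex_of_real t))" by (rule V_one[symmetric])
    also have "\<dots> = \<bar>- \<sigma>\<bar> *\<^sub>R (LINT t|lborel. V (complex_of_real (\<sigma> * x + (- \<sigma>) * t)))"
      by (rule lborel_integral_real_affine) (use \<sigma> in simp)
    also have "\<dots> = (LINT t|lborel. ?k t)" unfolding aff using \<sigma> by (simp add: scaleR_conv_of_real)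
    finally show ?thesis by simp
  qed
  have fx: "integrand (of_real x) t = ?k t * u t" for t by (simp add: integrand_def)
  have ifx: "integrable lborel (\<lambda>t. ?k t * u t)" using integrand_integrable[of "of_real x"] unfolding fx[abs_def, symmetric] by simp
  have iku: "integrable lborel (\<lambda>t. ?k t * u x)" using ik by (intro integrable_mult_left integrable_mult_right)
  have "u x - smoothed (of_real x) = (LINT t|lborel. ?k t) * u x - (LINT t|lborel. ?k t * u t)"
    unfolding one smoothed_def fx by simp
  also have "\<dots> = (LINT t|lborel. ?k t * u x - ?k t * u t)"
    using ik by (subst Bochner_Integration.integral_diff[OF iku ifx]) simp
  also have "\<dots> = (LINT t|lborel. ?k t * (u x - u t))" by (simp add: right_diff_distrib)
  finally have eq: "u x - smoothed (of_real x) = (LINT t|lborel. ?k t * (u x - u t))" .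
  have "ennreal (norm (LINT t|lborel. ?k t * (u x - u t))) \<le> (\<integral>\<^sup>+t. norm (?k t * (u x - u t)) \<partial>lborel)"
    using Bochner_Integration.integrable_diff[OF iku ifx]
    by (intro integral_norm_bound_ennreal) (simp add: right_diff_distrib)
  also have "\<dots> = (\<integral>\<^sup>+t. ennreal (\<sigma> * norm (V (of_real (\<sigma> * (x - t)))) * norm (u x - u t)) \<partial>lborel)"
    using \<sigma> by (simp add: norm_mult)
  finally show ?thesis unfolding eq .
qed

end

section \<open>Approximation of a function by means of its derivative\<close>

lemma Lp_has_integral_norm_bound:
  fixes h :: "real \<Rightarrow> complex"
  assumes h: "h \<in> borel_measurable lebesgue" and fin: "(\<integral>\<^sup>+y. ennreal (norm (h y)) * indicator {a..b} y \<partial>lebesgue) < \<infinity>"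
    and I: "(h has_integral i) {a..b}"
  shows "ennreal (norm i) \<le> (\<integral>\<^sup>+y. ennreal (norm (h y)) * indicator {a..b} y \<partial>lebesgue)"
proof -
  have eq: "(\<integral>\<^sup>+y. ennreal (norm (indicator {a..b} y *\<^sub>R h y)) \<partial>lebesgue) = (\<integral>\<^sup>+y. ennreal (norm (h y)) * indicator {a..b} y \<partial>lebesgue)"
    by (intro nn_integral_cong) (auto simp: indicator_def)
  have si: "set_integrable lebesgue {a..b} h"
    unfolding set_integrable_def integrable_iff_bounded using h fin eq
    by (auto intro!: borel_measurable_scaleR borel_measurable_indicator)
  have "i = integral {a..b} h" using I by (simp add: integral_unique)
  also have "\<dots> = (LINT y|lebesgue. indicator {a..b} y *\<^sub>R h y)"
    using set_lebesgue_integral_eq_integral(2)[OF si] by (simp add: set_lebesgue_integral_def)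
  finally have i: "i = (LINT y|lebesgue. indicator {a..b} y *\<^sub>R h y)" .
  have "ennreal (norm i) \<le> (\<integral>\<^sup>+y. norm (indicator {a..b} y *\<^sub>R h y) \<partial>lebesgue)"
    unfolding i using si by (intro integral_norm_bound_ennreal) (simp add: set_integrable_def)
  then show ?thesis using eq by simp
qed

text \<open>On the disc of radius \<open>\<bar>z\<bar>\<close> the derivative is bounded by its growth estimate; the extra factor
  \<open>\<bar>z\<bar>\<close> costs an arbitrarily small increase of the exponent.\<close>
lemma exp_type_primitive:
  assumes hol: "Q holomorphic_on UNIV" and ty: "exp_type_le \<sigma> Q" and \<sigma>: "\<sigma> > 0"
  obtains P where "P holomorphic_on UNIV" "exp_type_le \<sigma> P" "\<And>z. (P has_field_derivative Q z) (at z)"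
proof -
  obtain P where P: "\<And>z. (P has_field_derivative Q z) (at z)"
    using holomorphic_convex_primitive'[OF convex_UNIV open_UNIV hol] by auto
  have P_hol: "P holomorphic_on UNIV" using P by (auto simp: holomorphic_on_def field_differentiable_def)
  have "exp_type_le \<sigma> P"
    unfolding exp_type_le_def
  proof (intro allI impI)
    fix e :: real assume e: "e > 0"
    obtain A0 where A0: "\<And>z. norm (Q z) \<le> A0 * exp ((\<sigma> + e/2) * norm z)"
      using ty e unfolding exp_type_le_def by (metis half_gt_zero)
    have A0_nonneg: "A0 \<ge> 0" using order_trans[OF norm_ge_zero A0[of 0]] by simp
    have "norm (P z) \<le> (norm (P 0) + A0 * (2 / e)) * exp ((\<sigma> + e) * norm z)" for z
    proof -
      have "norm (P z - P 0) \<le> A0 * exp ((\<sigma> + e/2) * norm z) * norm (z - 0)"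
      proof (rule field_differentiable_bound[of "cball 0 (norm z)"])
        show "(P has_field_derivative Q y) (at y within cball 0 (norm z))" for y
          using P by (rule has_field_derivative_at_within)
        show "norm (Q y) \<le> A0 * exp ((\<sigma> + e/2) * norm z)" if "y \<in> cball 0 (norm z)" for y
        proof -
          have "A0 * exp ((\<sigma> + e/2) * norm y) \<le> A0 * exp ((\<sigma> + e/2) * norm z)"
            using that \<sigma> e A0_nonneg by (intro mult_left_mono) auto
          then show ?thesis using A0[of y] by simp
        qed
      qed auto
      moreover have "norm z \<le> 2 / e * exp (e/2 * norm z)"
      proof -
        have "e/2 * norm z \<le> exp (e/2 * norm z)" using exp_ge_add_one_self[of "e/2 * norm z"] by linarith
        then show ?thesis using e by (simp add: field_simps)
      qed
      ultimately have "norm (P z - P 0) \<le> A0 * exp ((\<sigma> + e/2) * norm z) * (2 / e * exp (e/2 * norm z))"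
        using A0_nonneg by (elim order_trans) (auto intro!: mult_left_mono mult_nonneg_nonneg simp del: times_divide_eq_left)
      also have "\<dots> = A0 * (2 / e) * exp ((\<sigma> + e) * norm z)"
      proof -
        have "exp ((\<sigma> + e) * norm z) = exp ((\<sigma> + e/2) * norm z) * exp (e/2 * norm z)"
          by (simp add: algebra_simps flip: exp_add)
        then show ?thesis by simp
      qed
      finally have "norm (P z - P 0) \<le> A0 * (2 / e) * exp ((\<sigma> + e) * norm z)" .
      moreover have "norm (P 0) * 1 \<le> norm (P 0) * exp ((\<sigma> + e) * norm z)"
        using \<sigma> e by (intro mult_left_mono) auto
      ultimately show ?thesis
        using norm_triangle_sub[of "P z" "P 0"] unfolding distrib_right by linarith
    qed
    then show "\<exists>A. \<forall>z. norm (P z) \<le> A * exp ((\<sigma> + e) * norm z)" by blast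
  qed
  then show ?thesis using P P_hol that by blast
qed

context log_hoelder
begin

text \<open>The theorem for one derivative, with \<open>0\<close> in place of the best approximation of the derivative \<open>h\<close>.
  The approximation is the smoothed function. Its
  error averages increments of \<open>u\<close>, and an increment over \<open>[t, x]\<close> is at most the integral of \<open>\<bar>h\<bar>\<close>
  there, which a factor \<open>(1 + \<sigma> \<bar>x - t\<bar>) ^ N / \<sigma>\<close> turns into a convolution of \<open>\<bar>h\<bar>\<close> at \<open>x\<close> with a
  kernel decaying like the \<open>N\<close>-th power. The factor is absorbed by the decay
  of \<open>V\<close>.\<close>
lemma approximation_of_primitive:
  "\<exists>C>0. \<forall>\<sigma>>0. \<forall>u h. h \<in> Lp p \<longrightarrow> continuous_on UNIV u \<longrightarrow>
     (\<forall>a b. a \<le> b \<longrightarrow> (h has_integral (u b - u a)) {a..b}) \<longrightarrow>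
     (\<exists>Q. Q holomorphic_on UNIV \<and> exp_type_le \<sigma> Q \<and> (\<lambda>x. u x - Q (complex_of_real x)) \<in> Lp p \<and>
       Lp_norm p (\<lambda>x. u x - Q (complex_of_real x)) \<le> C / \<sigma> * Lp_norm p h)"
proof -
  \<comment> \<open>The decay that the convolution bound asks for; the kernel needs two more powers to be integrable.\<close>
  define N where "N = nat \<lceil>2 * c1 + 2\<rceil>"
  have N: "real N \<ge> 2 * c1 + 2" unfolding N_def by linarith
  then have N2: "N \<ge> 2" using c1_pos by linarith
  obtain V K where K: "K > 0" and V: "V holomorphic_on UNIV"
    "\<And>z. norm (V z) \<le> K * exp \<bar>Im z\<bar> / (1 + norm z) ^ (N + 2)"
    "integrable lborel (\<lambda>t::real. V (complex_of_real t))" "(LINT t|lborel. V (complex_of_real t)) = 1"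
    using exists_band_limited_kernel[of "N + 2"] by auto
  have "\<exists>Q. Q holomorphic_on UNIV \<and> exp_type_le \<sigma> Q \<and> (\<lambda>x. u x - Q (complex_of_real x)) \<in> Lp p \<and>
       Lp_norm p (\<lambda>x. u x - Q (complex_of_real x)) \<le> (80 * conv_const * K) / \<sigma> * Lp_norm p h"
    if \<sigma>: "\<sigma> > 0" and h: "h \<in> Lp p" and uc: "continuous_on UNIV u"
      and ui: "\<And>a b. a \<le> b \<Longrightarrow> (h has_integral (u b - u a)) {a..b}" for \<sigma> and u h :: "real \<Rightarrow> complex"
  proof -
    have hm: "h \<in> borel_measurable lebesgue" using h by (simp add: Lp_def)
    obtain M where M: "M \<ge> 0" "\<And>a b. a \<le> b \<Longrightarrow>
        (\<integral>\<^sup>+y. ennreal (norm (h y)) * indicator {a..b} y \<partial>lebesgue) \<le> ennreal (M * (1 + (b - a)))"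
      using Lp_integral_linear_growth[OF h] by metis
    have ub: "ennreal (norm (u b - u a)) \<le> (\<integral>\<^sup>+y. ennreal (norm (h y)) * indicator {a..b} y \<partial>lebesgue)"
      if "a \<le> b" for a b
      by (rule Lp_has_integral_norm_bound[OF hm le_less_trans[OF M(2)[OF that]] ui[OF that]]) simp
    have ub2: "ennreal (norm (u x - u t)) \<le> (\<integral>\<^sup>+y. ennreal (norm (h y)) * indicator {min x t..max x t} y \<partial>lebesgue)" for x t
      using ub[of x t] ub[of t x] by (cases "x \<le> t") (auto simp: norm_minus_commute)
    have growth: "norm (u t) \<le> (norm (u 0) + M) * (1 + \<bar>t\<bar>)" for t
    proof -
      have "ennreal (norm (u t - u 0)) \<le> ennreal (M * (1 + (max t 0 - min t 0)))"
        by (rule order_trans[OF ub2 M(2)]) simp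
      moreover have "max t 0 - min t 0 = \<bar>t\<bar>" by simp
      ultimately have "norm (u t - u 0) \<le> M * (1 + \<bar>t\<bar>)" using M(1) by (simp add: ennreal_le_iff)
      moreover have "norm (u 0) * 1 \<le> norm (u 0) * (1 + \<bar>t\<bar>)" by (intro mult_left_mono) auto
      ultimately show ?thesis using norm_triangle_sub[of "u t" "u 0"] unfolding distrib_right by linarith
    qed
    interpret sm: smoothing V K "N + 2" \<sigma> u "norm (u 0) + M"
      by unfold_locales (use K V N2 \<sigma> uc growth M(1) in auto)
    define F where "F x = u x - sm.smoothed (complex_of_real x)" for x
    have "continuous_on UNIV F" unfolding F_def
      by (intro continuous_intros uc continuous_on_compose2[OF holomorphic_on_imp_continuous_on[OF sm.smoothed_holomorphic]]) auto
    then have Fm: "F \<in> borel_measurable lebesgue"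
      by (intro measurable_completion) (simp add: borel_measurable_continuous_onI)
    define T where "T x = (\<integral>\<^sup>+y. ennreal (\<sigma> / (1 + \<sigma> * \<bar>x - y\<bar>) ^ N) * ennreal (norm (h y)) \<partial>lebesgue)" for x
    have incr: "ennreal (norm (u x - u t)) \<le> ennreal ((1 + \<sigma> * \<bar>x - t\<bar>) ^ N / \<sigma>) * T x" for x t
    proof -
      have "ennreal (norm (u x - u t)) \<le> (\<integral>\<^sup>+y. ennreal (norm (h y)) * indicator {min x t..max x t} y \<partial>lebesgue)"
        by (rule ub2)
      also have "\<dots> \<le> (\<integral>\<^sup>+y. ennreal ((1 + \<sigma> * \<bar>x - t\<bar>) ^ N / \<sigma>) * (ennreal (\<sigma> / (1 + \<sigma> * \<bar>x - y\<bar>) ^ N) * ennreal (norm (h y))) \<partial>lebesgue)"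
      proof (rule nn_integral_mono)
        fix y
        show "ennreal (norm (h y)) * indicator {min x t..max x t} y \<le>
          ennreal ((1 + \<sigma> * \<bar>x - t\<bar>) ^ N / \<sigma>) * (ennreal (\<sigma> / (1 + \<sigma> * \<bar>x - y\<bar>) ^ N) * ennreal (norm (h y)))"
        proof (cases "y \<in> {min x t..max x t}")
          case True
          then have "\<sigma> * \<bar>x - y\<bar> \<le> \<sigma> * \<bar>x - t\<bar>" using \<sigma> by (intro mult_left_mono) (auto simp: abs_if split: if_splits)
          moreover have "\<sigma> * \<bar>x - y\<bar> \<ge> 0" using \<sigma> by simp
          ultimately have le: "(1 + \<sigma> * \<bar>x - y\<bar>) ^ N \<le> (1 + \<sigma> * \<bar>x - t\<bar>) ^ N" and pos: "(1 + \<sigma> * \<bar>x - y\<bar>) ^ N > 0"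
            by (auto intro!: power_mono zero_less_power)
          then have "1 \<le> (1 + \<sigma> * \<bar>x - t\<bar>) ^ N / \<sigma> * (\<sigma> / (1 + \<sigma> * \<bar>x - y\<bar>) ^ N)"
            using \<sigma> by (simp add: le_divide_eq)
          then have "norm (h y) * 1 \<le> norm (h y) * ((1 + \<sigma> * \<bar>x - t\<bar>) ^ N / \<sigma> * (\<sigma> / (1 + \<sigma> * \<bar>x - y\<bar>) ^ N))"
            by (intro mult_left_mono) auto
          then have "norm (h y) \<le> (1 + \<sigma> * \<bar>x - t\<bar>) ^ N / \<sigma> * (\<sigma> / (1 + \<sigma> * \<bar>x - y\<bar>) ^ N * norm (h y))"
            by (simp only: mult_1_right mult.commute mult.left_commute mult.assoc)
          then have "ennreal (norm (h y)) \<le> ennreal ((1 + \<sigma> * \<bar>x - t\<bar>) ^ N / \<sigma> * (\<sigma> / (1 + \<sigma> * \<bar>x - y\<bar>) ^ N * norm (h y)))"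
            by (rule ennreal_leI)
          also have "\<dots> = ennreal ((1 + \<sigma> * \<bar>x - t\<bar>) ^ N / \<sigma>) * (ennreal (\<sigma> / (1 + \<sigma> * \<bar>x - y\<bar>) ^ N) * ennreal (norm (h y)))"
            using \<sigma> pos by (subst ennreal_mult'', simp, subst ennreal_mult'', simp_all)
          finally show ?thesis using True by simp
        qed simp
      qed
      also have "\<dots> = ennreal ((1 + \<sigma> * \<bar>x - t\<bar>) ^ N / \<sigma>) * T x"
        unfolding T_def
      proof (rule nn_integral_cmult)
        have "(\<lambda>y. ennreal (\<sigma> / (1 + \<sigma> * \<bar>x - y\<bar>) ^ N)) \<in> borel_measurable lebesgue"
          by (intro measurable_completion) simp
        then show "(\<lambda>y. ennreal (\<sigma> / (1 + \<sigma> * \<bar>x - y\<bar>) ^ N) * ennreal (norm (h y))) \<in> borel_measurable lebesgue"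
          using hm by measurable
      qed
      finally show ?thesis .
    qed
    have dom: "ennreal (norm (F x)) \<le> ennreal (2 * K / \<sigma>) * T x" for x
    proof -
      have "ennreal (norm (F x)) \<le> (\<integral>\<^sup>+t. ennreal (\<sigma> * norm (V (of_real (\<sigma> * (x - t)))) * norm (u x - u t)) \<partial>lborel)"
        unfolding F_def by (rule sm.smoothed_error)
      also have "\<dots> \<le> (\<integral>\<^sup>+t. ennreal (K / \<sigma>) * ennreal (\<sigma> / (1 + \<sigma> * \<bar>x - t\<bar>) ^ 2) * T x \<partial>lborel)"
      proof (rule nn_integral_mono)
        fix t
        define b where "b = 1 + \<sigma> * \<bar>x - t\<bar>"
        have b: "b > 0" using \<sigma> by (simp add: b_def add_pos_nonneg)
        have "norm (V (of_real (\<sigma> * (x - t)))) \<le> K / b ^ (N + 2)"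
          using V(2)[of "of_real (\<sigma> * (x - t))"] \<sigma> by (simp add: b_def abs_mult flip: of_real_mult of_real_diff)
        then have "\<sigma> * norm (V (of_real (\<sigma> * (x - t)))) * (b ^ N / \<sigma>) \<le> \<sigma> * (K / b ^ (N + 2)) * (b ^ N / \<sigma>)"
          using \<sigma> b by (intro mult_right_mono mult_left_mono) auto
        also have "\<dots> = K / \<sigma> * (\<sigma> / b ^ 2)" using \<sigma> b by (simp add: power_add field_simps power2_eq_square)
        finally have le: "ennreal (\<sigma> * norm (V (of_real (\<sigma> * (x - t)))) * (b ^ N / \<sigma>)) \<le> ennreal (K / \<sigma> * (\<sigma> / b ^ 2))"
          by (rule ennreal_leI)
        have "ennreal (\<sigma> * norm (V (of_real (\<sigma> * (x - t)))) * norm (u x - u t)) =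
            ennreal (\<sigma> * norm (V (of_real (\<sigma> * (x - t))))) * ennreal (norm (u x - u t))"
          using \<sigma> by (simp add: ennreal_mult'')
        also have "\<dots> \<le> ennreal (\<sigma> * norm (V (of_real (\<sigma> * (x - t))))) * (ennreal (b ^ N / \<sigma>) * T x)"
          unfolding b_def by (intro mult_left_mono incr) simp
        also have "\<dots> = ennreal (\<sigma> * norm (V (of_real (\<sigma> * (x - t)))) * (b ^ N / \<sigma>)) * T x"
          using \<sigma> b by (subst ennreal_mult'') (auto simp: mult.assoc)
        also have "\<dots> \<le> ennreal (K / \<sigma> * (\<sigma> / b ^ 2)) * T x"
          by (intro mult_right_mono le) simp
        also have "\<dots> = ennreal (K / \<sigma>) * ennreal (\<sigma> / b ^ 2) * T x"
          using K \<sigma> b by (subst ennreal_mult'') auto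
        finally show "ennreal (\<sigma> * norm (V (of_real (\<sigma> * (x - t)))) * norm (u x - u t)) \<le>
          ennreal (K / \<sigma>) * ennreal (\<sigma> / (1 + \<sigma> * \<bar>x - t\<bar>) ^ 2) * T x" unfolding b_def .
      qed
      also have "\<dots> = ennreal (K / \<sigma>) * 2 * T x"
      proof -
        have "(\<integral>\<^sup>+t. ennreal (K / \<sigma>) * ennreal (\<sigma> / (1 + \<sigma> * \<bar>x - t\<bar>) ^ 2) * T x \<partial>lborel)
          = (\<integral>\<^sup>+t. ennreal (K / \<sigma>) * ennreal (\<sigma> / (1 + \<sigma> * \<bar>x - t\<bar>) ^ 2) \<partial>lborel) * T x"
          by (rule nn_integral_multc) simp
        also have "(\<integral>\<^sup>+t. ennreal (K / \<sigma>) * ennreal (\<sigma> / (1 + \<sigma> * \<bar>x - t\<bar>) ^ 2) \<partial>lborel)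
          = ennreal (K / \<sigma>) * (\<integral>\<^sup>+t. ennreal (\<sigma> / (1 + \<sigma> * \<bar>x - t\<bar>) ^ 2) \<partial>lborel)"
          by (rule nn_integral_cmult) simp
        finally show ?thesis unfolding nn_integral_scaled_inverse_square[OF \<sigma>] .
      qed
      also have "ennreal (K / \<sigma>) * 2 = ennreal (2 * K / \<sigma>)"
        using K \<sigma> by (simp add: ennreal_mult'[symmetric] mult.commute flip: ennreal_numeral)
      finally show ?thesis .
    qed
    have B: "2 * K / \<sigma> > 0" using K \<sigma> by simp
    note bound = kernel_domination_norm_bound[OF \<sigma> N h Fm B dom[unfolded T_def]]
    show ?thesis
    proof (intro exI[of _ sm.smoothed] conjI sm.smoothed_holomorphic sm.smoothed_exp_type)
      show "(\<lambda>x. u x - sm.smoothed (complex_of_real x)) \<in> Lp p" using bound(1) by (simp add: F_def[abs_def])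
      show "Lp_norm p (\<lambda>x. u x - sm.smoothed (complex_of_real x)) \<le> (80 * conv_const * K) / \<sigma> * Lp_norm p h"
        using bound(2) by (simp add: F_def[abs_def] mult_ac)
    qed
  qed
  moreover have "80 * conv_const * K > 0" using conv_const_pos K by simp
  ultimately show ?thesis by (intro exI[of _ "80 * conv_const * K"]) blast
qed

end

section \<open>The approximation theorem\<close>

lemma exp_type_add:
  assumes "exp_type_le \<sigma> P" "exp_type_le \<sigma> Q"
  shows "exp_type_le \<sigma> (\<lambda>z. P z + Q z)"
  unfolding exp_type_le_def
proof (intro allI impI)
  fix e :: real assume e: "e > 0"
  obtain A B where "\<And>z. norm (P z) \<le> A * exp ((\<sigma> + e) * norm z)" "\<And>z. norm (Q z) \<le> B * exp ((\<sigma> + e) * norm z)"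
    using assms e unfolding exp_type_le_def by metis
  then have "norm (P z + Q z) \<le> (A + B) * exp ((\<sigma> + e) * norm z)" for z
    unfolding distrib_right by (intro norm_triangle_le add_mono)
  then show "\<exists>A. \<forall>z. norm (P z + Q z) \<le> A * exp ((\<sigma> + e) * norm z)" by blast
qed

lemma nth_deriv_Suc: "nth_deriv (Suc n) f = (\<lambda>x. vector_derivative (nth_deriv n f) (at x))"
  by (simp add: nth_deriv_def)

lemma entire_has_vector_derivative:
  assumes "\<And>z. (P has_field_derivative Q z) (at z)"
  shows "((\<lambda>x. P (complex_of_real x)) has_vector_derivative Q (complex_of_real x)) (at x within S)"
  using has_vector_derivative_real_field[OF assms, of x S] by simp

text \<open>The values of \<open>vector_derivative F\<close> at points where \<open>F\<close> is not differentiable do not matter, as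
  these points form a null set.\<close>
lemma has_integral_deriv_diff_AC:
  fixes F :: "real \<Rightarrow> complex"
  assumes F: "AC_on a b F" and ab: "a \<le> b" and P: "\<And>z. (P has_field_derivative Q z) (at z)"
    and Q: "continuous_on UNIV Q"
  shows "((\<lambda>x. vector_derivative F (at x) - Q (complex_of_real x)) has_integral
    ((F b - P (complex_of_real b)) - (F a - P (complex_of_real a)))) {a..b}"
proof -
  define R where "R = max \<bar>a\<bar> \<bar>b\<bar>"
  have "compact (Q ` cball 0 R)" by (intro compact_continuous_image continuous_on_subset[OF Q]) auto
  then obtain B where B: "B > 0" "\<And>z. z \<in> cball 0 R \<Longrightarrow> norm (Q z) \<le> B"
    using compact_imp_bounded bounded_pos by (metis imageI)
  have AC: "AC_on a b (\<lambda>x. F x - P (complex_of_real x))"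
  proof (rule AC_on_of_increment_le[OF F])
    fix x y :: real assume xy: "a \<le> x" "x \<le> y" "y \<le> b"
    have "norm (P (complex_of_real y) - P (complex_of_real x)) \<le> B * norm (complex_of_real y - complex_of_real x)"
      by (rule field_differentiable_bound[of "cball 0 R" P Q])
        (use xy B in \<open>auto simp: R_def intro: has_field_derivative_at_within P\<close>)
    also have "norm (complex_of_real y - complex_of_real x) = y - x"
      using xy by (simp flip: of_real_diff)
    finally have "norm (P (complex_of_real y) - P (complex_of_real x)) \<le> B * (y - x)" .
    moreover have "F y - P (complex_of_real y) - (F x - P (complex_of_real x)) = (F y - F x) - (P (complex_of_real y) - P (complex_of_real x))"
      by simp
    ultimately show "norm (F y - P (complex_of_real y) - (F x - P (complex_of_real x))) \<le> norm (F y - F x) + B * (y - x)"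
      using norm_triangle_ineq4[of "F y - F x" "P (complex_of_real y) - P (complex_of_real x)"] by (simp only:)
  qed (use B in simp)
  show ?thesis
  proof (rule fundamental_theorem_of_calculus_AC[OF AC ab])
    show "negligible ({x\<in>{a<..<b}. \<not> F differentiable (at x)} \<union> {a, b})"
      by (intro negligible_Un AC_on_complex_differentiable_ae F) auto
    fix x assume "x \<in> {a..b} - ({x\<in>{a<..<b}. \<not> F differentiable (at x)} \<union> {a, b})"
    then have "F differentiable (at x)" by auto
    then have "(F has_vector_derivative vector_derivative F (at x)) (at x)"
      by (simp flip: vector_derivative_works)
    then have "(F has_vector_derivative vector_derivative F (at x)) (at x within {a..b})"
      by (rule has_vector_derivative_at_within)
    then show "((\<lambda>x. F x - P (complex_of_real x)) has_vector_derivative vector_derivative F (at x) - Q (complex_of_real x)) (at x within {a..b})"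
      by (intro has_vector_derivative_diff entire_has_vector_derivative P)
  qed
qed

lemma has_integral_deriv_diff_differentiable:
  fixes F :: "real \<Rightarrow> complex"
  assumes F: "\<And>x. F differentiable (at x)" and ab: "a \<le> b" and P: "\<And>z. (P has_field_derivative Q z) (at z)"
  shows "((\<lambda>x. vector_derivative F (at x) - Q (complex_of_real x)) has_integral
    ((F b - P (complex_of_real b)) - (F a - P (complex_of_real a)))) {a..b}"
proof (rule fundamental_theorem_of_calculus[OF ab])
  fix x
  have "(F has_vector_derivative vector_derivative F (at x)) (at x within {a..b})"
    by (rule has_vector_derivative_at_within) (simp add: F flip: vector_derivative_works)
  then show "((\<lambda>x. F x - P (complex_of_real x)) has_vector_derivative vector_derivative F (at x) - Q (complex_of_real x)) (at x within {a..b})"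
    by (intro has_vector_derivative_diff entire_has_vector_derivative P)
qed

theorem theorem5p2:
  fixes p :: "real \<Rightarrow> real" and r :: nat
  assumes "p \<in> log_exponents" and "r \<ge> 1"
  shows "\<exists>C>0. \<forall>\<sigma>>0. \<forall>f\<in>W r p.
    best_approx \<sigma> p f \<le> C / \<sigma> ^ r * best_approx \<sigma> p (nth_deriv r f)"
proof -
  obtain c1 c2 q where "log_hoelder p c1 c2 q" using log_exponents_imp_log_hoelder[OF assms(1)] .
  then interpret log_hoelder p c1 c2 q .
  obtain C where C: "C > 0" and step: "\<And>\<sigma> u h. \<sigma> > 0 \<Longrightarrow> h \<in> Lp p \<Longrightarrow> continuous_on UNIV u \<Longrightarrow>
     (\<And>a b. a \<le> b \<Longrightarrow> (h has_integral (u b - u a)) {a..b}) \<Longrightarrow>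
     \<exists>Q. Q holomorphic_on UNIV \<and> exp_type_le \<sigma> Q \<and> (\<lambda>x. u x - Q (complex_of_real x)) \<in> Lp p \<and>
       Lp_norm p (\<lambda>x. u x - Q (complex_of_real x)) \<le> C / \<sigma> * Lp_norm p h"
    using approximation_of_primitive by blast
  have "best_approx \<sigma> p f \<le> C ^ r / \<sigma> ^ r * best_approx \<sigma> p (nth_deriv r f)"
    if \<sigma>: "\<sigma> > 0" and f: "f \<in> W r p" for \<sigma> f
  proof -
    have fL: "f \<in> Lp p" and frL: "nth_deriv r f \<in> Lp p"
      and fd: "\<And>k x. k < r - 1 \<Longrightarrow> nth_deriv k f differentiable at x" and fac: "abs_cont (nth_deriv (r - 1) f)"
      using f by (auto simp: W_def)
    have AC: "AC_on a b (nth_deriv (r - 1) f)" if "a \<le> b" for a b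
      using fac that by (simp add: abs_cont_def abs_cont_on_imp_AC_on)
    have cont: "continuous_on UNIV (nth_deriv k f)" if k: "k < r" for k
    proof -
      have "isCont (nth_deriv k f) x" for x
      proof (cases "k < r - 1")
        case True
        then show ?thesis using fd differentiable_imp_continuous_within by blast
      next
        case False
        then have "k = r - 1" using k by simp
        then have "continuous_on {x - 1..x + 1} (nth_deriv k f)" using AC_on_imp_continuous[OF AC[of "x - 1" "x + 1"]] by simp
        then show ?thesis
          by (rule continuous_on_interior) auto
      qed
      then show ?thesis by (simp add: continuous_at_imp_continuous_on)
    qed
    have main: "best_approx \<sigma> p f \<le> C ^ r / \<sigma> ^ r * Lp_norm p (\<lambda>x. nth_deriv r f x - g (complex_of_real x))"
      if g: "g \<in> G \<sigma> p" for g
    proof -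
      define n where "n = Lp_norm p (\<lambda>x. nth_deriv r f x - g (complex_of_real x))"
      \<comment> \<open>Induction from the \<open>r\<close>-th derivative, approximated by \<open>g\<close>, down to \<open>f\<close> itself.\<close>
      have "\<exists>Q. Q holomorphic_on UNIV \<and> exp_type_le \<sigma> Q \<and> (\<lambda>x. nth_deriv (r - k) f x - Q (complex_of_real x)) \<in> Lp p \<and>
          Lp_norm p (\<lambda>x. nth_deriv (r - k) f x - Q (complex_of_real x)) \<le> (C / \<sigma>) ^ k * n" if "k \<le> r" for k
        using that
      proof (induction k)
        case 0
        show ?case
          by (rule exI[of _ g]) (use g Lp_diff[OF p_ge1 p_lebesgue frL] in \<open>auto simp: G_def n_def\<close>)
      next
        case (Suc k)
        then obtain Q where Q: "Q holomorphic_on UNIV" "exp_type_le \<sigma> Q"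
          and QL: "(\<lambda>x. nth_deriv (r - k) f x - Q (complex_of_real x)) \<in> Lp p"
          and Qn: "Lp_norm p (\<lambda>x. nth_deriv (r - k) f x - Q (complex_of_real x)) \<le> (C / \<sigma>) ^ k * n"
          by auto
        obtain P where P: "P holomorphic_on UNIV" "exp_type_le \<sigma> P" "\<And>z. (P has_field_derivative Q z) (at z)"
          using exp_type_primitive[OF Q \<sigma>] by blast
        define j where "j = r - Suc k"
        have rk: "r - k = Suc j" using Suc.prems by (simp add: j_def)
        \<comment> \<open>Its derivative is small, namely the error of approximation one order higher.\<close>
        define u where "u x = nth_deriv j f x - P (complex_of_real x)" for x
        have uc: "continuous_on UNIV u" unfolding u_def
          using Suc.prems P(1)
          by (intro continuous_intros cont continuous_on_compose2[OF holomorphic_on_imp_continuous_on[OF P(1)]])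
            (auto simp: j_def)
        have ui: "((\<lambda>x. nth_deriv (r - k) f x - Q (complex_of_real x)) has_integral (u b - u a)) {a..b}" if "a \<le> b" for a b
        proof (cases "k = 0")
          case True
          then show ?thesis unfolding rk nth_deriv_Suc u_def
            using has_integral_deriv_diff_AC[OF AC[OF that] that P(3) holomorphic_on_imp_continuous_on[OF Q(1)]]
            by (simp add: j_def)
        next
          case False
          then show ?thesis unfolding rk nth_deriv_Suc u_def
            using Suc.prems by (intro has_integral_deriv_diff_differentiable fd that P) (auto simp: j_def)
        qed
        obtain Q' where Q': "Q' holomorphic_on UNIV" "exp_type_le \<sigma> Q'"
          and Q'L: "(\<lambda>x. u x - Q' (complex_of_real x)) \<in> Lp p"
          and Q'n: "Lp_norm p (\<lambda>x. u x - Q' (complex_of_real x)) \<le> C / \<sigma> * Lp_norm p (\<lambda>x. nth_deriv (r - k) f x - Q (complex_of_real x))"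
          using step[OF \<sigma> QL uc ui] by blast
        have eq: "(\<lambda>x. nth_deriv (r - Suc k) f x - (P (complex_of_real x) + Q' (complex_of_real x))) = (\<lambda>x. u x - Q' (complex_of_real x))"
          by (simp add: u_def j_def fun_eq_iff)
        have "C / \<sigma> * Lp_norm p (\<lambda>x. nth_deriv (r - k) f x - Q (complex_of_real x)) \<le> C / \<sigma> * ((C / \<sigma>) ^ k * n)"
          using C \<sigma> by (intro mult_left_mono Qn) auto
        then have le: "Lp_norm p (\<lambda>x. u x - Q' (complex_of_real x)) \<le> (C / \<sigma>) ^ Suc k * n" using Q'n by simp
        show ?case
          by (rule exI[of _ "\<lambda>z. P z + Q' z"])
            (use P Q' Q'L le eq exp_type_add in \<open>auto intro!: holomorphic_intros\<close>)
      qed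
      from this[of r] obtain Q where Q: "Q holomorphic_on UNIV" "exp_type_le \<sigma> Q"
        and QL: "(\<lambda>x. f x - Q (complex_of_real x)) \<in> Lp p"
        and Qn: "Lp_norm p (\<lambda>x. f x - Q (complex_of_real x)) \<le> (C / \<sigma>) ^ r * n"
        by (auto simp: nth_deriv_def)
      have "(\<lambda>x. Q (complex_of_real x)) \<in> Lp p"
        using Lp_diff[OF p_ge1 p_lebesgue fL QL] by simp
      then have QG: "Q \<in> G \<sigma> p" using Q by (simp add: G_def)
      have "best_approx \<sigma> p f \<le> Lp_norm p (\<lambda>x. f x - Q (complex_of_real x))"
        unfolding best_approx_def
      proof (rule cINF_lower[OF bdd_belowI2[of _ 0] QG])
        fix g assume "g \<in> G \<sigma> p"
        then show "0 \<le> Lp_norm p (\<lambda>x. f x - g (complex_of_real x))"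
          by (intro Lp_norm_nonneg Lp_diff p_ge1 p_lebesgue fL) (simp add: G_def)
      qed
      then show ?thesis using Qn by (simp add: n_def power_divide)
    qed
    have cr: "C ^ r / \<sigma> ^ r > 0" using C \<sigma> by simp
    have "best_approx \<sigma> p f / (C ^ r / \<sigma> ^ r) \<le> best_approx \<sigma> p (nth_deriv r f)"
      unfolding best_approx_def[of \<sigma> p "nth_deriv r f"]
    proof (rule cINF_greatest)
      have "(\<lambda>z. 0) \<in> G \<sigma> p"
        by (auto simp: G_def exp_type_le_def Lp_def modular_def intro!: exI[of _ 0] exI[of _ 1])
      then show "G \<sigma> p \<noteq> {}" by blast
      show "best_approx \<sigma> p f / (C ^ r / \<sigma> ^ r) \<le> Lp_norm p (\<lambda>x. nth_deriv r f x - g (complex_of_real x))" if "g \<in> G \<sigma> p" for g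
        unfolding pos_divide_le_eq[OF cr] using main[OF that] by (simp only: mult.commute)
    qed
    then show ?thesis unfolding pos_divide_le_eq[OF cr] by (simp only: mult.commute)
  qed
  then show ?thesis using C by (intro exI[of _ "C ^ r"]) auto
qed

end
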